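(* Let $(E,\phi)$ be an abelian $t$-module of dimension $d$ over $K$, let $D\in\mathrm{Mat}_{d\times d}(K\{\tau\})$ represent $\phi_t$ with respect to a fixed coordinate system, and let $\mathsf{M}=\mathsf{M}(E)$ be its $t$-motive. Then $\mathsf{M}$ is pure if and only if the Newton polygon of the last invariant factor $\lambda_d\in K(\!(\sigma)\!)[t]$ of $D$ consists of exactly one edge. In this case the weight $w(\mathsf{M})$ equals the reciprocal $1/s$ of the slope $s$ of this edge.
   Context: Let $\mathbb{F}_q$ be the finite field with $q$ elements, $K$ a perfect field containing $\mathbb{F}_q$, and $\ell:\mathbb{F}_q[t]\to K$ an $\mathbb{F}_q$-algebra homomorphism. $K\{\tau\}$ is the skew polynomial ring $\{\sum\alpha_i\tau^i:\alpha_i\in K\}$ with $\tau\alpha=\alpha^q\tau$, identified with $\mathbb{F}_q$-linear endomorphisms of $\mathbb{G}_a$ over $K$. $K(\!(\sigma)\!)$ is the skew Laurent series field in $\sigma$ with $\sigma\alpha=\alpha^{1/q}\sigma$, valuation $v$ = order in $\sigma$, and $K\{\tau\}\subseteq K(\!(\sigma)\!)$ via $\tau\mapsto\sigma^{-1}$. A $t$-module $(E,\phi)$ of dimension $d$: an $\mathbb{F}_q$-vector space scheme $E\cong\mathbb{G}_a^d$ over $K$ with an $\mathbb{F}_q$-algebra homomorphism $\phi:\mathbb{F}_q[t]\to\mathrm{End}_{\mathrm{grp},\mathbb{F}_q}(E)$ such that $d\phi_a-\ell(a)$ is nilpotent on $\mathrm{Lie}(E)$ for all $a$. Its $t$-motive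 $\mathsf{M}(E)=\mathrm{Hom}_{\mathrm{grp},\mathbb{F}_q}(E,\mathbb{G}_a)$ is a left $K\{\tau\}$-module (post-composition), free of rank $d=\dim E$, and a $K[t]$-module ($t$ acts by pre-composition with $\phi_t$); $E$ is abelian if $\mathsf{M}(E)$ is finitely generated over $K[t]$ (then it is free over $K[t]$ of some rank $\mathrm{rk}(E)$). Purity: $K(\!(1/t)\!)\otimes_{K[t]}\mathsf{M}$ carries the semilinear operator $\tau(f\otimes m)=f^{(1)}\otimes\tau m$, where for $f=\sum\alpha_it^{-i}$ one puts $f^{(1)}=\sum\alpha_i^qt^{-i}$. $\mathsf{M}$ (and $E$) is pure if there exist a $K[\![1/t]\!]$-lattice $\tilde\Lambda$ (finitely generated $K[\![1/t]\!]$-submodule containing a $K(\!(1/t)\!)$-basis) in $K(\!(1/t)\!)\otimes_{K[t]}\mathsf{M}$ and positive integers $u,v$ with $t^u\tilde\Lambda=\tau^v\tilde\Lambda$. The weight of $\mathsf{M}$ is $w(\mathsf{M})=\dim(E)/\mathrm{rk}(E)$. Invariant factors: elementary row and column operations over $K(\!(\sigma)\!)[t]$ ($t$ central) bring $t\mathbf{1}_d-D$ into diagonal form $\mathrm{diag}(\lambda_1,\dots,\lambda_d)$, $\lambda_i$ monic, each $\lambda_i$ a left and right divisor of $\lambda_{i+1}$; the Newton polygons of the $\lambda_i$ are independent of choices. Newton polygon of $f=\sum a_it^i$: lower convex hull of the points $(i,v(a_i))$ with $a_i\ne0$; slope of an edge from $(i,w_i)$ to $(j,w_j)$ is $(w_j-w_i)/(j-i)$.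 *)

theory Defs
  imports "HOL-Analysis.Analysis" "HOL-Computational_Algebra.Polynomial"
    "HOL-Computational_Algebra.Formal_Laurent_Series"
begin

unbundle fps_syntax

text \<open>K has characteristic p, q = p^e (e >= 1), K contains the field with q elements
  (the roots of x^q = x in K form a set of q elements) and K is perfect.\<close>
definition fq_setup :: "nat \<Rightarrow> 'k::field itself \<Rightarrow> bool" where
  "fq_setup q _ \<longleftrightarrow> (\<exists>p e. prime p \<and> e \<ge> 1 \<and> q = p ^ e \<and> of_nat p = (0::'k)
      \<and> card {x::'k. x ^ q = x} = q \<and> (\<forall>y::'k. \<exists>x. x ^ p = y))"

definition fq_elem :: "nat \<Rightarrow> 'k::field \<Rightarrow> bool" where
  "fq_elem q x \<longleftrightarrow> x ^ q = x"

section \<open>Skew polynomials K{tau}: coefficient of tau^n, tau a = a^q tau\<close>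

type_synonym 'k skp = "nat \<Rightarrow> 'k"

definition skp_fin :: "'k::zero skp \<Rightarrow> bool" where
  "skp_fin a \<longleftrightarrow> finite {n. a n \<noteq> 0}"

definition skp_mult :: "nat \<Rightarrow> 'k::field skp \<Rightarrow> 'k skp \<Rightarrow> 'k skp" where
  "skp_mult q a b = (\<lambda>n. \<Sum>i\<le>n. a i * (b (n - i)) ^ (q ^ i))"

definition skp_const :: "'k::zero \<Rightarrow> 'k skp" where
  "skp_const c = (\<lambda>n. if n = 0 then c else 0)"

definition skp_tau :: "'k::{zero,one} skp" where
  "skp_tau = (\<lambda>n. if n = 1 then 1 else 0)"

text \<open>d x d matrices over K{tau} (entries with index >= d are irrelevant / zero).\<close>
type_synonym 'k skmat = "nat \<Rightarrow> nat \<Rightarrow> 'k skp"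

definition skmat_mult :: "nat \<Rightarrow> nat \<Rightarrow> 'k::field skmat \<Rightarrow> 'k skmat \<Rightarrow> 'k skmat" where
  "skmat_mult q d A B = (\<lambda>i j n. if i < d \<and> j < d then (\<Sum>k<d. skp_mult q (A i k) (B k j) n) else 0)"

definition skmat_one :: "nat \<Rightarrow> 'k::field skmat" where
  "skmat_one d = (\<lambda>i j. if i = j \<and> i < d then skp_const 1 else (\<lambda>_. 0))"

primrec skmat_pow :: "nat \<Rightarrow> nat \<Rightarrow> 'k::field skmat \<Rightarrow> nat \<Rightarrow> 'k skmat" where
  "skmat_pow q d A 0 = skmat_one d"
| "skmat_pow q d A (Suc k) = skmat_mult q d (skmat_pow q d A k) A"

text \<open>phi_a = a(phi_t) for a in F_q[t]; scalars c in F_q act as c * id.\<close>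
definition phi :: "nat \<Rightarrow> nat \<Rightarrow> 'k::field skmat \<Rightarrow> 'k poly \<Rightarrow> 'k skmat" where
  "phi q d D a = (\<lambda>i j n. \<Sum>k\<le>degree a. coeff a k * skmat_pow q d D k i j n)"

text \<open>Differential on Lie(E) = K^d: the constant (tau^0) coefficients.\<close>
definition dphi :: "nat \<Rightarrow> nat \<Rightarrow> 'k::field skmat \<Rightarrow> 'k poly \<Rightarrow> nat \<Rightarrow> nat \<Rightarrow> 'k" where
  "dphi q d D a = (\<lambda>i j. phi q d D a i j 0)"

definition kmat_mult :: "nat \<Rightarrow> (nat \<Rightarrow> nat \<Rightarrow> 'k::field) \<Rightarrow> (nat \<Rightarrow> nat \<Rightarrow> 'k) \<Rightarrow> nat \<Rightarrow> nat \<Rightarrow> 'k" where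
  "kmat_mult d A B = (\<lambda>i j. \<Sum>k<d. A i k * B k j)"

primrec kmat_pow :: "nat \<Rightarrow> (nat \<Rightarrow> nat \<Rightarrow> 'k::field) \<Rightarrow> nat \<Rightarrow> nat \<Rightarrow> nat \<Rightarrow> 'k" where
  "kmat_pow d A 0 = (\<lambda>i j. if i = j then 1 else 0)"
| "kmat_pow d A (Suc k) = kmat_mult d (kmat_pow d A k) A"

definition kmat_nilpotent :: "nat \<Rightarrow> (nat \<Rightarrow> nat \<Rightarrow> 'k::field) \<Rightarrow> bool" where
  "kmat_nilpotent d A \<longleftrightarrow> (\<exists>N. \<forall>i<d. \<forall>j<d. kmat_pow d A N i j = 0)"

section \<open>t-modules E = G_a^d with phi_t given by D, ell(t) = theta\<close>

definition tmodule :: "nat \<Rightarrow> 'k::field \<Rightarrow> nat \<Rightarrow> 'k skmat \<Rightarrow> bool" where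
  "tmodule q \<theta> d D \<longleftrightarrow> (\<forall>i<d. \<forall>j<d. skp_fin (D i j)) \<and>
     (\<forall>a::'k poly. (\<forall>k. fq_elem q (coeff a k)) \<longrightarrow>
        kmat_nilpotent d (\<lambda>i j. dphi q d D a i j - (if i = j then poly a \<theta> else 0)))"

section \<open>The t-motive M(E) = Hom(E, G_a) = row vectors over K{tau}\<close>

type_synonym 'k skvec = "nat \<Rightarrow> 'k skp"

definition motive :: "nat \<Rightarrow> 'k::field skvec set" where
  "motive d = {m. (\<forall>i. d \<le> i \<longrightarrow> m i = (\<lambda>_. 0)) \<and> (\<forall>i<d. skp_fin (m i))}"

definition vecmat :: "nat \<Rightarrow> nat \<Rightarrow> 'k::field skvec \<Rightarrow> 'k skmat \<Rightarrow> 'k skvec" where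
  "vecmat q d m A = (\<lambda>j n. if j < d then (\<Sum>i<d. skp_mult q (m i) (A i j) n) else 0)"

primrec tpow :: "nat \<Rightarrow> nat \<Rightarrow> 'k::field skmat \<Rightarrow> 'k skvec \<Rightarrow> nat \<Rightarrow> 'k skvec" where
  "tpow q d D m 0 = m"
| "tpow q d D m (Suc k) = vecmat q d (tpow q d D m k) D"

text \<open>K[t]-module structure: K acts by post-composition (left), t by pre-composition with phi_t.\<close>
definition kt_act :: "nat \<Rightarrow> nat \<Rightarrow> 'k::field skmat \<Rightarrow> 'k poly \<Rightarrow> 'k skvec \<Rightarrow> 'k skvec" where
  "kt_act q d D p m = (\<lambda>j n. \<Sum>k\<le>degree p. coeff p k * tpow q d D m k j n)"

definition tau_act :: "nat \<Rightarrow> 'k::field skvec \<Rightarrow> 'k skvec" where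
  "tau_act q m = (\<lambda>j. skp_mult q skp_tau (m j))"

definition kt_comb :: "nat \<Rightarrow> nat \<Rightarrow> 'k::field skmat \<Rightarrow> nat \<Rightarrow> (nat \<Rightarrow> 'k poly) \<Rightarrow> (nat \<Rightarrow> 'k skvec) \<Rightarrow> 'k skvec" where
  "kt_comb q d D r ps bs = (\<lambda>j n. \<Sum>k<r. kt_act q d D (ps k) (bs k) j n)"

definition abelian :: "nat \<Rightarrow> nat \<Rightarrow> 'k::field skmat \<Rightarrow> bool" where
  "abelian q d D \<longleftrightarrow> (\<exists>r bs. (\<forall>k<r. bs k \<in> motive d) \<and>
      (\<forall>m\<in>motive d. \<exists>ps. m = kt_comb q d D r ps bs))"

definition kt_basis :: "nat \<Rightarrow> nat \<Rightarrow> 'k::field skmat \<Rightarrow> nat \<Rightarrow> (nat \<Rightarrow> 'k skvec) \<Rightarrow> bool" where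
  "kt_basis q d D r bs \<longleftrightarrow> (\<forall>k<r. bs k \<in> motive d) \<and>
      (\<forall>m\<in>motive d. \<exists>ps. m = kt_comb q d D r ps bs) \<and>
      (\<forall>ps. kt_comb q d D r ps bs = (\<lambda>_ _. 0) \<longrightarrow> (\<forall>k<r. ps k = 0))"

definition motive_rank :: "nat \<Rightarrow> nat \<Rightarrow> 'k::field skmat \<Rightarrow> nat" where
  "motive_rank q d D = (THE r. \<exists>bs. kt_basis q d D r bs)"

definition weight :: "nat \<Rightarrow> nat \<Rightarrow> 'k::field skmat \<Rightarrow> real" where
  "weight q d D = real d / real (motive_rank q d D)"

section \<open>Purity.  K((1/t)) is modelled by 'k fls in the variable X = 1/t (so t = fls_X_inv);
  K((1/t)) \<otimes> M is identified with K((1/t))^r via a K[t]-basis bs of M.\<close>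

definition fls_frob :: "nat \<Rightarrow> 'k::field fls \<Rightarrow> 'k fls" where
  "fls_frob q f = Abs_fls (\<lambda>n. (f $$ n) ^ q)"

definition kt_to_fls :: "'k::field poly \<Rightarrow> 'k fls" where
  "kt_to_fls p = (\<Sum>k\<le>degree p. fls_const (coeff p k) * fls_X_inv ^ k)"

definition pows_ring :: "'k::field fls set" where
  "pows_ring = {f. f = 0 \<or> 0 \<le> fls_subdegree f}"

definition flvec_space :: "nat \<Rightarrow> (nat \<Rightarrow> 'k::field fls) set" where
  "flvec_space r = {x. \<forall>i. r \<le> i \<longrightarrow> x i = 0}"

definition fls_basis :: "nat \<Rightarrow> (nat \<Rightarrow> nat \<Rightarrow> 'k::field fls) \<Rightarrow> bool" where
  "fls_basis r es \<longleftrightarrow> (\<forall>k<r. es k \<in> flvec_space r) \<and>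
     (\<forall>x\<in>flvec_space r. \<exists>c. x = (\<lambda>i. \<Sum>k<r. c k * es k i)) \<and>
     (\<forall>c. (\<lambda>i. \<Sum>k<r. c k * es k i) = (\<lambda>_. 0) \<longrightarrow> (\<forall>k<r. c k = 0))"

definition is_lattice :: "nat \<Rightarrow> (nat \<Rightarrow> 'k::field fls) set \<Rightarrow> bool" where
  "is_lattice r L \<longleftrightarrow>
     (\<exists>(gs :: nat \<Rightarrow> nat \<Rightarrow> 'k fls) n. (\<forall>j<n. gs j \<in> flvec_space r) \<and>
        L = {(\<lambda>i. \<Sum>j<n. c j * gs j i) | c :: nat \<Rightarrow> 'k fls. \<forall>j<n. c j \<in> pows_ring}) \<and>
     (\<exists>es :: nat \<Rightarrow> nat \<Rightarrow> 'k fls. (\<forall>k<r. es k \<in> L) \<and> fls_basis r es)"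

text \<open>tau (sum f_k \<otimes> b_k) = sum f_k^(1) \<otimes> tau b_k, where tau b_k = sum_l A k l b_l.\<close>
definition tau_fl :: "nat \<Rightarrow> nat \<Rightarrow> (nat \<Rightarrow> nat \<Rightarrow> 'k::field poly) \<Rightarrow> (nat \<Rightarrow> 'k fls) \<Rightarrow> nat \<Rightarrow> 'k fls" where
  "tau_fl q r A x = (\<lambda>l. if l < r then (\<Sum>k<r. fls_frob q (x k) * kt_to_fls (A k l)) else 0)"

definition pure :: "nat \<Rightarrow> nat \<Rightarrow> 'k::field skmat \<Rightarrow> bool" where
  "pure q d D \<longleftrightarrow> (\<exists>r bs A. kt_basis q d D r bs \<and>
      (\<forall>k<r. tau_act q (bs k) = kt_comb q d D r (A k) bs) \<and>
      (\<exists>L u v. is_lattice r L \<and> 0 < u \<and> 0 < v \<and>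
         (\<lambda>x i. fls_X_inv ^ u * x i) ` L = (tau_fl q r A ^^ v) ` L))"

section \<open>Skew Laurent series K((sigma)), sigma a = a^(1/q) sigma, stored as 'k fls
  (coefficient n = coefficient of sigma^n)\<close>

definition invfrob :: "nat \<Rightarrow> 'k::field \<Rightarrow> 'k" where
  "invfrob q x = (THE y. y ^ q = x)"

definition frob_int :: "nat \<Rightarrow> int \<Rightarrow> 'k::field \<Rightarrow> 'k" where
  "frob_int q k x = (if 0 \<le> k then x ^ (q ^ nat k) else (invfrob q ^^ nat (- k)) x)"

definition sl_mult :: "nat \<Rightarrow> 'k::field fls \<Rightarrow> 'k fls \<Rightarrow> 'k fls" where
  "sl_mult q f g = Abs_fls (\<lambda>n. \<Sum>i\<in>{fls_subdegree f .. n - fls_subdegree g}.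
       f $$ i * frob_int q (- i) (g $$ (n - i)))"

text \<open>Embedding K{tau} into K((sigma)), tau \<mapsto> sigma^(-1).\<close>
definition tau_to_sigma :: "'k::field skp \<Rightarrow> 'k fls" where
  "tau_to_sigma a = Abs_fls (\<lambda>k. if k \<le> 0 then a (nat (- k)) else 0)"

section \<open>Polynomials over K((sigma)) in a central variable t\<close>

type_synonym 'k slp = "nat \<Rightarrow> 'k fls"

definition slp_fin :: "'k::field slp \<Rightarrow> bool" where
  "slp_fin a \<longleftrightarrow> finite {n. a n \<noteq> 0}"

definition slp_mult :: "nat \<Rightarrow> 'k::field slp \<Rightarrow> 'k slp \<Rightarrow> 'k slp" where
  "slp_mult q a b = (\<lambda>n. \<Sum>i\<le>n. sl_mult q (a i) (b (n - i)))"

definition slp_one :: "'k::field slp" where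
  "slp_one = (\<lambda>n. if n = 0 then 1 else 0)"

definition slp_unit :: "nat \<Rightarrow> 'k::field slp \<Rightarrow> bool" where
  "slp_unit q u \<longleftrightarrow> slp_fin u \<and> (\<exists>w. slp_fin w \<and> slp_mult q u w = slp_one \<and> slp_mult q w u = slp_one)"

definition slp_monic :: "'k::field slp \<Rightarrow> bool" where
  "slp_monic f \<longleftrightarrow> slp_fin f \<and> (\<exists>n. f n = 1 \<and> (\<forall>m>n. f m = 0))"

type_synonym 'k slmat = "nat \<Rightarrow> nat \<Rightarrow> 'k slp"

definition charmat :: "nat \<Rightarrow> 'k::field skmat \<Rightarrow> 'k slmat" where
  "charmat d D = (\<lambda>i j n. if i < d \<and> j < d then
       (if n = 1 \<and> i = j then 1 else 0) - (if n = 0 then tau_to_sigma (D i j) else 0) else 0)"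

inductive elem_equiv :: "nat \<Rightarrow> nat \<Rightarrow> 'k::field slmat \<Rightarrow> 'k slmat \<Rightarrow> bool" for q d where
  refl: "elem_equiv q d A A"
| row_add: "elem_equiv q d A B \<Longrightarrow> i < d \<Longrightarrow> j < d \<Longrightarrow> i \<noteq> j \<Longrightarrow> slp_fin c \<Longrightarrow>
    elem_equiv q d A (B(i := (\<lambda>k n. B i k n + slp_mult q c (B j k) n)))"
| col_add: "elem_equiv q d A B \<Longrightarrow> i < d \<Longrightarrow> j < d \<Longrightarrow> i \<noteq> j \<Longrightarrow> slp_fin c \<Longrightarrow>
    elem_equiv q d A (\<lambda>r k. if k = j then (\<lambda>n. B r j n + slp_mult q (B r i) c n) else B r k)"
| row_swap: "elem_equiv q d A B \<Longrightarrow> i < d \<Longrightarrow> j < d \<Longrightarrow>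
    elem_equiv q d A (B(i := B j, j := B i))"
| col_swap: "elem_equiv q d A B \<Longrightarrow> i < d \<Longrightarrow> j < d \<Longrightarrow>
    elem_equiv q d A (\<lambda>r. (B r)(i := B r j, j := B r i))"
| row_scale: "elem_equiv q d A B \<Longrightarrow> i < d \<Longrightarrow> slp_unit q u \<Longrightarrow>
    elem_equiv q d A (B(i := (\<lambda>k. slp_mult q u (B i k))))"
| col_scale: "elem_equiv q d A B \<Longrightarrow> j < d \<Longrightarrow> slp_unit q u \<Longrightarrow>
    elem_equiv q d A (\<lambda>r. (B r)(j := slp_mult q (B r j) u))"

definition invariant_factors :: "nat \<Rightarrow> nat \<Rightarrow> 'k::field skmat \<Rightarrow> (nat \<Rightarrow> 'k slp) \<Rightarrow> bool" where
  "invariant_factors q d D lam \<longleftrightarrow>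
     (\<exists>B. elem_equiv q d (charmat d D) B \<and>
        (\<forall>i<d. \<forall>j<d. i \<noteq> j \<longrightarrow> B i j = (\<lambda>_. 0)) \<and> (\<forall>i<d. B i i = lam i)) \<and>
     (\<forall>i<d. slp_monic (lam i)) \<and>
     (\<forall>i. i + 1 < d \<longrightarrow> (\<exists>x. slp_fin x \<and> lam (i + 1) = slp_mult q (lam i) x) \<and>
                         (\<exists>y. slp_fin y \<and> lam (i + 1) = slp_mult q y (lam i)))"

section \<open>Newton polygons (valuation v = order in sigma = fls_subdegree)\<close>

definition np_points :: "'k::field slp \<Rightarrow> (real \<times> real) set" where
  "np_points f = {(real i, real_of_int (fls_subdegree (f i))) | i. f i \<noteq> 0}"

definition np_low :: "'k::field slp \<Rightarrow> nat" where
  "np_low f = Min {n. f n \<noteq> 0}"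

definition np_deg :: "'k::field slp \<Rightarrow> nat" where
  "np_deg f = Max {n. f n \<noteq> 0}"

definition np_lower :: "'k::field slp \<Rightarrow> real \<Rightarrow> real" where
  "np_lower f x = Inf {y. (x, y) \<in> convex hull (np_points f)}"

definition np_slope :: "'k::field slp \<Rightarrow> real" where
  "np_slope f = (np_lower f (real (np_deg f)) - np_lower f (real (np_low f)))
                 / (real (np_deg f) - real (np_low f))"

definition np_one_edge :: "'k::field slp \<Rightarrow> bool" where
  "np_one_edge f \<longleftrightarrow> np_low f < np_deg f \<and>
     (\<forall>x\<in>{real (np_low f) .. real (np_deg f)}.
        np_lower f x = np_lower f (real (np_low f)) + np_slope f * (x - real (np_low f)))"

end

theory Submission
  imports Defs "HOL-Library.Function_Algebras"
begin

text \<open>Let V be the space of row vectors over K((sigma)), on which t acts by D. As a module over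
  K((sigma))[t] it is the sum of the quotients by the lambda i, and it contains M. The Newton polygon of the
  last invariant factor is one edge of slope s if and only if, with an error bounded independently of n, the
  operator t^n lowers the order of every vector of V by s n: if the polygon is one edge, so are those of the
  divisors lambda i, and multiplication by t can be computed by division with remainder; if it is not, a
  factor belonging to another slope grows at another rate. By approximation it suffices to test this on M,
  where it says that t^n raises the degree in tau by s n.

  Compare the degree in tau with the degree in t relative to a basis of M over K[t]. Both filter M by
  finite-dimensional spaces, so if t raises the first degree by s, then the degrees agree up to the factor s
  and a bounded error, and tau raises the second degree by 1/s; the converse is symmetric. Counting
  dimensions gives rk M = s d. By approximation again, tau raises the order of pole by 1/s on the space
  K((1/t))^r. If 1/s = u/v, the vectors x with t^(-u n) tau^(v n) x integral for all large n
  form a lattice as required by purity, and conversely such a lattice forces this growth.\<close>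

section \<open>Skew Laurent series and Gauss valuations\<close>

text \<open>The claim about another slope is proved without factoring the polynomial. If the line of
  slope s supporting the Newton polygon touches it last at an index j below the degree, then modulo
  the polynomial t^j agrees with something of lower degree plus an error as small as desired, and
  uniform growth does not tolerate such small representatives. The upper growth bound puts the
  polygon above the line of slope s through its right end; the lower one, used after reversing the
  polynomial, puts the constant coefficient on that line.

  A polygon with one edge does not notice a power of t dividing the polynomial, so the constant
  coefficient has to be shown nonzero. Here finite generation of M over K[t] enters, through the
  injectivity of D on V. Together with growth it also yields s > 0, torsion-freeness and hence a
  K[t]-basis of M. Equality of lattices requires tau to be bijective on K((1/t))^r, which comes from
  the finite dimension of M / tau M over K.\<close>

lemma sum_fun_apply: "(\<Sum>i\<in>A. f i) x = (\<Sum>i\<in>A. f i x)"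
  by (induction A rule: infinite_finite_induct) auto

locale skew =
  fixes q :: nat and K :: "'k::field itself"
  assumes fq: "fq_setup q K"
begin

section \<open>The Frobenius of K and its integral powers\<close>

lemma q_CHAR: "prime CHAR('k)" "\<exists>e\<ge>1. q = CHAR('k) ^ e" "\<exists>x. x ^ CHAR('k) = (y::'k)"
proof -
  obtain p e where p: "prime p" "e \<ge> 1" "q = p ^ e" "of_nat p = (0::'k)"
    and r: "\<And>y::'k. \<exists>x. x ^ p = y"
    using fq unfolding fq_setup_def by blast
  have "CHAR('k) dvd p" using p(4) by (simp add: of_nat_eq_0_iff_char_dvd)
  then have "CHAR('k) = p"
    using p(1) by (metis CHAR_not_1' One_nat_def prime_nat_iff)
  then show "prime CHAR('k)" "\<exists>e\<ge>1. q = CHAR('k) ^ e" "\<exists>x. x ^ CHAR('k) = (y::'k)"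
    using p r by auto
qed

lemma q_gt_1: "q > 1"
  using q_CHAR(1,2) by (metis one_le_numeral prime_gt_1_nat one_less_power less_le_trans zero_less_one)

lemma q_pos [simp]: "q > 0" "q \<noteq> 0"
  using q_gt_1 by auto

lemma frob_add: "((x::'k) + y) ^ q = x ^ q + y ^ q"
  using q_CHAR freshmans_dream' by blast

lemma frob_minus: "(- (x::'k)) ^ q = - (x ^ q)"
  using frob_add[of x "-x"] by (simp add: add_eq_0_iff power_0_left)

lemma frob_inj: "(x::'k) ^ q = y ^ q \<longleftrightarrow> x = y"
proof
  assume "x ^ q = y ^ q"
  then have "(x - y) ^ q = 0" using frob_add[of x "-y"] by (simp add: frob_minus)
  then show "x = y" by simp
qed simp

text \<open>Perfectness provides p-th roots only; a root of order p^e is obtained by taking e of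
  them in succession.\<close>

lemma frob_surj: "\<exists>x. x ^ q = (y::'k)"
proof -
  have "\<exists>x. x ^ (CHAR('k) ^ e) = (y::'k)" for e
  proof (induction e arbitrary: y)
    case (Suc e)
    obtain z where z: "z ^ CHAR('k) = y" using q_CHAR(3) by blast
    obtain x where "x ^ (CHAR('k) ^ e) = z" using Suc by blast
    then have "x ^ (CHAR('k) ^ Suc e) = y" using z by (metis power_Suc2 power_mult)
    then show ?case by blast
  qed auto
  then show ?thesis using q_CHAR(2) by metis
qed

lemma invfrob_pow [simp]: "invfrob q x ^ q = (x::'k)"
  unfolding invfrob_def by (rule theI') (metis frob_surj frob_inj)

lemma invfrob_of_pow [simp]: "invfrob q (x ^ q) = (x::'k)"
  using frob_inj invfrob_pow by blast

abbreviation phi_int :: "int \<Rightarrow> 'k \<Rightarrow> 'k" where "phi_int \<equiv> frob_int q"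

lemma phi_nat: "phi_int (int n) x = x ^ (q ^ n)"
  by (simp add: frob_int_def)

lemma phi_0 [simp]: "phi_int 0 x = x"
  by (simp add: frob_int_def)

lemma phi_Suc: "phi_int (k + 1) x = (phi_int k x) ^ q"
proof (cases "k \<ge> 0")
  case True
  then have "nat (k + 1) = Suc (nat k)" by simp
  then show ?thesis using True by (simp add: frob_int_def flip: power_mult) (simp add: mult.commute)
next
  case False
  then have "nat (- k) = Suc (nat (- (k + 1)))" by simp
  then show ?thesis using False by (auto simp: frob_int_def)
qed

text \<open>Since the step is an equivalence, it serves both directions of induction over the
  integers. For the laws of \<open>phi_int\<close> it combines a property of the q-power map with
  its injectivity, so negative powers need no separate treatment.\<close>

lemma phi_ind: assumes "P 0" "\<And>k. P k \<longleftrightarrow> P (k + 1)" shows "P (k::int)"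
proof (induction k rule: int_induct[where k = 0])
  case (step2 i) then show ?case using assms(2)[of "i - 1"] by simp
qed (use assms in auto)

lemma phi_comp: "phi_int (k + l) x = phi_int k (phi_int l x)"
proof (induction k rule: phi_ind)
  case (2 k)
  have "k + 1 + l = (k + l) + 1" by simp
  then show ?case by (metis phi_Suc frob_inj)
qed simp

lemma phi_add: "phi_int k (x + y) = phi_int k x + phi_int k y"
  by (induction k rule: phi_ind) (simp, metis phi_Suc frob_inj frob_add)

lemma phi_mult: "phi_int k (x * y) = phi_int k x * phi_int k y"
  by (induction k rule: phi_ind) (simp, metis phi_Suc frob_inj power_mult_distrib)

lemma phi_one [simp]: "phi_int k 1 = 1"
  by (induction k rule: phi_ind) (simp, metis phi_Suc frob_inj power_one)

lemma phi_zero [simp]: "phi_int k 0 = 0"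
  by (metis add_cancel_left_left add_0 phi_add)

lemma phi_inverse [simp]: "phi_int k (phi_int (- k) x) = x" "phi_int (- k) (phi_int k x) = x"
  by (simp_all flip: phi_comp)

lemma phi_eq_0 [simp]: "phi_int k x = 0 \<longleftrightarrow> x = 0"
  by (metis phi_inverse(2) phi_zero)

lemma phi_sum: "phi_int k (sum f A) = (\<Sum>i\<in>A. phi_int k (f i))"
  by (induction A rule: infinite_finite_induct) (auto simp: phi_add)

section \<open>Multiplication of skew Laurent series\<close>

abbreviation smul :: "'k fls \<Rightarrow> 'k fls \<Rightarrow> 'k fls" (infixl "\<star>" 70)
  where "f \<star> g \<equiv> sl_mult q f g"

text \<open>The definition sums between the exact orders of the factors. Here any lower bounds for
  the two supports are allowed, so several products can be expanded over one common range without
  computing the order of a sum or a product.\<close>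

lemma sl_nth:
  assumes "\<And>n. n < A \<Longrightarrow> f $$ n = 0" "\<And>n. n < B \<Longrightarrow> g $$ n = 0"
  shows "(f \<star> g) $$ n = (\<Sum>i\<in>{A..n-B}. f $$ i * phi_int (- i) (g $$ (n - i)))"
proof -
  have 1: "(f \<star> g) $$ n = (\<Sum>i\<in>{fls_subdegree f..n - fls_subdegree g}. f $$ i * phi_int (- i) (g $$ (n - i)))"
    unfolding sl_mult_def
    by (rule nth_Abs_fls_lower_bound[where N="fls_subdegree f + fls_subdegree g"]) auto
  \<comment> \<open>\<open>fls_subdegree 0\<close> is 0 by convention and bounds nothing, so zero
    factors are treated apart.\<close>
  show ?thesis
  proof (cases "f = 0 \<or> g = 0")
    case True then show ?thesis unfolding 1 by auto
  next
    case False
    then have "A \<le> fls_subdegree f" "B \<le> fls_subdegree g"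
      using assms by (meson linorder_not_less nth_fls_subdegree_nonzero)+
    then show ?thesis unfolding 1
      by (intro sum.mono_neutral_left) auto
  qed
qed

lemma fls_lower2: "\<exists>A. (\<forall>n<A. (f::'k fls) $$ n = 0) \<and> (\<forall>n<A. (g::'k fls) $$ n = 0)"
  by (intro exI[of _ "min (fls_subdegree f) (fls_subdegree g)"]) auto

lemma fls_lower3: "\<exists>A. (\<forall>n<A. (f::'k fls) $$ n = 0) \<and> (\<forall>n<A. (g::'k fls) $$ n = 0) \<and> (\<forall>n<A. (h::'k fls) $$ n = 0)"
  by (intro exI[of _ "min (fls_subdegree h) (min (fls_subdegree f) (fls_subdegree g))"]) auto

lemma sl_add_left: "(f + g) \<star> h = f \<star> h + g \<star> h"
proof -
  obtain A where A: "\<And>n. n < A \<Longrightarrow> f $$ n = 0" "\<And>n. n < A \<Longrightarrow> g $$ n = 0" "\<And>n. n < A \<Longrightarrow> h $$ n = 0"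
    using fls_lower3 by meson
  show ?thesis
    by (rule fls_eqI) (simp add: A sl_nth[where A=A and B=A] sum.distrib algebra_simps)
qed

lemma sl_add_right: "h \<star> (f + g) = h \<star> f + h \<star> g"
proof -
  obtain A where A: "\<And>n. n < A \<Longrightarrow> f $$ n = 0" "\<And>n. n < A \<Longrightarrow> g $$ n = 0" "\<And>n. n < A \<Longrightarrow> h $$ n = 0"
    using fls_lower3 by meson
  show ?thesis
    by (rule fls_eqI) (simp add: A sl_nth[where A=A and B=A] sum.distrib phi_add algebra_simps)
qed

lemma sl_zero [simp]: "0 \<star> f = 0" "f \<star> 0 = 0"
  by (metis add_cancel_left_left add_0 sl_add_left, metis add_cancel_left_left add_0 sl_add_right)

lemma sl_minus_left: "(- f) \<star> g = - (f \<star> g)"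
  using sl_add_left[of f "- f" g] by (simp add: add_eq_0_iff)

lemma sl_minus_right: "f \<star> (- g) = - (f \<star> g)"
  using sl_add_right[of f g "- g"] by (simp add: add_eq_0_iff)

lemma sl_sum_left: "sum f A \<star> g = (\<Sum>i\<in>A. f i \<star> g)"
  by (induction A rule: infinite_finite_induct) (auto simp: sl_add_left)

lemma sl_sum_right: "g \<star> sum f A = (\<Sum>i\<in>A. g \<star> f i)"
  by (induction A rule: infinite_finite_induct) (auto simp: sl_add_right)

text \<open>The monomial c sigma^k.\<close>

definition smon :: "'k \<Rightarrow> int \<Rightarrow> 'k fls" where
  "smon c k = fls_shift (- k) (fls_const c)"

lemma smon_nth: "smon c k $$ n = (if n = k then c else 0)"
  by (simp add: smon_def)

lemma smon_mult_nth: "(smon c k \<star> f) $$ n = c * phi_int (- k) (f $$ (n - k))"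
proof -
  define A where "A = min k (fls_subdegree f)"
  have "(smon c k \<star> f) $$ n = (\<Sum>i\<in>{min k (n - fls_subdegree f)..n-fls_subdegree f}. smon c k $$ i * phi_int (- i) (f $$ (n - i)))"
    by (rule sl_nth) (auto simp: smon_nth)
  also have "\<dots> = (\<Sum>i\<in>{min k (n - fls_subdegree f)..n-fls_subdegree f}. if i = k then c * phi_int (- k) (f $$ (n - k)) else 0)"
    by (intro sum.cong) (auto simp: smon_nth)
  also have "\<dots> = c * phi_int (- k) (f $$ (n - k))"
    by auto
  finally show ?thesis .
qed

lemma smon_1_0: "smon 1 0 = 1"
  by (simp add: smon_def)

lemma sl_one [simp]: "1 \<star> f = f" "f \<star> 1 = f"
proof -
  show "1 \<star> f = f" by (rule fls_eqI) (simp add: smon_mult_nth flip: smon_1_0)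
  show "f \<star> 1 = f"
  proof (rule fls_eqI)
    fix n
    have "(f \<star> 1) $$ n = (\<Sum>i\<in>{min n (fls_subdegree f)..n-0}. f $$ i * phi_int (- i) (1 $$ (n - i)))"
      by (rule sl_nth) auto
    also have "\<dots> = (\<Sum>i\<in>{min n (fls_subdegree f)..n-0}. if i = n then f $$ n else 0)"
      by (intro sum.cong) auto
    also have "\<dots> = f $$ n" by auto
    finally show "(f \<star> 1) $$ n = f $$ n" .
  qed
qed

text \<open>Both sides are sums of products of f_i, g_j and h_(n-i-j), with the twist -i on g_j and
  -(i + j) on the last factor; on the right the latter arises as the composite of the twists -i and
  -j.\<close>

lemma sl_assoc: "(f \<star> g) \<star> h = f \<star> (g \<star> h)"
proof (rule fls_eqI)
  fix n
  obtain A where A: "\<And>n. n < A \<Longrightarrow> f $$ n = 0" "\<And>n. n < A \<Longrightarrow> g $$ n = 0" "\<And>n. n < A \<Longrightarrow> h $$ n = 0"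
    using fls_lower3 by meson
  have fg: "(f \<star> g) $$ k = 0" if "k < A + A" for k
    using that by (subst sl_nth[where A=A and B=A]) (auto simp: A)
  have gh: "(g \<star> h) $$ k = 0" if "k < A + A" for k
    using that by (subst sl_nth[where A=A and B=A]) (auto simp: A)
  define F where "F i j = f $$ i * phi_int (- i) (g $$ j) * phi_int (- (i + j)) (h $$ (n - i - j))" for i j
  have "((f \<star> g) \<star> h) $$ n = (\<Sum>k\<in>{A+A..n-A}. \<Sum>i\<in>{A..k-A}. F i (k - i))"
    by (subst sl_nth[where A="A+A" and B=A])
      (auto simp: fg A sl_nth[where A=A and B=A] sum_distrib_right F_def intro!: sum.cong)
  also have "\<dots> = (\<Sum>(k,i)\<in>(SIGMA k:{A+A..n-A}. {A..k-A}). F i (k - i))"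
    by (simp add: sum.Sigma)
  also have "\<dots> = (\<Sum>(i,j)\<in>(SIGMA i:{A..n-(A+A)}. {A..n-i-A}). F i j)"
    by (rule sum.reindex_bij_witness[of _ "\<lambda>(i,j). (i+j,i)" "\<lambda>(k,i). (i,k-i)"]) auto
  also have "\<dots> = (\<Sum>i\<in>{A..n-(A+A)}. \<Sum>j\<in>{A..n-i-A}. F i j)"
    by (simp add: sum.Sigma)
  also have "\<dots> = (f \<star> (g \<star> h)) $$ n"
  proof -
    have e: "phi_int (- i) (phi_int (- j) x) = phi_int (- i - j) x" for i j x
      by (simp flip: phi_comp)
    show ?thesis
    by (subst sl_nth[where A=A and B="A+A"])
      (auto simp: gh A sl_nth[where A=A and B=A] sum_distrib_left F_def phi_sum phi_mult mult.assoc e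
           intro!: sum.cong)
  qed
  finally show "((f \<star> g) \<star> h) $$ n = (f \<star> (g \<star> h)) $$ n" .
qed

text \<open>Order at least c, with c real since slopes need not be integers. Phrased through
  coefficients, it holds for 0 with every c, and sums need no case distinction.\<close>

definition vge :: "'k fls \<Rightarrow> real \<Rightarrow> bool" where
  "vge f c \<longleftrightarrow> (\<forall>n. real_of_int n < c \<longrightarrow> f $$ n = 0)"

lemma vge_0 [simp]: "vge 0 c" by (simp add: vge_def)

lemma vge_mono: "vge f c \<Longrightarrow> c' \<le> c \<Longrightarrow> vge f c'" by (auto simp: vge_def)

lemma vge_add: "vge f c \<Longrightarrow> vge g c \<Longrightarrow> vge (f + g) c" by (simp add: vge_def)
lemma vge_minus: "vge f c \<Longrightarrow> vge (- f) c" by (simp add: vge_def)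
lemma vge_diff: "vge f c \<Longrightarrow> vge g c \<Longrightarrow> vge (f - g) c" by (simp add: vge_def)
lemma vge_sum: "(\<And>i. i \<in> A \<Longrightarrow> vge (f i) c) \<Longrightarrow> vge (sum f A) c"
  by (induction A rule: infinite_finite_induct) (auto simp: vge_add)

lemma vge_mult: assumes "vge f a" "vge g b" shows "vge (f \<star> g) (a + b)"
  unfolding vge_def
proof (intro allI impI)
  fix n :: int assume n: "real_of_int n < a + b"
  obtain A where A: "\<And>n. n < A \<Longrightarrow> f $$ n = 0" "\<And>n. n < A \<Longrightarrow> g $$ n = 0"
    using fls_lower2 by meson
  have "f $$ i * phi_int (- i) (g $$ (n - i)) = 0" for i
  proof (cases "real_of_int i < a")
    case True then show ?thesis using assms(1) by (simp add: vge_def)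
  next
    case False
    then have "real_of_int (n - i) < b" using n by simp
    then show ?thesis using assms(2) unfolding vge_def by simp
  qed
  then show "(f \<star> g) $$ n = 0" by (subst sl_nth[where A=A and B=A]) (auto simp only: A intro!: sum.neutral)
qed

lemma vge_subdegree: "vge f (real_of_int (fls_subdegree f))" by (simp add: vge_def)

lemma vge_iff: "f \<noteq> 0 \<Longrightarrow> vge f c \<longleftrightarrow> c \<le> real_of_int (fls_subdegree f)"
  by (metis vge_mono vge_subdegree vge_def nth_fls_subdegree_nonzero linorder_not_less)

lemma vge_one: "vge 1 c \<longleftrightarrow> c \<le> 0"
  by (simp add: vge_iff)

lemma vge_smon: "vge (smon c k) (real_of_int k)" by (simp add: vge_def smon_nth)

lemma sl_mult_lead:
  assumes "vge f (real_of_int a)" "vge g (real_of_int b)"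
  shows "(f \<star> g) $$ (a + b) = f $$ a * phi_int (- a) (g $$ b)"
  using assms by (subst sl_nth[where A=a and B=b]) (auto simp: vge_def)

text \<open>The twist is injective, so the lowest coefficients multiply to a nonzero element of K.
  Orders add, and there are no zero divisors.\<close>

lemma sl_subdegree_mult:
  assumes "f \<noteq> 0" "g \<noteq> 0"
  shows "f \<star> g \<noteq> 0" "fls_subdegree (f \<star> g) = fls_subdegree f + fls_subdegree g"
proof -
  let ?n = "fls_subdegree f + fls_subdegree g"
  have 1: "(f \<star> g) $$ ?n \<noteq> 0"
    using assms by (simp add: sl_mult_lead vge_subdegree)
  then show "f \<star> g \<noteq> 0" by auto
  show "fls_subdegree (f \<star> g) = ?n"
    using vge_mult[OF vge_subdegree[of f] vge_subdegree[of g]] 1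
    by (intro fls_subdegree_eqI) (auto simp: vge_def)
qed

section \<open>Polynomials over the skew field in a central variable\<close>

abbreviation pmul :: "'k slp \<Rightarrow> 'k slp \<Rightarrow> 'k slp" (infixl "\<otimes>\<^sub>p" 70)
  where "f \<otimes>\<^sub>p g \<equiv> slp_mult q f g"

lemma pmul_nth: "(f \<otimes>\<^sub>p g) n = (\<Sum>i\<le>n. f i \<star> g (n - i))"
  by (simp add: slp_mult_def)

lemma pmul_add_left: "(f + g) \<otimes>\<^sub>p h = f \<otimes>\<^sub>p h + g \<otimes>\<^sub>p h"
  by (rule ext) (simp add: pmul_nth sl_add_left sum.distrib)
lemma pmul_add_right: "h \<otimes>\<^sub>p (f + g) = h \<otimes>\<^sub>p f + h \<otimes>\<^sub>p g"
  by (rule ext) (simp add: pmul_nth sl_add_right sum.distrib)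
lemma pmul_minus_left: "(- f) \<otimes>\<^sub>p h = - (f \<otimes>\<^sub>p h)"
  by (rule ext) (simp add: pmul_nth sl_minus_left sum_negf)
lemma pmul_minus_right: "f \<otimes>\<^sub>p (- h) = - (f \<otimes>\<^sub>p h)"
  by (rule ext) (simp add: pmul_nth sl_minus_right sum_negf)
lemma pmul_diff_right: "h \<otimes>\<^sub>p (f - g) = h \<otimes>\<^sub>p f - h \<otimes>\<^sub>p g"
  using pmul_add_right[of h f "- g"] by (simp add: pmul_minus_right)
lemma pmul_zero [simp]: "0 \<otimes>\<^sub>p h = 0" "h \<otimes>\<^sub>p 0 = 0"
  by (rule ext, simp add: pmul_nth)+
lemma pmul_assoc: "(f \<otimes>\<^sub>p g) \<otimes>\<^sub>p h = f \<otimes>\<^sub>p (g \<otimes>\<^sub>p h)"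
proof (rule ext)
  fix n
  have "((f \<otimes>\<^sub>p g) \<otimes>\<^sub>p h) n = (\<Sum>k\<le>n. \<Sum>i\<le>k. (f i \<star> g (k - i)) \<star> h (n - k))"
    by (simp add: pmul_nth sl_sum_left)
  also have "\<dots> = (\<Sum>(k,i)\<in>(SIGMA k:{..n}. {..k}). (f i \<star> g (k - i)) \<star> h (n - k))"
    by (simp add: sum.Sigma)
  also have "\<dots> = (\<Sum>(i,j)\<in>(SIGMA i:{..n}. {..n-i}). f i \<star> (g j \<star> h (n - i - j)))"
    by (rule sum.reindex_bij_witness[of _ "\<lambda>(i,j). (i+j,i)" "\<lambda>(k,i). (i,k-i)"]) (auto simp: sl_assoc)
  also have "\<dots> = (f \<otimes>\<^sub>p (g \<otimes>\<^sub>p h)) n"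
    by (simp add: pmul_nth sl_sum_right sum.Sigma)
  finally show "((f \<otimes>\<^sub>p g) \<otimes>\<^sub>p h) n = (f \<otimes>\<^sub>p (g \<otimes>\<^sub>p h)) n" .
qed

definition pmon :: "'k fls \<Rightarrow> nat \<Rightarrow> 'k slp" where
  "pmon c k = (\<lambda>n. if n = k then c else 0)"

lemma pmon_pmul: "(pmon c k \<otimes>\<^sub>p f) n = (if n < k then 0 else c \<star> f (n - k))"
proof -
  have "(pmon c k \<otimes>\<^sub>p f) n = (\<Sum>i\<le>n. if i = k then c \<star> f (n - k) else 0)"
    unfolding pmul_nth pmon_def by (intro sum.cong) auto
  then show ?thesis by auto
qed

lemma pmul_pmon: "(f \<otimes>\<^sub>p pmon c k) n = (if n < k then 0 else f (n - k) \<star> c)"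
proof -
  have "(f \<otimes>\<^sub>p pmon c k) n = (\<Sum>i\<le>n. if i = n - k then (if n < k then 0 else f (n - k) \<star> c) else 0)"
    unfolding pmul_nth pmon_def by (intro sum.cong) auto
  then show ?thesis by auto
qed

lemma slp_one_pmon: "slp_one = pmon 1 0" by (auto simp: slp_one_def pmon_def)

lemma pmul_one [simp]: "slp_one \<otimes>\<^sub>p f = f" "f \<otimes>\<^sub>p slp_one = f"
  by (rule ext, simp add: slp_one_pmon pmon_pmul pmul_pmon)+

lemma pmon_nth: "pmon c k n = (if n = k then c else 0)" by (simp add: pmon_def)

lemma pmon_1_pmul: "(pmon 1 k \<otimes>\<^sub>p f) n = (if n < k then 0 else f (n - k))"
  by (simp add: pmon_pmul)
lemma pmon_1_add: "pmon 1 k \<otimes>\<^sub>p pmon 1 l = pmon 1 (k + l)"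
proof (rule ext)
  fix n show "(pmon 1 k \<otimes>\<^sub>p pmon 1 l) n = pmon 1 (k + l) n"
    unfolding pmon_1_pmul by (auto simp: pmon_def)
qed
lemma pmon_1_0: "pmon 1 0 = slp_one" by (simp add: slp_one_pmon)

lemma slp_fin_bound: "slp_fin (f::'k slp) \<longleftrightarrow> (\<exists>N. \<forall>n\<ge>N. f n = 0)"
proof
  assume "slp_fin f"
  then obtain N where "\<forall>x\<in>{n. f n \<noteq> 0}. x < N"
    unfolding slp_fin_def using finite_nat_set_iff_bounded by blast
  then show "\<exists>N. \<forall>n\<ge>N. f n = 0" by (metis mem_Collect_eq linorder_not_less)
next
  assume "\<exists>N. \<forall>n\<ge>N. f n = 0"
  then obtain N where "\<forall>n\<ge>N. f n = 0" by blast
  then have "{n. f n \<noteq> 0} \<subseteq> {..<N}" by (auto simp: not_le[symmetric])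
  then show "slp_fin f" unfolding slp_fin_def using finite_subset by blast
qed

lemma slp_fin_zero [simp]: "slp_fin (0::'k slp)" "slp_fin (\<lambda>_. 0::'k fls)" by (auto simp: slp_fin_def)
lemma slp_fin_pmon [simp]: "slp_fin (pmon c k)"
  unfolding slp_fin_bound pmon_def by (rule exI[of _ "Suc k"]) auto
lemma slp_fin_one [simp]: "slp_fin (slp_one :: 'k slp)" by (simp add: slp_one_pmon)
lemma slp_fin_add: "slp_fin (f::'k slp) \<Longrightarrow> slp_fin g \<Longrightarrow> slp_fin (f + g)"
  unfolding slp_fin_def by (rule finite_subset[of _ "{n. f n \<noteq> 0} \<union> {n. g n \<noteq> 0}"]) auto
lemma slp_fin_minus: "slp_fin (f::'k slp) \<Longrightarrow> slp_fin (- f)"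
  unfolding slp_fin_def by simp
lemma slp_fin_diff: "slp_fin (f::'k slp) \<Longrightarrow> slp_fin g \<Longrightarrow> slp_fin (f - g)"
  using slp_fin_add[of f "- g"] slp_fin_minus[of g] by simp
lemma pmul_vanish:
  assumes "\<And>n. n \<ge> M \<Longrightarrow> f n = 0" "\<And>n. n \<ge> N \<Longrightarrow> g n = 0" "n \<ge> M + N"
  shows "(f \<otimes>\<^sub>p g) n = 0"
  unfolding pmul_nth
proof (rule sum.neutral, rule ballI)
  fix i show "f i \<star> g (n - i) = 0"
    by (cases "i \<ge> M") (use assms in auto)
qed

lemma slp_fin_mult: "slp_fin f \<Longrightarrow> slp_fin g \<Longrightarrow> slp_fin (f \<otimes>\<^sub>p g)"
proof -
  assume "slp_fin f" "slp_fin g"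
  then obtain M N where "\<forall>n\<ge>M. f n = 0" "\<forall>n\<ge>N. g n = 0"
    unfolding slp_fin_bound by blast
  then have "\<forall>n\<ge>M+N. (f \<otimes>\<^sub>p g) n = 0" using pmul_vanish[of M f N g] by blast
  then show "slp_fin (f \<otimes>\<^sub>p g)" unfolding slp_fin_bound by blast
qed

text \<open>A lower bound c for the Gauss valuation min_i (v(f_i) - s i): the Newton polygon of f
  lies on or above the line of slope s and intercept c. Bounds are used instead of the minimum
  because it does not exist for f = 0.\<close>

definition gv :: "real \<Rightarrow> 'k slp \<Rightarrow> real \<Rightarrow> bool" where
  "gv s f c \<longleftrightarrow> (\<forall>i. vge (f i) (c + s * real i))"

lemma gv_0 [simp]: "gv s 0 c" by (simp add: gv_def)
lemma gv_mono: "gv s f c \<Longrightarrow> c' \<le> c \<Longrightarrow> gv s f c'"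
  unfolding gv_def by (metis vge_mono add_right_mono)
lemma gv_add: "gv s f c \<Longrightarrow> gv s g c \<Longrightarrow> gv s (f + g) c" by (simp add: gv_def vge_add)
lemma gv_minus: "gv s f c \<Longrightarrow> gv s (- f) c" by (simp add: gv_def vge_minus)
lemma gv_diff: "gv s f c \<Longrightarrow> gv s g c \<Longrightarrow> gv s (f - g) c" by (simp add: gv_def vge_diff)
lemma gv_sum: "(\<And>i. i \<in> A \<Longrightarrow> gv s (f i) c) \<Longrightarrow> gv s (sum f A) c"
  by (simp add: gv_def sum_fun_apply vge_sum)

lemma gv_pmon: "gv s (pmon c k) b \<longleftrightarrow> vge c (b + s * real k)"
  by (auto simp: gv_def pmon_def)

lemma gv_mult: assumes "gv s f a" "gv s g b" shows "gv s (f \<otimes>\<^sub>p g) (a + b)"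
  unfolding gv_def pmul_nth
proof (intro allI vge_sum)
  fix n i :: nat assume i: "i \<in> {..n}"
  have "vge (f i \<star> g (n - i)) ((a + s * real i) + (b + s * real (n - i)))"
    using assms vge_mult unfolding gv_def by blast
  then show "vge (f i \<star> g (n - i)) (a + b + s * real n)"
    using i by (simp add: algebra_simps of_nat_diff)
qed

lemma gv_ex: assumes "slp_fin (f::'k slp)" shows "\<exists>c. gv s f c"
proof -

  obtain N where N: "\<And>n. n \<ge> N \<Longrightarrow> f n = 0" using assms slp_fin_bound by blast
  define c where "c i = real_of_int (fls_subdegree (f i))" for i :: nat
  have c: "vge (f i) (c i)" for i :: nat by (simp add: c_def vge_subdegree)
  define m where "m = (if N = 0 then 0 else Min ((\<lambda>i. c i - s * real i) ` {..<N}))"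
  have "vge (f i) (m + s * real i)" for i :: nat
  proof (cases "i < N")
    case True
    then have "m \<le> c i - s * real i" unfolding m_def by (auto intro!: Min_le)
    then show ?thesis using vge_mono[OF c[of i]] by (simp add: algebra_simps)
  qed (simp add: N)
  then show ?thesis unfolding gv_def by blast
qed

definition pmonic :: "'k slp \<Rightarrow> nat \<Rightarrow> bool" where
  "pmonic f n \<longleftrightarrow> f n = 1 \<and> (\<forall>i>n. f i = 0)"

text \<open>The leading term t^j of \<open>mu\<close> has Gauss valuation - s j, so the bound on
  \<open>mu\<close> says that no other term is worse. Every step of the division subtracts something
  no worse than f, and neither quotient nor remainder loses precision.\<close>

lemma poly_division:
  assumes mon: "pmonic mu j" and mu_gv: "gv s mu (- s * real j)"
    and f: "slp_fin f" "gv s f c"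
  shows "\<exists>g r. f = g \<otimes>\<^sub>p mu + r \<and> slp_fin g \<and> (\<forall>i\<ge>j. r i = 0) \<and> gv s g (c + s * real j) \<and> gv s r c"
proof -
  have mu: "mu j = 1" "\<And>i. i > j \<Longrightarrow> mu i = 0" "gv s mu (- s * real j)"
    using assms by (auto simp: pmonic_def)
  have "\<exists>g r. f = g \<otimes>\<^sub>p mu + r \<and> slp_fin g \<and> (\<forall>i\<ge>j. r i = 0) \<and> gv s g (c + s * real j) \<and> gv s r c"
    if "\<forall>n\<ge>N. f n = 0" "gv s f c" for N f
    using that
  proof (induction N arbitrary: f)
    case 0
    then have "f = 0" by (auto simp: fun_eq_iff)
    then show ?case by - (rule exI[of _ 0], rule exI[of _ 0], simp flip: zero_fun_def)
  next
    case (Suc n)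
    show ?case
    proof (cases "Suc n \<le> j")
      case True
      then show ?thesis using Suc.prems by - (rule exI[of _ 0], rule exI[of _ f], auto simp flip: zero_fun_def)
    next
      case False
      then have nj: "j \<le> n" by simp
      \<comment> \<open>Multiplied by \<open>mu\<close>, this monomial has the same term of degree n
        as f.\<close>
      define g0 where "g0 = pmon (f n) (n - j)"
      have g0: "gv s g0 (c + s * real j)"
      proof -
        have "c + s * real j + s * real (n - j) = c + s * real n"
          using nj by (simp add: of_nat_diff algebra_simps)
        then show ?thesis using Suc.prems(2)[unfolded gv_def, rule_format, of n] by (simp only: g0_def gv_pmon)
      qed
      have g0mu: "gv s (g0 \<otimes>\<^sub>p mu) c" using gv_mult[OF g0 mu(3)] by simp
      have van: "\<forall>i\<ge>n. (f - g0 \<otimes>\<^sub>p mu) i = 0"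
      proof (intro allI impI)
        fix i assume i: "i \<ge> n"
        then have 1: "(g0 \<otimes>\<^sub>p mu) i = f n \<star> mu (i - (n - j))"
          by (simp add: g0_def pmon_pmul)
        show "(f - g0 \<otimes>\<^sub>p mu) i = 0"
        proof (cases "i = n")
          case True
          then have "i - (n - j) = j" using nj by simp
          then have "(g0 \<otimes>\<^sub>p mu) i = f n" using 1 mu(1) by simp
          then show ?thesis using True by simp
        next
          case False
          then have "mu (i - (n - j)) = 0" "f i = 0" using i nj mu(2) Suc.prems(1) by simp_all
          then show ?thesis by (simp add: 1)
        qed
      qed
      then obtain g r where gr: "f - g0 \<otimes>\<^sub>p mu = g \<otimes>\<^sub>p mu + r" "slp_fin g" "\<forall>i\<ge>j. r i = 0"
          "gv s g (c + s * real j)" "gv s r c"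
        using Suc.IH[OF van gv_diff[OF Suc.prems(2) g0mu]] by blast
      have "f = (f - g0 \<otimes>\<^sub>p mu) + g0 \<otimes>\<^sub>p mu" by (rule diff_add_cancel[symmetric])
      also have "\<dots> = (g \<otimes>\<^sub>p mu + r) + g0 \<otimes>\<^sub>p mu" by (simp only: gr(1))
      also have "\<dots> = (g0 + g) \<otimes>\<^sub>p mu + r" by (simp only: pmul_add_left add_ac)
      finally have fe: "f = (g0 + g) \<otimes>\<^sub>p mu + r" .
      have "slp_fin g0" by (simp add: g0_def)
      show ?thesis
        by (rule exI[of _ "g0 + g"], rule exI[of _ r])
          (intro conjI fe slp_fin_add gv_add \<open>slp_fin g0\<close> g0 gr)
    qed
  qed
  note * = this
  obtain N where "\<forall>n\<ge>N. f n = 0" using f(1) slp_fin_bound by blast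
  then show ?thesis by (rule *) (rule f(2))
qed

text \<open>The top coefficient of g meets the leading coefficient 1 of \<open>mu\<close> and
  survives.\<close>

lemma monic_mult_degree:
  assumes mon: "pmonic mu j" and g: "slp_fin g" "g \<noteq> 0"
  shows "\<exists>i\<ge>j. (g \<otimes>\<^sub>p mu) i \<noteq> 0"
proof -
  have mu: "mu j = 1" "\<And>i. i > j \<Longrightarrow> mu i = 0"
    using assms by (auto simp: pmonic_def)
  have fin: "finite {n. g n \<noteq> 0}" and ne: "{n. g n \<noteq> 0} \<noteq> {}"
    using g by (auto simp: slp_fin_def fun_eq_iff)
  define n where "n = Max {n. g n \<noteq> 0}"
  have n: "g n \<noteq> 0" using Max_in[OF fin ne] unfolding n_def by simp
  have n': "g i = 0" if "i > n" for i using Max_ge[OF fin, of i] that unfolding n_def by force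
  have "(g \<otimes>\<^sub>p mu) (n + j) = (\<Sum>i\<le>n+j. if i = n then g n else 0)"
    unfolding pmul_nth
  proof (rule sum.cong)
    show "{..n+j} = {..n+j}" ..
    fix i assume "i \<in> {..n+j}"
    then show "g i \<star> mu (n + j - i) = (if i = n then g n else 0)"
      using mu n' by (cases i n rule: linorder_cases) auto
  qed
  also have "\<dots> = g n" by simp
  finally show ?thesis using n by (intro exI[of _ "n + j"]) auto
qed

lemma monic_mult_small:
  assumes "pmonic mu j" "slp_fin g" "\<forall>i\<ge>j. (g \<otimes>\<^sub>p mu) i = 0"
  shows "g = 0"
proof (rule ccontr)
  assume "g \<noteq> 0"
  then obtain i where "i \<ge> j" "(g \<otimes>\<^sub>p mu) i \<noteq> 0"
    using monic_mult_degree[OF assms(1,2)] by blast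
  then show False using assms(3) by blast
qed

end

section \<open>Row modules and elementary equivalence\<close>

locale skewd = skew q K for q :: nat and K :: "'k::field itself" +
  fixes d :: nat
begin

definition rowsp :: "(nat \<Rightarrow> 'k slp) set" where
  "rowsp = {x. (\<forall>k. slp_fin (x k)) \<and> (\<forall>k\<ge>d. x k = 0)}"

definition rsm :: "'k slp \<Rightarrow> (nat \<Rightarrow> 'k slp) \<Rightarrow> nat \<Rightarrow> 'k slp" where
  "rsm c x = (\<lambda>k. c \<otimes>\<^sub>p x k)"

lemma rsm_add_left: "rsm (a + b) x = rsm a x + rsm b x"
  by (rule ext) (simp add: rsm_def pmul_add_left)
lemma rsm_add_right: "rsm a (x + y) = rsm a x + rsm a y"
  by (rule ext) (simp add: rsm_def pmul_add_right)
lemma rsm_minus_left: "rsm (- a) x = - rsm a x"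
  by (rule ext) (simp add: rsm_def pmul_minus_left)
lemma rsm_assoc: "rsm a (rsm b x) = rsm (a \<otimes>\<^sub>p b) x"
  by (rule ext) (simp add: rsm_def pmul_assoc)
lemma rsm_zero [simp]: "rsm 0 x = 0" "rsm a 0 = 0"
  by (rule ext, simp add: rsm_def)+
lemma rsm_one [simp]: "rsm slp_one x = x"
  by (simp add: rsm_def)
lemma rsm_sum_right: "rsm c (sum f A) = (\<Sum>i\<in>A. rsm c (f i))"
  using sum_comp_morphism[of "rsm c" f A] by (simp add: o_def rsm_add_right)

lemma rowsp_zero [simp]: "0 \<in> rowsp" by (simp add: rowsp_def)
lemma rowsp_add: "x \<in> rowsp \<Longrightarrow> y \<in> rowsp \<Longrightarrow> x + y \<in> rowsp"
  by (simp add: rowsp_def slp_fin_add)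
lemma rowsp_minus: "x \<in> rowsp \<Longrightarrow> - x \<in> rowsp"
  by (simp add: rowsp_def slp_fin_minus)
lemma rowsp_diff: "x \<in> rowsp \<Longrightarrow> y \<in> rowsp \<Longrightarrow> x - y \<in> rowsp"
  using rowsp_add[of x "- y"] rowsp_minus[of y] by simp
lemma rowsp_rsm: "x \<in> rowsp \<Longrightarrow> slp_fin c \<Longrightarrow> rsm c x \<in> rowsp"
  by (simp add: rowsp_def slp_fin_mult rsm_def)
lemma rowsp_sum: "(\<And>i. i \<in> A \<Longrightarrow> f i \<in> rowsp) \<Longrightarrow> sum f A \<in> rowsp"
  by (induction A rule: infinite_finite_induct) (auto simp: rowsp_add)

definition rspan :: "'k slmat \<Rightarrow> (nat \<Rightarrow> 'k slp) set" where
  "rspan B = {(\<Sum>i<d. rsm (c i) (B i)) | c. \<forall>i. slp_fin (c i)}"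

lemma rspanI: "x = (\<Sum>i<d. rsm (c i) (B i)) \<Longrightarrow> (\<And>i. slp_fin (c i)) \<Longrightarrow> x \<in> rspan B"
  unfolding rspan_def by blast

lemma rspan_zero [simp]: "0 \<in> rspan B"
  by (rule rspanI[of _ "\<lambda>_. 0"]) auto

lemma rspan_add: assumes "x \<in> rspan B" "y \<in> rspan B" shows "x + y \<in> rspan B"
proof -
  obtain c e where "x = (\<Sum>i<d. rsm (c i) (B i))" "\<forall>i. slp_fin (c i)"
    "y = (\<Sum>i<d. rsm (e i) (B i))" "\<forall>i. slp_fin (e i)"
    using assms unfolding rspan_def by blast
  then show ?thesis
    by (intro rspanI[of _ "\<lambda>i. c i + e i"]) (auto simp: rsm_add_left sum.distrib slp_fin_add)
qed

lemma rspan_rsm: assumes "x \<in> rspan B" "slp_fin a" shows "rsm a x \<in> rspan B"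
proof -
  obtain c where "x = (\<Sum>i<d. rsm (c i) (B i))" "\<forall>i. slp_fin (c i)"
    using assms unfolding rspan_def by blast
  then show ?thesis using assms(2)
    by (intro rspanI[of _ "\<lambda>i. a \<otimes>\<^sub>p c i"]) (auto simp: rsm_sum_right rsm_assoc slp_fin_mult)
qed

lemma rspan_minus: assumes "x \<in> rspan B" shows "- x \<in> rspan B"
  using rspan_rsm[OF assms, of "- slp_one"] by (simp add: rsm_minus_left slp_fin_minus)

lemma rspan_diff: "x \<in> rspan B \<Longrightarrow> y \<in> rspan B \<Longrightarrow> x - y \<in> rspan B"
  using rspan_add[of x B "- y"] rspan_minus[of y B] by simp

lemma rspan_sum: "(\<And>i. i \<in> A \<Longrightarrow> f i \<in> rspan B) \<Longrightarrow> sum f A \<in> rspan B"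
  by (induction A rule: infinite_finite_induct) (auto simp: rspan_add)

lemma rspan_row: assumes "i < d" shows "B i \<in> rspan B"
proof (rule rspanI[of _ "\<lambda>k. if k = i then slp_one else 0"])
  have "(\<Sum>k<d. rsm (if k = i then slp_one else 0) (B k)) = (\<Sum>k<d. if k = i then B i else 0)"
    by (intro sum.cong) auto
  then show "B i = (\<Sum>k<d. rsm (if k = i then slp_one else 0) (B k))"
    using assms by simp
qed auto

lemma rspan_subset: assumes "\<And>k. k < d \<Longrightarrow> B' k \<in> rspan B" shows "rspan B' \<subseteq> rspan B"
proof
  fix x assume "x \<in> rspan B'"
  then obtain c where "x = (\<Sum>i<d. rsm (c i) (B' i))" "\<forall>i. slp_fin (c i)"
    unfolding rspan_def by blast
  then show "x \<in> rspan B" using assms by (auto intro!: rspan_sum rspan_rsm)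
qed

lemma rspan_rowsp: assumes "\<And>k. k < d \<Longrightarrow> B k \<in> rowsp" shows "rspan B \<subseteq> rowsp"
  using assms unfolding rspan_def by (auto intro!: rowsp_sum rowsp_rsm)

text \<open>Linearity is required on all functions and not only on \<open>rowsp\<close>, so
  rewriting with it produces no membership conditions.\<close>

definition rlin :: "((nat \<Rightarrow> 'k slp) \<Rightarrow> nat \<Rightarrow> 'k slp) \<Rightarrow> bool" where
  "rlin Q \<longleftrightarrow> (\<forall>x y. Q (x + y) = Q x + Q y) \<and> (\<forall>c x. Q (rsm c x) = rsm c (Q x)) \<and> Q ` rowsp \<subseteq> rowsp"

lemma rlin_add: "rlin Q \<Longrightarrow> Q (x + y) = Q x + Q y" by (simp add: rlin_def)
lemma rlin_rsm: "rlin Q \<Longrightarrow> Q (rsm c x) = rsm c (Q x)" by (simp add: rlin_def)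
lemma rlin_rowsp: "rlin Q \<Longrightarrow> x \<in> rowsp \<Longrightarrow> Q x \<in> rowsp" by (auto simp: rlin_def)
lemma rlin_zero: "rlin Q \<Longrightarrow> Q 0 = 0" using rlin_rsm[of Q 0 0] by simp
lemma rlin_minus: "rlin Q \<Longrightarrow> Q (- x) = - Q x"
  using rlin_rsm[of Q "- slp_one" x] by (simp add: rsm_minus_left)
lemma rlin_diff: "rlin Q \<Longrightarrow> Q (x - y) = Q x - Q y"
  using rlin_add[of Q x "- y"] rlin_minus[of Q y] by (metis diff_conv_add_uminus)
lemma rlin_sum: "rlin Q \<Longrightarrow> Q (sum f A) = (\<Sum>i\<in>A. Q (f i))"
proof -
  assume Q: "rlin Q"
  have "sum (Q \<circ> f) A = Q (sum f A)"
    by (rule sum_comp_morphism[where h=Q]) (simp_all only: rlin_zero[OF Q] rlin_add[OF Q])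
  then show ?thesis by (simp only: o_def)
qed
lemma rlin_comp: "rlin Q \<Longrightarrow> rlin P \<Longrightarrow> rlin (\<lambda>x. Q (P x))"
  unfolding rlin_def by (metis (no_types, lifting) image_subset_iff)
lemma rlin_id: "rlin (\<lambda>x. x)" by (simp add: rlin_def)

lemma rlin_rspan:
  assumes "rlin E" "\<And>i. i < d \<Longrightarrow> B' i = E (B i)" "x \<in> rspan B"
  shows "E x \<in> rspan B'"
proof -
  obtain c where "x = (\<Sum>i<d. rsm (c i) (B i))" "\<forall>i. slp_fin (c i)"
    using assms(3) unfolding rspan_def by blast
  then show ?thesis using assms(2)
    by (intro rspanI[of _ c]) (auto simp: rlin_sum[OF assms(1)] rlin_rsm[OF assms(1)])
qed

text \<open>An automorphism of the row module that matches the two row spans, hence an isomorphism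
  of the cokernels as left modules over the polynomial ring. For the matrix t - D this cokernel is
  V.\<close>

definition row_iso :: "'k slmat \<Rightarrow> 'k slmat \<Rightarrow> bool" where
  "row_iso A B \<longleftrightarrow> (\<exists>Q Q'. rlin Q \<and> rlin Q' \<and> (\<forall>x. Q' (Q x) = x) \<and> (\<forall>x. Q (Q' x) = x) \<and>
     (\<forall>x\<in>rspan A. Q x \<in> rspan B) \<and> (\<forall>x\<in>rspan B. Q' x \<in> rspan A))"

text \<open>Row operations keep the span, so the automorphism stays the same.\<close>

lemma row_iso_row:
  assumes "row_iso A B" "\<And>k. k < d \<Longrightarrow> B' k \<in> rspan B" "\<And>k. k < d \<Longrightarrow> B k \<in> rspan B'"
  shows "row_iso A B'"
proof -
  have "rspan B' = rspan B" using rspan_subset assms by blast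
  then show ?thesis using assms(1) by (simp add: row_iso_def)
qed

lemma row_iso_row_add:
  assumes "row_iso A B" "i < d" "j < d" "i \<noteq> j" "slp_fin c"
    and Bi: "B' i = B i + rsm c (B j)" and Bk: "\<And>k. k \<noteq> i \<Longrightarrow> B' k = B k"
  shows "row_iso A B'"
proof (rule row_iso_row[OF assms(1)])
  fix k assume k: "k < d"
  show "B' k \<in> rspan B"
  proof (cases "k = i")
    case True
    show ?thesis unfolding True Bi using assms by (intro rspan_add rspan_rsm rspan_row)
  next
    case False
    show ?thesis unfolding Bk[OF False] by (rule rspan_row[OF k])
  qed
  show "B k \<in> rspan B'"
  proof (cases "k = i")
    case True
    have "B i = B' i - rsm c (B' j)"
      unfolding Bi Bk[OF assms(4)[symmetric]] by (rule add_diff_cancel_right'[symmetric])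
    moreover have "B' i - rsm c (B' j) \<in> rspan B'"
      using assms by (intro rspan_diff rspan_rsm rspan_row)
    ultimately show ?thesis using True by metis
  next
    case False
    show ?thesis unfolding Bk[OF False, symmetric] by (rule rspan_row[OF k])
  qed
qed

lemma row_iso_row_swap:
  assumes "row_iso A B" "i < d" "j < d"
    and "B' i = B j" "B' j = B i" "\<And>k. k \<noteq> i \<Longrightarrow> k \<noteq> j \<Longrightarrow> B' k = B k"
  shows "row_iso A B'"
proof (rule row_iso_row[OF assms(1)])
  fix k assume k: "k < d"
  show "B' k \<in> rspan B" "B k \<in> rspan B'"
    using rspan_row[OF k] rspan_row[OF assms(2)] rspan_row[OF assms(3)] assms(4-)
    by (cases "k = i"; cases "k = j"; metis)+
qed

lemma row_iso_row_scale:
  assumes "row_iso A B" "i < d" "slp_unit q u"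
    and Bi: "B' i = rsm u (B i)" and Bk: "\<And>k. k \<noteq> i \<Longrightarrow> B' k = B k"
  shows "row_iso A B'"
proof (rule row_iso_row[OF assms(1)])
  obtain w where w: "slp_fin u" "slp_fin w" "w \<otimes>\<^sub>p u = slp_one"
    using assms(3) unfolding slp_unit_def by blast
  fix k assume k: "k < d"
  show "B' k \<in> rspan B"
  proof (cases "k = i")
    case True
    show ?thesis unfolding True Bi using assms w by (intro rspan_rsm rspan_row)
  next
    case False
    show ?thesis unfolding Bk[OF False] by (rule rspan_row[OF k])
  qed
  show "B k \<in> rspan B'"
  proof (cases "k = i")
    case True
    have "B i = rsm w (B' i)" unfolding Bi rsm_assoc w rsm_one ..
    moreover have "rsm w (B' i) \<in> rspan B'"
      using assms w by (intro rspan_rsm rspan_row)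
    ultimately show ?thesis using True by metis
  next
    case False
    show ?thesis unfolding Bk[OF False, symmetric] by (rule rspan_row[OF k])
  qed
qed

text \<open>Column operations multiply rows from the right and therefore commute with left scalars;
  they are composed with the automorphism already found.\<close>

lemma row_iso_col:
  assumes "row_iso A B" "rlin E" "rlin E'" "\<And>x. E' (E x) = x" "\<And>x. E (E' x) = x"
    "\<And>i. i < d \<Longrightarrow> B' i = E (B i)"
  shows "row_iso A B'"
proof -
  obtain Q Q' where Q: "rlin Q" "rlin Q'" "\<forall>x. Q' (Q x) = x" "\<forall>x. Q (Q' x) = x"
     "\<forall>x\<in>rspan A. Q x \<in> rspan B" "\<forall>x\<in>rspan B. Q' x \<in> rspan A"
    using assms(1) unfolding row_iso_def by blast
  have 1: "E x \<in> rspan B'" if "x \<in> rspan B" for x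
    using rlin_rspan[OF assms(2,6) that] .
  have 2: "E' x \<in> rspan B" if "x \<in> rspan B'" for x
    by (rule rlin_rspan[OF assms(3) _ that]) (simp add: assms(4,6))
  show ?thesis unfolding row_iso_def
  proof (rule exI[of _ "\<lambda>x. E (Q x)"], rule exI[of _ "\<lambda>x. Q' (E' x)"], intro conjI allI ballI)
    show "rlin (\<lambda>x. E (Q x))" by (rule rlin_comp[OF assms(2) Q(1)])
    show "rlin (\<lambda>x. Q' (E' x))" by (rule rlin_comp[OF Q(2) assms(3)])
    show "Q' (E' (E (Q x))) = x" for x by (simp only: assms(4) Q(3))
    show "E (Q (Q' (E' x))) = x" for x by (simp only: assms(5) Q(4))
    show "E (Q x) \<in> rspan B'" if "x \<in> rspan A" for x using 1 Q(5) that by blast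
    show "Q' (E' x) \<in> rspan A" if "x \<in> rspan B'" for x using 2 Q(6) that by blast
  qed
qed

definition col_add_op where
  "col_add_op i j c x = (\<lambda>k. if k = j then x j + x i \<otimes>\<^sub>p c else x k)"
definition col_swap_op where
  "col_swap_op i j x = (\<lambda>k. if k = j then x i else if k = i then x j else x k)"
definition col_scale_op where
  "col_scale_op j u x = (\<lambda>k. if k = j then x j \<otimes>\<^sub>p u else x k)"

lemma rlin_col_add: "i < d \<Longrightarrow> j < d \<Longrightarrow> slp_fin c \<Longrightarrow> rlin (col_add_op i j c)"
  unfolding rlin_def col_add_op_def
  by (auto simp: fun_eq_iff rsm_def pmul_add_right pmul_add_left pmul_assoc rowsp_def slp_fin_add slp_fin_mult)

lemma rlin_col_swap: "i < d \<Longrightarrow> j < d \<Longrightarrow> rlin (col_swap_op i j)"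
  unfolding rlin_def col_swap_op_def
  by (auto simp: fun_eq_iff rsm_def rowsp_def)

lemma rlin_col_scale: "j < d \<Longrightarrow> slp_fin c \<Longrightarrow> rlin (col_scale_op j c)"
  unfolding rlin_def col_scale_op_def
  by (auto simp: fun_eq_iff rsm_def pmul_add_right pmul_add_left pmul_assoc rowsp_def slp_fin_add slp_fin_mult)

lemma elem_equiv_row_iso:
  assumes "elem_equiv q d A B" shows "row_iso A B"
  using assms
proof (induction rule: elem_equiv.induct)
  case (refl A)
  show ?case unfolding row_iso_def by (intro exI[of _ "\<lambda>x. x"]) (simp add: rlin_id)
next
  case (row_add A B i j c)
  show ?case
    by (rule row_iso_row_add[OF row_add.IH row_add.hyps(2,3,4,5)]) (auto simp: fun_eq_iff rsm_def)
next
  case (col_add A B i j c)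
  show ?case
    by (rule row_iso_col[OF col_add.IH rlin_col_add[OF col_add.hyps(2,3,5)] rlin_col_add[OF col_add.hyps(2,3) slp_fin_minus[OF col_add.hyps(5)]]])
      (use col_add.hyps in \<open>auto simp: col_add_op_def fun_eq_iff pmul_minus_right\<close>)
next
  case (row_swap A B i j)
  show ?case
    by (rule row_iso_row_swap[OF row_swap.IH row_swap.hyps(2,3)]) auto
next
  case (col_swap A B i j)
  show ?case
    by (rule row_iso_col[OF col_swap.IH rlin_col_swap[OF col_swap.hyps(2,3)] rlin_col_swap[OF col_swap.hyps(2,3)]])
      (auto simp: col_swap_op_def fun_eq_iff)
next
  case (row_scale A B i u)
  show ?case
    by (rule row_iso_row_scale[OF row_scale.IH row_scale.hyps(2,3)]) (auto simp: fun_eq_iff rsm_def)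
next
  case (col_scale A B j u)
  obtain w where w: "slp_fin u" "slp_fin w" "w \<otimes>\<^sub>p u = slp_one" "u \<otimes>\<^sub>p w = slp_one"
    using col_scale.hyps unfolding slp_unit_def by blast
  show ?case
    by (rule row_iso_col[OF col_scale.IH rlin_col_scale[OF col_scale.hyps(2) w(1)] rlin_col_scale[OF col_scale.hyps(2) w(2)]])
      (auto simp: col_scale_op_def fun_eq_iff pmul_assoc w)
qed

definition gvr :: "real \<Rightarrow> (nat \<Rightarrow> 'k slp) \<Rightarrow> real \<Rightarrow> bool" where
  "gvr s x c \<longleftrightarrow> (\<forall>k. gv s (x k) c)"

definition runit :: "nat \<Rightarrow> nat \<Rightarrow> 'k slp" where
  "runit i = (\<lambda>k. if k = i then slp_one else 0)"

lemma runit_rowsp: "i < d \<Longrightarrow> runit i \<in> rowsp" by (auto simp: rowsp_def runit_def)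

lemma rowsp_expand: assumes "x \<in> rowsp" shows "x = (\<Sum>i<d. rsm (x i) (runit i))"
proof (rule ext)
  fix k
  have "(\<Sum>i<d. rsm (x i) (runit i)) k = (\<Sum>i<d. rsm (x i) (runit i) k)"
    by (rule sum_fun_apply)
  also have "\<dots> = (\<Sum>i<d. if i = k then x k else 0)"
    by (rule sum.cong) (auto simp: rsm_def runit_def)
  also have "\<dots> = x k" using assms by (auto simp: rowsp_def)
  finally show "x k = (\<Sum>i<d. rsm (x i) (runit i)) k" by simp
qed

lemma rlin_expand: "rlin Q \<Longrightarrow> x \<in> rowsp \<Longrightarrow> Q x = (\<Sum>i<d. rsm (x i) (Q (runit i)))"
  by (subst rowsp_expand[of x]) (simp_all only: rlin_sum rlin_rsm)

lemma (in -) finite_lower: fixes c :: "nat \<Rightarrow> real" shows "\<exists>m. \<forall>i<n. m \<le> c i"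
proof (induction n)
  case (Suc n)
  then obtain m where "\<forall>i<n. m \<le> c i" by blast
  then have "\<forall>i<Suc n. min m (c n) \<le> c i" by (auto simp: less_Suc_eq min.coboundedI1)
  then show ?case by blast
qed auto

lemma gvr_ex: assumes "x \<in> rowsp" shows "\<exists>c. gvr s x c"
proof -
  have "\<exists>c. gv s (x k) c" for k using assms by (auto simp: rowsp_def gv_ex)
  then obtain c where c: "\<And>k. gv s (x k) (c k)" by metis
  obtain m where m: "\<And>i. i < d \<Longrightarrow> m \<le> c i" using finite_lower by metis
  have "gv s (x k) m" for k
    by (cases "k < d") (use assms m gv_mono[OF c] in \<open>auto simp: rowsp_def\<close>)
  then show ?thesis unfolding gvr_def by blast
qed

text \<open>A linear map is determined by the images of the d unit rows, so it lowers Gauss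
  valuations by at most a constant depending only on the map and on s.\<close>

lemma rlin_gvr: assumes "rlin Q"
  shows "\<exists>C. \<forall>x\<in>rowsp. \<forall>c. gvr s x c \<longrightarrow> gvr s (Q x) (c - C)"
proof -
  have "\<exists>c. gvr s (Q (runit k)) c" if "k < d" for k
    using gvr_ex rlin_rowsp[OF assms runit_rowsp] that by blast
  then obtain c where c: "\<And>k. k < d \<Longrightarrow> gvr s (Q (runit k)) (c k)" by metis
  obtain m where m: "\<And>i. i < d \<Longrightarrow> m \<le> c i" using finite_lower by metis
  have "gvr s (Q x) (b - (- m))" if x: "x \<in> rowsp" "gvr s x b" for x b
    unfolding gvr_def
  proof
    fix k
    have eq: "Q x k = (\<Sum>i<d. x i \<otimes>\<^sub>p Q (runit i) k)"
      unfolding rlin_expand[OF assms x(1)] sum_fun_apply rsm_def ..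
    have "gv s (\<Sum>i<d. x i \<otimes>\<^sub>p Q (runit i) k) (b + m)"
    proof (rule gv_sum)
      fix i assume "i \<in> {..<d}"
      then have "gv s (Q (runit i) k) m" using c m unfolding gvr_def by (meson gv_mono lessThan_iff)
      then show "gv s (x i \<otimes>\<^sub>p Q (runit i) k) (b + m)"
        using x(2) unfolding gvr_def by (intro gv_mult) auto
    qed
    then show "gv s (Q x k) (b - (- m))" by (simp add: eq)
  qed
  then show ?thesis by blast
qed

lemma rowsp_vanish: assumes "y \<in> rowsp" shows "\<exists>M. \<forall>k. \<forall>n\<ge>M. y k n = 0"
proof -
  have "\<exists>M. \<forall>n\<ge>M. y k n = 0" for k using assms slp_fin_bound by (auto simp: rowsp_def)
  then obtain M where M: "\<And>k n. n \<ge> M k \<Longrightarrow> y k n = 0" by metis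
  have "y k n = 0" if "n \<ge> (\<Sum>i<d. M i)" for k n
  proof (cases "k < d")
    case True
    then have "M k \<le> (\<Sum>i<d. M i)" by (intro member_le_sum) auto
    then show ?thesis using M that by force
  qed (use assms in \<open>auto simp: rowsp_def\<close>)
  then show ?thesis by blast
qed

text \<open>The degree in t rises by at most a constant, for the same reason: the images of the unit
  rows have bounded degree.\<close>

lemma rlin_degree: assumes "rlin Q"
  shows "\<exists>M. \<forall>x\<in>rowsp. \<forall>h. (\<forall>k. \<forall>n\<ge>h. x k n = 0) \<longrightarrow> (\<forall>k. \<forall>n\<ge>h+M. Q x k n = 0)"
proof -
  have "\<exists>M. \<forall>k. \<forall>n\<ge>M. Q (runit i) k n = 0" if "i < d" for i
    using rowsp_vanish[OF rlin_rowsp[OF assms runit_rowsp[OF that]]] .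
  then obtain M where M: "\<And>i k n. i < d \<Longrightarrow> n \<ge> M i \<Longrightarrow> Q (runit i) k n = 0" by metis
  have "Q x k n = 0" if x: "x \<in> rowsp" "\<forall>k. \<forall>n\<ge>h. x k n = 0" "n \<ge> h + (\<Sum>i<d. M i)" for x h k n
  proof -
    have "Q x k n = (\<Sum>i<d. (x i \<otimes>\<^sub>p Q (runit i) k) n)"
      unfolding rlin_expand[OF assms x(1)] sum_fun_apply rsm_def ..
    also have "\<dots> = 0"
    proof (intro sum.neutral ballI)
      fix i assume i: "i \<in> {..<d}"
      then have "M i \<le> (\<Sum>i<d. M i)" by (intro member_le_sum) auto
      then show "(x i \<otimes>\<^sub>p Q (runit i) k) n = 0"
        using i x M by (intro pmul_vanish[of h _ "M i"]) auto
    qed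
    finally show ?thesis .
  qed
  then show ?thesis by blast
qed

end

section \<open>The action of D on row vectors\<close>

context skewd begin

definition vs :: "(nat \<Rightarrow> 'k fls) set" where "vs = {x. \<forall>k\<ge>d. x k = 0}"

lemma vs_sum: "(\<And>i. i \<in> A \<Longrightarrow> f i \<in> vs) \<Longrightarrow> sum f A \<in> vs"
  by (auto simp: vs_def sum_fun_apply)

definition ssm :: "'k fls \<Rightarrow> (nat \<Rightarrow> 'k fls) \<Rightarrow> nat \<Rightarrow> 'k fls" where
  "ssm c x = (\<lambda>k. c \<star> x k)"

definition vvge :: "(nat \<Rightarrow> 'k fls) \<Rightarrow> real \<Rightarrow> bool" where
  "vvge x c \<longleftrightarrow> (\<forall>k. vge (x k) c)"

lemma vvge_zero [simp]: "vvge 0 c" by (simp add: vvge_def)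
lemma vvge_mono: "vvge x c \<Longrightarrow> c' \<le> c \<Longrightarrow> vvge x c'" unfolding vvge_def using vge_mono by blast
lemma vvge_add: "vvge x c \<Longrightarrow> vvge y c \<Longrightarrow> vvge (x + y) c" by (simp add: vvge_def vge_add)
lemma vvge_diff: "vvge x c \<Longrightarrow> vvge y c \<Longrightarrow> vvge (x - y) c" by (simp add: vvge_def vge_diff)
lemma vvge_sum: "(\<And>i. i \<in> A \<Longrightarrow> vvge (f i) c) \<Longrightarrow> vvge (sum f A) c"
  by (auto simp: vvge_def sum_fun_apply intro: vge_sum)
lemma vvge_ex: assumes "x \<in> vs" shows "\<exists>c. vvge x c"
proof -
  obtain m where m: "\<And>i. i < d \<Longrightarrow> m \<le> real_of_int (fls_subdegree (x i))"
    using finite_lower[of d "\<lambda>i. real_of_int (fls_subdegree (x i))"] by blast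
  have "vge (x k) m" for k
    by (cases "k < d") (use m vge_mono[OF vge_subdegree] assms in \<open>auto simp: vs_def\<close>)
  then show ?thesis unfolding vvge_def by blast
qed

definition emb :: "(nat \<Rightarrow> 'k fls) \<Rightarrow> nat \<Rightarrow> 'k slp" where
  "emb x = (\<lambda>k. pmon (x k) 0)"

lemma emb_nth: "emb x k n = (if n = 0 then x k else 0)" by (simp add: emb_def pmon_def)
lemma emb_rowsp: "x \<in> vs \<Longrightarrow> emb x \<in> rowsp"
  by (auto simp: rowsp_def vs_def emb_def pmon_def fun_eq_iff slp_fin_bound intro!: exI[of _ "1::nat"])
lemma emb_add: "emb (x + y) = emb x + emb y" by (simp add: fun_eq_iff emb_nth)
lemma emb_diff: "emb (x - y) = emb x - emb y" by (simp add: fun_eq_iff emb_nth)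
lemma emb_zero: "emb 0 = 0" by (simp add: fun_eq_iff emb_nth)
lemma emb_sum: "emb (sum f A) = (\<Sum>i\<in>A. emb (f i))"
  using sum_comp_morphism[of emb f A] by (simp add: o_def emb_add emb_zero)
lemma gvr_emb: "gvr s (emb x) c \<longleftrightarrow> vvge x c"
  by (simp add: gvr_def emb_def gv_pmon vvge_def)

end

lemma diff_diff_diff_cancel: "(a - b) - (a - c) = c - (b :: 'x :: ab_group_add)"
  by simp

locale tmod = skewd q K d for q and K :: "'k::field itself" and d +
  fixes D :: "'k skmat"
  assumes D_fin: "\<And>i j. i < d \<Longrightarrow> j < d \<Longrightarrow> skp_fin (D i j)"
begin

abbreviation DS :: "nat \<Rightarrow> nat \<Rightarrow> 'k fls" where "DS i j \<equiv> tau_to_sigma (D i j)"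
abbreviation CM :: "'k slmat" where "CM \<equiv> charmat d D"

text \<open>Right multiplication by D, which is the action of t on V.\<close>

definition vD :: "(nat \<Rightarrow> 'k fls) \<Rightarrow> nat \<Rightarrow> 'k fls" where
  "vD x = (\<lambda>j. if j < d then \<Sum>i<d. x i \<star> DS i j else 0)"

lemma vD_add: "vD (x + y) = vD x + vD y"
  by (rule ext) (simp add: vD_def sl_add_left sum.distrib)
lemma vD_minus: "vD (- x) = - vD x"
  by (rule ext) (simp add: vD_def sl_minus_left sum_negf)
lemma vD_diff: "vD (x - y) = vD x - vD y"
  using vD_add[of x "- y"] by (simp add: vD_minus)
lemma vD_zero [simp]: "vD 0 = 0" by (rule ext) (simp add: vD_def)
lemma vD_ssm: "vD (ssm c x) = ssm c (vD x)"
  by (rule ext) (simp add: vD_def ssm_def sl_sum_right sl_assoc)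
lemma vD_vs [simp]: "vD x \<in> vs" by (simp add: vD_def vs_def)

definition vDn :: "nat \<Rightarrow> (nat \<Rightarrow> 'k fls) \<Rightarrow> nat \<Rightarrow> 'k fls" where
  "vDn n = vD ^^ n"

lemma vDn_0 [simp]: "vDn 0 x = x" by (simp add: vDn_def)
lemma vDn_Suc: "vDn (Suc n) x = vD (vDn n x)" by (simp add: vDn_def)
lemma vDn_Suc2: "vDn (Suc n) x = vDn n (vD x)" by (simp add: vDn_def funpow_swap1)
lemma vDn_vs: "x \<in> vs \<Longrightarrow> vDn n x \<in> vs" by (cases n) (auto simp: vDn_Suc)
lemma vDn_add: "vDn n (x + y) = vDn n x + vDn n y"
  by (induction n) (simp_all only: vDn_Suc vDn_0 vD_add)
lemma vDn_diff: "vDn n (x - y) = vDn n x - vDn n y"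
  by (induction n) (simp_all only: vDn_Suc vDn_0 vD_diff)
lemma vDn_zero [simp]: "vDn n 0 = 0"
  by (induction n) (simp_all only: vDn_Suc vDn_0 vD_zero)
lemma vDn_ssm: "vDn n (ssm c x) = ssm c (vDn n x)"
  by (induction n) (simp_all only: vDn_Suc vDn_0 vD_ssm)

lemma vD_vvge: "\<exists>e\<ge>0. \<forall>x c. vvge x c \<longrightarrow> vvge (vD x) (c - e)"
proof -
  define v where "v i j = real_of_int (fls_subdegree (DS i j))" for i j
  have "\<exists>m. \<forall>j<d. m \<le> v i j" for i by (rule finite_lower)
  then obtain m where m: "\<And>i j. j < d \<Longrightarrow> m i \<le> v i j" by metis
  obtain m' where m': "\<And>i. i < d \<Longrightarrow> m' \<le> m i" using finite_lower[of d m] by blast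
  define e where "e = max 0 (- m')"
  have "vvge (vD x) (c - e)" if x: "vvge x c" for x c
    unfolding vvge_def vD_def
  proof
    fix j
    show "vge (if j < d then \<Sum>i<d. x i \<star> DS i j else 0) (c - e)"
    proof (cases "j < d")
      case True
      have "vge (x i \<star> DS i j) (c - e)" if "i < d" for i
      proof -
        have "- e \<le> v i j" using m[OF True, of i] m'[OF that] by (simp add: e_def)
        then have "vge (DS i j) (- e)" unfolding v_def by (rule vge_mono[OF vge_subdegree])
        then have "vge (x i \<star> DS i j) (c + (- e))" using x unfolding vvge_def by (intro vge_mult) auto
        then show ?thesis by simp
      qed
      then show ?thesis using True by (auto intro!: vge_sum)
    qed simp
  qed
  then show ?thesis by (intro exI[of _ e]) (simp add: e_def)
qed

text \<open>A crude bound whose constant is unrelated to the slopes. It serves for a bounded number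
  of powers, or for errors that can be made small in advance.\<close>

lemma vDn_vvge: "\<exists>e\<ge>0. \<forall>n x c. vvge x c \<longrightarrow> vvge (vDn n x) (c - real n * e)"
proof -
  obtain e where e: "e \<ge> 0" "\<And>x c. vvge x c \<Longrightarrow> vvge (vD x) (c - e)" using vD_vvge by blast
  have "vvge (vDn n x) (c - real n * e)" if "vvge x c" for n x c
  proof (induction n)
    case (Suc n)
    have "vvge (vDn (Suc n) x) (c - real n * e - e)" unfolding vDn_Suc by (rule e(2)[OF Suc])
    then show ?case by (simp add: algebra_simps)
  qed (simp add: that)
  then show ?thesis using e(1) by blast
qed

lemma CM_entry:
  "i < d \<Longrightarrow> k < d \<Longrightarrow> CM i k = (if i = k then pmon 1 1 else 0) - pmon (DS i k) 0"
  by (rule ext) (simp add: charmat_def pmon_def)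

lemma CM_entry0: "\<not> k < d \<Longrightarrow> CM i k = 0"
  by (rule ext) (simp add: charmat_def)

lemma CM_rowsp: "i < d \<Longrightarrow> CM i \<in> rowsp"
  unfolding rowsp_def
proof (intro CollectI conjI allI impI)
  fix k assume "i < d"
  show "slp_fin (CM i k)"
  proof (cases "k < d")
    case True
    have "slp_fin (if i = k then pmon 1 1 else 0)" by auto
    then show ?thesis unfolding CM_entry[OF \<open>i < d\<close> True] by (rule slp_fin_diff) simp
  next
    case False
    show ?thesis unfolding CM_entry0[OF False] by simp
  qed
  show "CM i k = 0" if "k \<ge> d" using CM_entry0[of k i] that by simp
qed

lemma rspan_CM_rowsp: "rspan CM \<subseteq> rowsp" by (rule rspan_rowsp) (rule CM_rowsp)

text \<open>In c (t - D) the coefficient of t^n is c_(n-1) - c_n D.\<close>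

lemma CM_comb:
  "(\<Sum>i<d. rsm (c i) (CM i)) k n =
     (if k < d then (if n = 0 then 0 else c k (n - 1)) - vD (\<lambda>i. c i n) k else 0)"
proof (cases "k < d")
  case True
  have "(\<Sum>i<d. rsm (c i) (CM i)) k n = (\<Sum>i<d. (c i \<otimes>\<^sub>p CM i k) n)"
    unfolding sum_fun_apply rsm_def ..
  also have "\<dots> = (\<Sum>i<d. (if i = k then (if n = 0 then 0 else c k (n - 1)) else 0) - c i n \<star> DS i k)"
  proof (rule sum.cong)
    show "{..<d} = {..<d}" ..
    fix i assume "i \<in> {..<d}"
    then have i: "i < d" by simp
    have "c i \<otimes>\<^sub>p CM i k = (if i = k then c k \<otimes>\<^sub>p pmon 1 1 else 0) - c i \<otimes>\<^sub>p pmon (DS i k) 0"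
      unfolding CM_entry[OF i True] pmul_diff_right by auto
    then show "(c i \<otimes>\<^sub>p CM i k) n = (if i = k then (if n = 0 then 0 else c k (n - 1)) else 0) - c i n \<star> DS i k"
      by (simp add: pmul_pmon)
  qed
  also have "\<dots> = (if n = 0 then 0 else c k (n - 1)) - vD (\<lambda>i. c i n) k"
    using True by (simp add: sum_subtractf vD_def)
  finally show ?thesis using True by simp
next
  case False
  have "(\<Sum>i<d. rsm (c i) (CM i)) k n = (\<Sum>i<d. (c i \<otimes>\<^sub>p CM i k) n)"
    unfolding sum_fun_apply rsm_def ..
  then show ?thesis using False by (simp add: CM_entry0)
qed

text \<open>The combination of the rows of t - D with the coefficients x is t x - x D. Thus t acts
  on the cokernel as D acts on constant rows.\<close>

lemma t_emb: assumes "x \<in> vs" shows "rsm (pmon 1 1) (emb x) - emb (vD x) \<in> rspan CM"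
proof (rule rspanI)
  show "slp_fin (pmon (x i) 0)" for i by simp
  show "rsm (pmon 1 1) (emb x) - emb (vD x) = (\<Sum>i<d. rsm (pmon (x i) 0) (CM i))"
  proof (intro ext)
    fix k n
    have 1: "(\<lambda>i. pmon (x i) 0 n) = (if n = 0 then x else 0)" by (auto simp: pmon_def)
    have 2: "vD x k = 0" "x k = 0" if "\<not> k < d" using that assms by (auto simp: vD_def vs_def)
    have 4: "vD (\<lambda>i. 0) k = 0" by (simp add: vD_def)
    have 3: "rsm (pmon 1 1) (emb x) k n = (if n = 1 then x k else 0)"
      unfolding rsm_def pmon_1_pmul emb_nth by auto
    show "(rsm (pmon 1 1) (emb x) - emb (vD x)) k n = (\<Sum>i<d. rsm (pmon (x i) 0) (CM i)) k n"
      unfolding CM_comb 1 minus_apply 3 emb_nth pmon_nth using 2 by (auto simp: 4)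
  qed
qed

lemma tn_emb: assumes "x \<in> vs" shows "rsm (pmon 1 n) (emb x) - emb (vDn n x) \<in> rspan CM"
proof (induction n)
  case (Suc n)
  have "rsm (pmon 1 1) (rsm (pmon 1 n) (emb x) - emb (vDn n x)) \<in> rspan CM"
    by (rule rspan_rsm[OF Suc]) simp
  moreover have "rsm (pmon 1 1) (emb (vDn n x)) - emb (vD (vDn n x)) \<in> rspan CM"
    by (rule t_emb[OF vDn_vs[OF assms]])
  ultimately have 1: "rsm (pmon 1 1) (rsm (pmon 1 n) (emb x) - emb (vDn n x)) +
    (rsm (pmon 1 1) (emb (vDn n x)) - emb (vD (vDn n x))) \<in> rspan CM" by (rule rspan_add)
  have 2: "rsm (pmon 1 1) (rsm (pmon 1 n) (emb x) - emb (vDn n x)) =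
     rsm (pmon 1 (Suc n)) (emb x) - rsm (pmon 1 1) (emb (vDn n x))"
    using rsm_add_right[of "pmon 1 1" "rsm (pmon 1 n) (emb x) - emb (vDn n x)" "emb (vDn n x)"]
    by (simp only: diff_add_cancel rsm_assoc pmon_1_add) (simp only: plus_1_eq_Suc add_diff_cancel_right')
  show ?case using 1 unfolding 2 vDn_Suc by (simp only: diff_add_cancel add_diff_eq)
next
  case 0
  show ?case by (simp only: pmon_1_0 rsm_one vDn_0 diff_self rspan_zero)
qed

section \<open>Evaluation of polynomial rows at t = D\<close>

definition crow :: "(nat \<Rightarrow> 'k slp) \<Rightarrow> nat \<Rightarrow> nat \<Rightarrow> 'k fls" where
  "crow f n = (\<lambda>k. f k n)"

lemma crow_vs: "f \<in> rowsp \<Longrightarrow> crow f n \<in> vs" by (simp add: crow_def vs_def rowsp_def)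

text \<open>For a row f with coefficient rows f_n this is the sum of the f_n D^n, cut off at n <
  N.\<close>

definition evN :: "nat \<Rightarrow> (nat \<Rightarrow> 'k slp) \<Rightarrow> nat \<Rightarrow> 'k fls" where
  "evN N f = (\<Sum>n<N. vDn n (crow f n))"

lemma evN_vs: "f \<in> rowsp \<Longrightarrow> evN N f \<in> vs"
  unfolding evN_def by (intro vs_sum vDn_vs crow_vs)

lemma evN_cong:
  assumes "\<And>k n. n \<ge> N \<Longrightarrow> f k n = 0" "N \<le> N'" shows "evN N' f = evN N f"
proof -
  have "crow f n = 0" if "n \<ge> N" for n using assms(1)[OF that] by (auto simp: crow_def)
  then show ?thesis unfolding evN_def using assms(2)
    by (intro sum.mono_neutral_right) auto
qed

lemma evN_rspan:
  assumes "f \<in> rowsp" "\<And>k n. n \<ge> N \<Longrightarrow> f k n = 0"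
  shows "f - emb (evN N f) \<in> rspan CM"
proof -
  have "f = (\<Sum>n<N. rsm (pmon 1 n) (emb (crow f n)))"
  proof (intro ext)
    fix k m
    have "(\<Sum>n<N. rsm (pmon 1 n) (emb (crow f n))) k m = (\<Sum>n<N. if n = m then f k m else 0)"
      unfolding sum_fun_apply by (rule sum.cong) (auto simp: rsm_def pmon_1_pmul emb_nth crow_def)
    also have "\<dots> = f k m" using assms(2)[of m k] by auto
    finally show "f k m = (\<Sum>n<N. rsm (pmon 1 n) (emb (crow f n))) k m" by simp
  qed
  moreover have "emb (evN N f) = (\<Sum>n<N. emb (vDn n (crow f n)))"
    unfolding evN_def by (rule emb_sum)
  ultimately have "f - emb (evN N f) =
      (\<Sum>n<N. rsm (pmon 1 n) (emb (crow f n))) - (\<Sum>n<N. emb (vDn n (crow f n)))"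
    by (rule arg_cong2[where f="(-)"])
  also have "\<dots> = (\<Sum>n<N. rsm (pmon 1 n) (emb (crow f n)) - emb (vDn n (crow f n)))"
    by (rule sum_subtractf[symmetric])
  also have "\<dots> \<in> rspan CM"
    by (intro rspan_sum tn_emb crow_vs assms(1))
  finally show ?thesis .
qed

text \<open>A combination of the rows of t - D has the coefficients c_(n-1) - c_n D; applying D^n
  and summing telescopes. Together with \<open>evN_rspan\<close> this shows that each class of the
  cokernel contains exactly one constant row.\<close>

lemma evN_zero:
  assumes "f \<in> rspan CM" "\<And>k n. n \<ge> N \<Longrightarrow> f k n = 0"
  shows "evN N f = 0"
proof -
  obtain c where f: "f = (\<Sum>i<d. rsm (c i) (CM i))" and c: "\<And>i. slp_fin (c i)"
    using assms(1) unfolding rspan_def by blast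
  define cr where "cr = (\<lambda>k. if k < d then c k else 0)"
  have "cr \<in> rowsp" using c by (auto simp: rowsp_def cr_def)
  then obtain M where M: "\<And>k n. n \<ge> M \<Longrightarrow> cr k n = 0" using rowsp_vanish by blast
  \<comment> \<open>The coefficient row c_(n-1), with the value 0 at n = 0 that makes the first end
    of the telescope vanish.\<close>
  define S where "S n = (if n = 0 then 0 else crow cr (n - 1))" for n :: nat
  have fn: "crow f n = S n - vD (S (Suc n))" for n
  proof (rule ext)
    fix k
    have "vD (\<lambda>i. c i n) = vD (crow cr n)" by (rule ext) (simp add: vD_def crow_def cr_def)
    moreover have "vD (crow cr n) k = 0" if "\<not> k < d" using that by (simp add: vD_def)
    ultimately show "crow f n k = (S n - vD (S (Suc n))) k"
      unfolding crow_def f CM_comb by (auto simp: S_def cr_def crow_def)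
  qed
  \<comment> \<open>At least M + 1, because \<open>S N'\<close> is the coefficient row of index N' -
    1.\<close>
  define N' where "N' = max N (Suc M)"
  have "evN N f = evN N' f" using evN_cong[of N f N'] assms(2) by (simp add: N'_def)
  also have "\<dots> = (\<Sum>n<N'. vDn n (S n) - vDn (Suc n) (S (Suc n)))"
    unfolding evN_def fn vDn_diff vDn_Suc2 ..
  also have "\<dots> = vDn 0 (S 0) - vDn N' (S N')" by (rule sum_lessThan_telescope')
  also have "S 0 = 0" by (simp add: S_def)
  also have "S N' = 0"
  proof (rule ext)
    fix k show "S N' k = 0 k" using M[of "N' - 1" k] by (simp add: S_def N'_def crow_def)
  qed
  finally show ?thesis by (simp only: vDn_zero diff_self)
qed

lemma emb_rspan_zero: assumes "emb x \<in> rspan CM" shows "x = 0"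
proof -
  have "evN 1 (emb x) = 0" by (rule evN_zero[OF assms]) (simp add: emb_nth)
  moreover have "evN 1 (emb x) = x" by (simp add: evN_def crow_def emb_nth)
  ultimately show ?thesis by simp
qed

text \<open>\<open>evN\<close> does not depend on its cutoff once this exceeds the degree; taking
  the least one removes the parameter.\<close>

definition ev :: "(nat \<Rightarrow> 'k slp) \<Rightarrow> nat \<Rightarrow> 'k fls" where
  "ev f = evN (LEAST N. \<forall>k. \<forall>n\<ge>N. f k n = 0) f"

lemma ev_eq: assumes "\<And>k n. n \<ge> N \<Longrightarrow> f k n = 0" shows "ev f = evN N f"
proof -
  let ?P = "\<lambda>N. \<forall>k. \<forall>n\<ge>N. f k n = 0"
  have P: "?P N" using assms by blast
  have 1: "?P (LEAST N. ?P N)" by (rule LeastI[of ?P, OF P])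
  have "evN N f = evN (LEAST N. ?P N) f"
  proof (rule evN_cong)
    show "f k n = 0" if "n \<ge> (LEAST N. ?P N)" for k n using 1 that by blast
    show "(LEAST N. ?P N) \<le> N" by (rule Least_le[of ?P, OF P])
  qed
  then show ?thesis unfolding ev_def by (rule sym)
qed

lemma ev_vs: "f \<in> rowsp \<Longrightarrow> ev f \<in> vs" by (simp add: ev_def evN_vs)

lemma ev_rspan: assumes "f \<in> rowsp" shows "f - emb (ev f) \<in> rspan CM"
proof -
  obtain N where N: "\<And>k n. n \<ge> N \<Longrightarrow> f k n = 0" using rowsp_vanish[OF assms] by blast
  have "ev f = evN N f" by (rule ev_eq) (rule N)
  moreover have "f - emb (evN N f) \<in> rspan CM" by (rule evN_rspan[OF assms]) (rule N)
  ultimately show ?thesis by metis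
qed

lemma ev_unique: assumes "f \<in> rowsp" "x \<in> vs" "f - emb x \<in> rspan CM" shows "ev f = x"
proof -
  have "(f - emb x) - (f - emb (ev f)) \<in> rspan CM"
    by (rule rspan_diff[OF assms(3) ev_rspan[OF assms(1)]])
  moreover have "(f - emb x) - (f - emb (ev f)) = emb (ev f - x)"
    unfolding emb_diff by (rule diff_diff_diff_cancel)
  ultimately have "ev f - x = 0" using emb_rspan_zero by metis
  then show ?thesis by (simp only: right_minus_eq)
qed

end

context skew begin

lemma pmonic_fin: "pmonic f h \<Longrightarrow> slp_fin f"
  unfolding slp_fin_bound pmonic_def by (rule exI[of _ "Suc h"]) auto

text \<open>The last condition says that f 0 is nonzero of order at most - s h, so the Newton polygon of f is
  one edge of slope s.\<close>

definition straight :: "real \<Rightarrow> 'k slp \<Rightarrow> nat \<Rightarrow> bool" where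
  "straight s f h \<longleftrightarrow> pmonic f h \<and> gv s f (- s * real h) \<and>
     (\<forall>x c. vge (x \<star> f 0) (c - s * real h) \<longrightarrow> vge x c)"

text \<open>The remainder of t f modulo left multiples of \<open>mu\<close>, when \<open>mu\<close>
  is monic of degree h > 0 and f has degree below h.\<close>

definition mulred :: "'k slp \<Rightarrow> nat \<Rightarrow> 'k slp \<Rightarrow> 'k slp" where
  "mulred mu h f = pmon 1 1 \<otimes>\<^sub>p f - pmon (f (h - 1)) 0 \<otimes>\<^sub>p mu"

lemma mulred_nth: "mulred mu h f n = (if n = 0 then 0 else f (n - 1)) - f (h - 1) \<star> mu n"
  unfolding mulred_def minus_apply pmon_1_pmul pmon_pmul by auto

lemma mulred_vanish:
  assumes "pmonic mu h" "h > 0" "\<And>n. n \<ge> h \<Longrightarrow> f n = 0" "n \<ge> h"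
  shows "mulred mu h f n = 0"
proof (cases "n = h")
  case True
  then show ?thesis using assms by (simp add: mulred_nth pmonic_def)
next
  case False
  then have "f (n - 1) = 0" using assms(3)[of "n - 1"] assms(4) by simp
  then show ?thesis using False assms by (simp add: mulred_nth pmonic_def)
qed

text \<open>Multiplication by t in the quotient shifts the Gauss valuation by exactly s. For the
  bound on f, note that the remainder has constant coefficient - f_(h-1) \<open>mu 0\<close>; as the
  order of \<open>mu 0\<close> is extremal, this bounds f_(h-1), and the other coefficients follow
  by adding f_(h-1) \<open>mu\<close> back.\<close>

lemma mulred_gv:
  assumes "straight s mu h" "h > 0" "\<And>n. n \<ge> h \<Longrightarrow> f n = 0"
  shows "gv s (mulred mu h f) (c - s) \<longleftrightarrow> gv s f c"
proof -
  have mu: "vge (mu n) (- s * real h + s * real n)" for n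
    using assms(1) unfolding straight_def gv_def by blast
  have h1: "real (h - 1) = real h - 1" using assms(2) by (simp add: of_nat_diff)
  show ?thesis
  proof
    assume f: "gv s f c"
    show "gv s (mulred mu h f) (c - s)"
      unfolding gv_def mulred_nth
    proof (intro allI vge_diff)
      fix n
      show "vge (if n = 0 then 0 else f (n - 1)) (c - s + s * real n)"
      proof (cases "n = 0")
        case False
        then have "c - s + s * real n = c + s * real (n - 1)" by (simp add: of_nat_diff algebra_simps)
        moreover have "vge (f (n - 1)) (c + s * real (n - 1))" using f unfolding gv_def by blast
        ultimately show ?thesis using False by metis
      qed simp
      have "vge (f (h - 1) \<star> mu n) ((c + s * real (h - 1)) + (- s * real h + s * real n))"
        by (rule vge_mult[OF _ mu]) (use f in \<open>auto simp: gv_def\<close>)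
      moreover have "(c + s * real (h - 1)) + (- s * real h + s * real n) = c - s + s * real n"
        unfolding h1 by (simp add: algebra_simps)
      ultimately show "vge (f (h - 1) \<star> mu n) (c - s + s * real n)" by metis
    qed
  next
    assume g: "gv s (mulred mu h f) (c - s)"
    then have gn: "vge (mulred mu h f n) (c - s + s * real n)" for n unfolding gv_def by blast
    have "vge (- (f (h - 1) \<star> mu 0)) (c - s)" using gn[of 0] by (simp add: mulred_nth)
    then have "vge (f (h - 1) \<star> mu 0) (c - s)" using vge_minus by fastforce
    moreover have "c - s = (c + s * real (h - 1)) - s * real h" unfolding h1 by (simp add: algebra_simps)
    ultimately have last: "vge (f (h - 1)) (c + s * real (h - 1))"
      using assms(1) unfolding straight_def by metis
    show "gv s f c" unfolding gv_def
    proof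
      fix n
      have "vge (mulred mu h f (Suc n) + f (h - 1) \<star> mu (Suc n)) (c + s * real n)"
      proof (rule vge_add)
        show "vge (mulred mu h f (Suc n)) (c + s * real n)"
          using gn[of "Suc n"] by (simp add: algebra_simps)
        have "vge (f (h - 1) \<star> mu (Suc n)) ((c + s * real (h - 1)) + (- s * real h + s * real (Suc n)))"
          by (rule vge_mult[OF last mu])
        moreover have "(c + s * real (h - 1)) + (- s * real h + s * real (Suc n)) = c + s * real n"
          unfolding h1 by (simp add: algebra_simps)
        ultimately show "vge (f (h - 1) \<star> mu (Suc n)) (c + s * real n)" by metis
      qed
      then show "vge (f n) (c + s * real n)" by (simp add: mulred_nth)
    qed
  qed
qed

end

context skewd begin

section \<open>Rows modulo a diagonal matrix\<close>

definition diagset :: "(nat \<Rightarrow> 'k slp) \<Rightarrow> (nat \<Rightarrow> 'k slp) set" where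
  "diagset lam = {x \<in> rowsp. \<forall>i<d. \<exists>g. slp_fin g \<and> x i = g \<otimes>\<^sub>p lam i}"

lemma diagsetI: "x \<in> rowsp \<Longrightarrow> (\<And>i. i < d \<Longrightarrow> \<exists>g. slp_fin g \<and> x i = g \<otimes>\<^sub>p lam i) \<Longrightarrow> x \<in> diagset lam"
  by (simp add: diagset_def)

lemma diagset_add: assumes "x \<in> diagset lam" "y \<in> diagset lam" shows "x + y \<in> diagset lam"
proof (rule diagsetI)
  show "x + y \<in> rowsp" using assms by (auto simp: diagset_def intro: rowsp_add)
  fix i assume i: "i < d"
  obtain a b where "slp_fin a" "x i = a \<otimes>\<^sub>p lam i" "slp_fin b" "y i = b \<otimes>\<^sub>p lam i"
    using assms i unfolding diagset_def by blast
  then show "\<exists>g. slp_fin g \<and> (x + y) i = g \<otimes>\<^sub>p lam i"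
    by - (rule exI[of _ "a + b"], simp only: pmul_add_left slp_fin_add plus_fun_apply[of x y])
qed

lemma diagset_rsm: assumes "x \<in> diagset lam" "slp_fin c" shows "rsm c x \<in> diagset lam"
proof (rule diagsetI)
  show "rsm c x \<in> rowsp" using assms by (auto simp: diagset_def intro: rowsp_rsm)
  fix i assume i: "i < d"
  obtain a where "slp_fin a" "x i = a \<otimes>\<^sub>p lam i"
    using assms i unfolding diagset_def by blast
  then show "\<exists>g. slp_fin g \<and> rsm c x i = g \<otimes>\<^sub>p lam i"
    using assms(2) by - (rule exI[of _ "c \<otimes>\<^sub>p a"], simp only: rsm_def pmul_assoc slp_fin_mult)
qed

lemma diagset_minus: "x \<in> diagset lam \<Longrightarrow> - x \<in> diagset lam"
  using diagset_rsm[of x lam "- slp_one"] by (simp add: rsm_minus_left slp_fin_minus)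

lemma diagset_diff: "x \<in> diagset lam \<Longrightarrow> y \<in> diagset lam \<Longrightarrow> x - y \<in> diagset lam"
  using diagset_add[of x lam "- y"] diagset_minus[of y lam] by simp

lemma diagset_rspan:
  assumes "\<And>i. i < d \<Longrightarrow> B i \<in> rowsp"
    and "\<And>i j. i < d \<Longrightarrow> j < d \<Longrightarrow> i \<noteq> j \<Longrightarrow> B i j = 0" and "\<And>i. i < d \<Longrightarrow> B i i = lam i"
  shows "rspan B = diagset lam"
proof
  have comb: "(\<Sum>i<d. rsm (c i) (B i)) k = c k \<otimes>\<^sub>p lam k" if "k < d" for c k
  proof -
    have "(\<Sum>i<d. rsm (c i) (B i)) k = (\<Sum>i<d. if i = k then c k \<otimes>\<^sub>p lam k else 0)"
      unfolding sum_fun_apply[of _ _ k] rsm_def by (rule sum.cong) (use assms that in auto)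
    then show ?thesis using that by simp
  qed
  show "rspan B \<subseteq> diagset lam"
  proof
    fix x assume x: "x \<in> rspan B"
    then obtain c where c: "x = (\<Sum>i<d. rsm (c i) (B i))" "\<And>i. slp_fin (c i)"
      unfolding rspan_def by blast
    show "x \<in> diagset lam"
    proof (rule diagsetI)
      show "x \<in> rowsp" using rspan_rowsp[of B] assms(1) x by blast
      show "\<exists>g. slp_fin g \<and> x i = g \<otimes>\<^sub>p lam i" if "i < d" for i
        using c comb[OF that, of c] by blast
    qed
  qed
  show "diagset lam \<subseteq> rspan B"
  proof
    fix x assume x: "x \<in> diagset lam"
    then have "\<exists>g. slp_fin g \<and> (i < d \<longrightarrow> x i = g \<otimes>\<^sub>p lam i)" for i
      unfolding diagset_def using slp_fin_zero(1) by blast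
    then obtain c where c: "\<And>i. slp_fin (c i)" "\<And>i. i < d \<Longrightarrow> x i = c i \<otimes>\<^sub>p lam i" by metis
    have "x = (\<Sum>i<d. rsm (c i) (B i))"
    proof (rule ext)
      fix k
      show "x k = (\<Sum>i<d. rsm (c i) (B i)) k"
      proof (cases "k < d")
        case True
        then show ?thesis using comb c(2) by simp
      next
        case False
        then have "x k = 0" using x by (simp add: diagset_def rowsp_def)
        moreover have "(\<Sum>i<d. rsm (c i) (B i)) k = 0"
          unfolding sum_fun_apply[of _ _ k] rsm_def
          using assms(1) False by (intro sum.neutral) (auto simp: rowsp_def)
        ultimately show ?thesis by simp
      qed
    qed
    then show "x \<in> rspan B" using c(1) by (rule rspanI)
  qed
qed

end

text \<open>What diagonalization provides: \<open>Q\<close> induces an isomorphism from V, the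
  cokernel of t - D, onto the direct sum of the quotients by the \<open>lam i\<close>, whose degrees
  are the \<open>h i\<close>.\<close>

locale tmod_iso = tmod q K d D for q and K :: "'k::field itself" and d and D :: "'k skmat" +
  fixes Q Q' :: "(nat \<Rightarrow> 'k slp) \<Rightarrow> nat \<Rightarrow> 'k slp" and lam :: "nat \<Rightarrow> 'k slp" and h :: "nat \<Rightarrow> nat"
  assumes Q: "rlin Q" and Q': "rlin Q'" and Q'Q: "\<And>x. Q' (Q x) = x" and QQ': "\<And>x. Q (Q' x) = x"
    and Q_rspan: "\<And>x. x \<in> rspan CM \<Longrightarrow> Q x \<in> diagset lam"
    and Q'_diag: "\<And>x. x \<in> diagset lam \<Longrightarrow> Q' x \<in> rspan CM"
    and lam_monic: "\<And>i. i < d \<Longrightarrow> pmonic (lam i) (h i)"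
begin

definition redset :: "(nat \<Rightarrow> 'k slp) set" where
  "redset = {w \<in> rowsp. \<forall>i<d. \<forall>n\<ge>h i. w i n = 0}"

text \<open>Division in each entry; the assumed bounds on the \<open>lam i\<close> are what
  preserves the Gauss valuation.\<close>

lemma reduce:
  assumes s: "\<And>i. i < d \<Longrightarrow> gv s (lam i) (- s * real (h i))" and f: "f \<in> rowsp" and c: "gvr s f c"
  shows "\<exists>w\<in>redset. f - w \<in> diagset lam \<and> gvr s w c"
proof -
  have "\<exists>g r. f i = g \<otimes>\<^sub>p lam i + r \<and> slp_fin g \<and> (\<forall>n\<ge>h i. r n = 0) \<and>
      gv s g (c + s * real (h i)) \<and> gv s r c" if i: "i < d" for i
    by (rule poly_division[OF lam_monic[OF i] s[OF i]])
      (use c f in \<open>auto simp: gvr_def rowsp_def\<close>)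
  then obtain g r where gr: "\<And>i. i < d \<Longrightarrow> f i = g i \<otimes>\<^sub>p lam i + r i"
    "\<And>i. i < d \<Longrightarrow> slp_fin (g i)" "\<And>i. i < d \<Longrightarrow> \<forall>n\<ge>h i. r i n = 0"
    "\<And>i. i < d \<Longrightarrow> gv s (r i) c" by metis
  define w where "w = (\<lambda>i. if i < d then r i else 0)"
  have "slp_fin (r i)" if "i < d" for i
    unfolding slp_fin_bound using gr(3)[OF that] by blast
  then have w: "w \<in> rowsp" by (auto simp: rowsp_def w_def)
  moreover have "w \<in> redset" using w gr(3) by (auto simp: redset_def w_def)
  moreover have "f - w \<in> diagset lam"
  proof (rule diagsetI)
    show "f - w \<in> rowsp" using f w by (rule rowsp_diff)
    fix i assume i: "i < d"
    have "(f - w) i = f i - w i" by (rule minus_apply)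
    also have "\<dots> = (g i \<otimes>\<^sub>p lam i + r i) - r i" using gr(1)[OF i] i by (simp only: w_def if_True)
    also have "\<dots> = g i \<otimes>\<^sub>p lam i" by (rule add_diff_cancel_right')
    finally show "\<exists>g. slp_fin g \<and> (f - w) i = g \<otimes>\<^sub>p lam i" using gr(2)[OF i] by blast
  qed
  moreover have "gvr s w c" using gr(4) by (auto simp: gvr_def w_def)
  ultimately show ?thesis by blast
qed

lemma reduce_zero: assumes "w \<in> redset" "w \<in> diagset lam" shows "w = 0"
proof (rule ext)
  fix i
  show "w i = 0 i"
  proof (cases "i < d")
    case True
    obtain g where g: "slp_fin g" "w i = g \<otimes>\<^sub>p lam i" using assms(2) True unfolding diagset_def by blast
    have "\<forall>n\<ge>h i. (g \<otimes>\<^sub>p lam i) n = 0"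
      using assms(1) True unfolding redset_def g(2)[symmetric] by blast
    then have "g = 0" by (rule monic_mult_small[OF lam_monic[OF True] g(1)])
    then show ?thesis using g(2) by (simp only: pmul_zero zero_fun_apply)
  next
    case False
    then show ?thesis using assms(1) by (simp add: redset_def rowsp_def)
  qed
qed

lemma redset_diff: "w \<in> redset \<Longrightarrow> w' \<in> redset \<Longrightarrow> w - w' \<in> redset"
  unfolding redset_def using rowsp_diff[of w w'] by simp

lemma reduce_unique:
  assumes "w \<in> redset" "w' \<in> redset" "f - w \<in> diagset lam" "f - w' \<in> diagset lam"
  shows "w = w'"
proof -
  have "(f - w') - (f - w) \<in> diagset lam" using assms(4,3) by (rule diagset_diff)
  then have "w - w' \<in> diagset lam" by (simp only: diff_diff_diff_cancel)
  then have "w - w' = 0" using reduce_zero redset_diff assms(1,2) by blast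
  then show ?thesis by (simp only: right_minus_eq)
qed

text \<open>Entries with \<open>h i = 0\<close> belong to zero quotients. There
  \<open>h i - 1\<close> would not be the index of a top coefficient, so the value is set to
  0.\<close>

definition mulredr :: "(nat \<Rightarrow> 'k slp) \<Rightarrow> nat \<Rightarrow> 'k slp" where
  "mulredr w = (\<lambda>i. if i < d \<and> h i > 0 then mulred (lam i) (h i) (w i) else 0)"

lemma mulredr_redset: assumes "w \<in> redset" shows "mulredr w \<in> redset"
proof -
  have 1: "mulredr w i n = 0" if "i < d" "n \<ge> h i" for i n
    using assms mulred_vanish[OF lam_monic[OF that(1)], of "w i" n] that
    by (auto simp: mulredr_def redset_def)
  have "slp_fin (mulredr w i)" for i
  proof (cases "i < d")
    case True
    show ?thesis unfolding slp_fin_bound by (rule exI[of _ "h i"]) (use 1[OF True] in blast)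
  qed (simp add: mulredr_def)
  then have "mulredr w \<in> rowsp" by (auto simp: rowsp_def mulredr_def)
  then show ?thesis using 1 by (auto simp: redset_def)
qed

lemma mulredr_diag: assumes "w \<in> redset" shows "rsm (pmon 1 1) w - mulredr w \<in> diagset lam"
proof (rule diagsetI)
  have w: "w \<in> rowsp" using assms by (simp add: redset_def)
  show "rsm (pmon 1 1) w - mulredr w \<in> rowsp"
    using mulredr_redset[OF assms] w by (intro rowsp_diff rowsp_rsm) (auto simp: redset_def)
  fix i assume i: "i < d"
  show "\<exists>g. slp_fin g \<and> (rsm (pmon 1 1) w - mulredr w) i = g \<otimes>\<^sub>p lam i"
  proof (cases "h i > 0")
    case True
    have "(rsm (pmon 1 1) w - mulredr w) i = rsm (pmon 1 1) w i - mulredr w i" by (rule minus_apply)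
    also have "\<dots> = pmon 1 1 \<otimes>\<^sub>p w i - (pmon 1 1 \<otimes>\<^sub>p w i - pmon (w i (h i - 1)) 0 \<otimes>\<^sub>p lam i)"
      using i True by (simp only: rsm_def mulredr_def mulred_def if_True simp_thms)
    also have "\<dots> = pmon (w i (h i - 1)) 0 \<otimes>\<^sub>p lam i" by (simp only: diff_diff_eq2 add_diff_cancel_left')
    finally show ?thesis using slp_fin_pmon by blast
  next
    case False
    then have "w i = 0" using assms i by (auto simp: redset_def fun_eq_iff)
    moreover have "(rsm (pmon 1 1) w - mulredr w) i = rsm (pmon 1 1) w i - mulredr w i" by (rule minus_apply)
    ultimately have "(rsm (pmon 1 1) w - mulredr w) i = 0 \<otimes>\<^sub>p lam i"
      using False by (simp only: rsm_def mulredr_def pmul_zero simp_thms if_False diff_self)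
    then show ?thesis using slp_fin_zero(1) by blast
  qed
qed

definition mulredn :: "nat \<Rightarrow> (nat \<Rightarrow> 'k slp) \<Rightarrow> nat \<Rightarrow> 'k slp" where "mulredn n = mulredr ^^ n"

lemma mulredn_redset: "w \<in> redset \<Longrightarrow> mulredn n w \<in> redset"
  by (induction n) (auto simp: mulredn_def mulredr_redset)

lemma mulredn_diag: assumes "w \<in> redset" shows "rsm (pmon 1 n) w - mulredn n w \<in> diagset lam"
proof (induction n)
  case 0
  have "0 \<in> diagset lam" using diagset_rsm[OF mulredr_diag[OF assms], of 0] by simp
  then show ?case by (simp only: pmon_1_0 rsm_one mulredn_def funpow_0 diff_self)
next
  case (Suc n)
  let ?t = "rsm (pmon 1 1)"
  have 1: "?t (rsm (pmon 1 n) w - mulredn n w) \<in> diagset lam" by (rule diagset_rsm[OF Suc]) simp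
  have 2: "?t (mulredn n w) - mulredn (Suc n) w \<in> diagset lam"
    using mulredr_diag[OF mulredn_redset[OF assms]] by (simp add: mulredn_def)
  have "?t (rsm (pmon 1 n) w - mulredn n w) = rsm (pmon 1 (Suc n)) w - ?t (mulredn n w)"
    using rsm_add_right[of "pmon 1 1" "rsm (pmon 1 n) w - mulredn n w" "mulredn n w"]
    by (simp only: diff_add_cancel rsm_assoc pmon_1_add) (simp only: plus_1_eq_Suc add_diff_cancel_right')
  then show ?case using diagset_add[OF 1 2] by (simp only: diff_add_cancel add_diff_eq)
qed

lemma mulredn_gvr:
  assumes "\<And>i. i < d \<Longrightarrow> straight s (lam i) (h i)" "w \<in> redset"
  shows "gvr s (mulredn n w) (c - s * real n) \<longleftrightarrow> gvr s w c"
proof (induction n arbitrary: c)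
  case (Suc n)
  have "gvr s (mulredr u) (b - s) \<longleftrightarrow> gvr s u b" if u: "u \<in> redset" for u b
  proof -
    have "gv s (mulredr u i) (b - s) \<longleftrightarrow> gv s (u i) b" for i
    proof (cases "i < d \<and> h i > 0")
      case True
      then have "\<And>n. n \<ge> h i \<Longrightarrow> u i n = 0" using u by (auto simp: redset_def)
      then show ?thesis using True mulred_gv[OF assms(1)[of i], of "u i" b]
        by (simp add: mulredr_def)
    next
      case False
      have "u i n = 0" for n
        by (cases "i < d") (use u False in \<open>auto simp: redset_def rowsp_def\<close>)
      then have "u i = 0" by (simp add: fun_eq_iff)
      then show ?thesis using False by (simp only: mulredr_def if_False gv_0)
    qed
    then show ?thesis by (simp add: gvr_def)
  qed
  from this[OF mulredn_redset[OF assms(2), of n], of "c - s * real n"] Suc[of c]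
  show ?case by (simp add: mulredn_def algebra_simps)
qed (simp add: mulredn_def)

text \<open>The row of an element y of V modulo the diagonal row space is its class in
  the direct sum of the S[t]/S[t] lam i.\<close>

lemma Q_emb_tn:
  assumes "x \<in> vs"
  shows "rsm (pmon 1 n) (Q (emb x)) - Q (emb (vDn n x)) \<in> diagset lam"
proof -
  have "Q (rsm (pmon 1 n) (emb x) - emb (vDn n x)) \<in> diagset lam"
    by (rule Q_rspan[OF tn_emb[OF assms]])
  then show ?thesis by (simp only: rlin_diff[OF Q] rlin_rsm[OF Q])
qed

lemma ev_Q':
  assumes "y \<in> vs" "w \<in> rowsp" "Q (emb y) - w \<in> diagset lam"
  shows "ev (Q' w) = y"
proof (rule ev_unique[OF rlin_rowsp[OF Q' assms(2)] assms(1)])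
  have "Q' (w - Q (emb y)) \<in> rspan CM"
    using diagset_minus[OF assms(3)] by (intro Q'_diag) (simp only: minus_diff_eq)
  then show "Q' w - emb y \<in> rspan CM" by (simp only: rlin_diff[OF Q'] Q'Q)
qed

text \<open>The constant depends on N, since each power of D may cost a fixed amount as long as no
  growth rate is known.\<close>

lemma evN_vvge: "\<exists>C. \<forall>f c. gvr s f c \<longrightarrow> vvge (evN N f) (c - C)"
proof -
  obtain e where e: "\<And>n x c. vvge x c \<Longrightarrow> vvge (vDn n x) (c - real n * e)" using vDn_vvge by blast
  obtain m where m: "\<And>n. n < N \<Longrightarrow> m \<le> s * real n - real n * e"
    using finite_lower[of N "\<lambda>n. s * real n - real n * e"] by blast
  have "vvge (evN N f) (c - (- m))" if f: "gvr s f c" for f c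
    unfolding evN_def
  proof (rule vvge_sum)
    fix n assume n: "n \<in> {..<N}"
    have "vvge (crow f n) (c + s * real n)"
      using f by (simp add: vvge_def crow_def gvr_def gv_def)
    then have "vvge (vDn n (crow f n)) (c + s * real n - real n * e)" by (rule e)
    then show "vvge (vDn n (crow f n)) (c - (- m))"
      by (rule vvge_mono) (use m[of n] n in auto)
  qed
  then show ?thesis by blast
qed

text \<open>On reduced rows t^n shifts the Gauss valuation by exactly s n. Passing between an
  element of V and its reduced row costs a constant in either direction, and these constants do not
  involve n.\<close>

theorem straight_imp_growth:
  assumes st: "\<And>i. i < d \<Longrightarrow> straight s (lam i) (h i)"
  shows "\<exists>C. \<forall>n. \<forall>x\<in>vs. \<forall>c. (vvge x c \<longrightarrow> vvge (vDn n x) (c - s * real n - C)) \<and>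
     (vvge (vDn n x) (c - s * real n) \<longrightarrow> vvge x (c - C))"
proof -
  have gvl: "\<And>i. i < d \<Longrightarrow> gv s (lam i) (- s * real (h i))" using st by (simp add: straight_def)
  obtain C1 where C1: "\<And>x c. x \<in> rowsp \<Longrightarrow> gvr s x c \<Longrightarrow> gvr s (Q x) (c - C1)"
    using rlin_gvr[OF Q] by blast
  obtain C2 where C2: "\<And>x c. x \<in> rowsp \<Longrightarrow> gvr s x c \<Longrightarrow> gvr s (Q' x) (c - C2)"
    using rlin_gvr[OF Q'] by blast
  \<comment> \<open>Reduced rows have degree below the sum of the \<open>h i\<close>, and
    \<open>Q'\<close> adds at most M. One cutoff therefore serves all evaluations, which makes the
    constant of \<open>evN_vvge\<close> uniform.\<close>
  obtain M where M: "\<forall>x\<in>rowsp. \<forall>h. (\<forall>k. \<forall>n\<ge>h. x k n = 0) \<longrightarrow> (\<forall>k. \<forall>n\<ge>h+M. Q' x k n = 0)"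
    using rlin_degree[OF Q'] by blast
  define H where "H = (\<Sum>i<d. h i)"
  obtain C3 where C3: "\<And>f c. gvr s f c \<Longrightarrow> vvge (evN (H + M) f) (c - C3)"
    using evN_vvge[of s "H + M"] by blast
  have low: "vvge y (c - C2 - C3)"
    if y: "y \<in> vs" "w \<in> redset" "Q (emb y) - w \<in> diagset lam" "gvr s w c" for y w c
  proof -
    have w: "w \<in> rowsp" using y(2) by (simp add: redset_def)
    have "w k n = 0" if "n \<ge> H" for k n
    proof (cases "k < d")
      case True
      then have "h k \<le> H" unfolding H_def by (intro member_le_sum) auto
      then show ?thesis using y(2) True that by (auto simp: redset_def)
    qed (use w in \<open>auto simp: rowsp_def\<close>)
    then have "\<forall>k. \<forall>n\<ge>H+M. Q' w k n = 0" using M w by blast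
    then have "ev (Q' w) = evN (H + M) (Q' w)" by (intro ev_eq) blast
    then show ?thesis using C3[OF C2[OF w y(4)]] ev_Q'[OF y(1) w y(3)] by metis
  qed
  have up: "gvr s w (c - C1)"
    if y: "y \<in> vs" "w \<in> redset" "Q (emb y) - w \<in> diagset lam" "vvge y c" for y w c
  proof -
    have e: "emb y \<in> rowsp" by (rule emb_rowsp[OF y(1)])
    have "gvr s (Q (emb y)) (c - C1)" by (rule C1[OF e]) (simp add: gvr_emb y(4))
    then obtain w' where w': "w' \<in> redset" "Q (emb y) - w' \<in> diagset lam" "gvr s w' (c - C1)"
      using reduce[OF gvl rlin_rowsp[OF Q e]] by blast
    then have "w = w'" using reduce_unique y by blast
    then show ?thesis using w'(3) by simp
  qed
  have "(vvge x c \<longrightarrow> vvge (vDn n x) (c - s * real n - (C1 + C2 + C3))) \<and>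
     (vvge (vDn n x) (c - s * real n) \<longrightarrow> vvge x (c - (C1 + C2 + C3)))" if x: "x \<in> vs" for n x c
  proof -
    have e: "Q (emb x) \<in> rowsp" by (rule rlin_rowsp[OF Q emb_rowsp[OF x]])
    obtain b where "gvr s (Q (emb x)) b" using gvr_ex[OF e] by blast
    then obtain w where w: "w \<in> redset" "Q (emb x) - w \<in> diagset lam"
      using reduce[OF gvl e] by blast
    define wn where "wn = mulredn n w"
    have wn: "wn \<in> redset" unfolding wn_def by (rule mulredn_redset[OF w(1)])
    have "rsm (pmon 1 n) (Q (emb x) - w) \<in> diagset lam" by (rule diagset_rsm[OF w(2)]) simp
    moreover have "rsm (pmon 1 n) (Q (emb x) - w) = rsm (pmon 1 n) (Q (emb x)) - rsm (pmon 1 n) w"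
      using rsm_add_right[of "pmon 1 n" "Q (emb x) - w" w]
      by (simp only: diff_add_cancel) (simp only: add_diff_cancel_right')
    ultimately have a: "rsm (pmon 1 n) (Q (emb x)) - rsm (pmon 1 n) w \<in> diagset lam" by metis
    have b: "rsm (pmon 1 n) w - wn \<in> diagset lam" unfolding wn_def by (rule mulredn_diag[OF w(1)])
    have c: "rsm (pmon 1 n) (Q (emb x)) - wn \<in> diagset lam"
      using diagset_add[OF a b] by (simp only: diff_add_cancel add_diff_eq)
    have y: "Q (emb (vDn n x)) - wn \<in> diagset lam"
      using diagset_diff[OF c Q_emb_tn[OF x, of n]] by (simp only: diff_diff_diff_cancel)
    have g: "gvr s wn (b - s * real n) \<longleftrightarrow> gvr s w b" for b
      unfolding wn_def by (rule mulredn_gvr[OF st w(1)])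
    show ?thesis
    proof (intro conjI impI)
      assume "vvge x c"
      then have "gvr s w (c - C1)" by (rule up[OF x w])
      then have "gvr s wn (c - C1 - s * real n)" by (simp only: g)
      then have "vvge (vDn n x) (c - C1 - s * real n - C2 - C3)" by (rule low[OF vDn_vs[OF x] wn y])
      then show "vvge (vDn n x) (c - s * real n - (C1 + C2 + C3))" by (simp add: algebra_simps)
    next
      assume "vvge (vDn n x) (c - s * real n)"
      then have "gvr s wn (c - s * real n - C1)" by (rule up[OF vDn_vs[OF x] wn y])
      then have "gvr s wn ((c - C1) - s * real n)" by (simp add: algebra_simps)
      then have "gvr s w (c - C1)" by (simp only: g)
      then have "vvge x (c - C1 - C2 - C3)" by (rule low[OF x w])
      then show "vvge x (c - (C1 + C2 + C3))" by (simp add: algebra_simps)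
    qed
  qed
  then show ?thesis by blast
qed

end

section \<open>Growth determines the last invariant factor\<close>

context skew begin

text \<open>Here c is the intercept of the supporting line of slope s, j the last index on this
  line, and \<delta> the least distance of the other points from it, capped at 1 so that it exists
  when there are none.\<close>

lemma newton_vertex:
  assumes "slp_fin f" "f \<noteq> 0"
  shows "\<exists>c j \<delta>. \<delta> > 0 \<and> gv s f c \<and> f j \<noteq> 0 \<and> real_of_int (fls_subdegree (f j)) = c + s * real j \<and>
    (\<forall>i>j. vge (f i) (c + s * real i + \<delta>))"
proof -
  define A where "A = {i. f i \<noteq> 0}"
  have A: "finite A" "A \<noteq> {}" using assms by (auto simp: A_def slp_fin_def fun_eq_iff)
  define v where "v i = real_of_int (fls_subdegree (f i)) - s * real i" for i :: nat
  define c where "c = Min (v ` A)"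
  have c: "c \<le> v i" if "i \<in> A" for i unfolding c_def using A that by simp
  define J where "J = {i\<in>A. v i = c}"
  have "c \<in> v ` A" unfolding c_def using A by (intro Min_in) auto
  then have J: "finite J" "J \<noteq> {}" using A by (auto simp: J_def)
  define j where "j = Max J"
  have j: "j \<in> J" unfolding j_def using J by simp
  define \<delta> where "\<delta> = Min (insert 1 ((\<lambda>i. v i - c) ` (A - J)))"
  have d: "\<delta> > 0" unfolding \<delta>_def using A c by (subst Min_gr_iff) (auto simp: J_def less_le)
  have d2: "\<delta> \<le> v i - c" if "i \<in> A" "i \<notin> J" for i
    unfolding \<delta>_def using A that by (intro Min_le) auto
  have "gv s f c" unfolding gv_def
  proof
    fix i show "vge (f i) (c + s * real i)"
      by (cases "f i = 0") (use c[of i] in \<open>auto simp: vge_iff v_def A_def\<close>)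
  qed
  moreover have "vge (f i) (c + s * real i + \<delta>)" if "i > j" for i
  proof (cases "f i = 0")
    case False
    have "i \<notin> J" using that J unfolding j_def by (metis Max_ge leD)
    then show ?thesis using d2[of i] False by (auto simp: vge_iff v_def A_def)
  qed simp
  ultimately show ?thesis using j d by (intro exI[of _ c] exI[of _ j] exI[of _ \<delta>]) (auto simp: J_def A_def v_def)
qed

text \<open>Division by the part of l below its last vertex of slope s makes the remainder small; only the
  leading coefficient of the vertex is inverted, the rest of that coefficient goes into the error.\<close>

lemma weierstrass_approx:
  assumes l: "gv s l c" "l j \<noteq> 0" "real_of_int (fls_subdegree (l j)) = c + s * real j"
    "\<And>i. i > j \<Longrightarrow> vge (l i) (c + s * real i + \<delta>)" and fin: "slp_fin l" and \<delta>: "0 < \<delta>" "\<delta> \<le> 1"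
  shows "\<exists>r e g. pmon 1 j = r + e + g \<otimes>\<^sub>p l \<and> slp_fin e \<and> slp_fin g \<and> (\<forall>i\<ge>j. r i = 0) \<and>
    gv s e (- s * real j + real n * \<delta>)"
proof -
  define v where "v = fls_subdegree (l j)"
  have lead: "l j $$ v \<noteq> 0" using l(2) by (simp add: v_def)
  \<comment> \<open>The inverse of the lowest monomial of \<open>l j\<close>, to be multiplied from
    the left; moving sigma^(-v) past the coefficient produces the Frobenius power in the
    denominator.\<close>
  define a where "a = smon (1 / phi_int v (l j $$ v)) (- v)"
  define l' where "l' = pmon a 0 \<otimes>\<^sub>p l"
  have l'_nth: "l' i = a \<star> l i" for i by (simp add: l'_def pmon_pmul)
  have va: "vge a (- real_of_int v)" unfolding a_def using vge_smon[of _ "- v"] by simp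
  have sj: "- real_of_int v + c = - s * real j" using l(3) by (simp add: v_def)
  have gl': "gv s l' (- s * real j)"
  proof -
    have "gv s (pmon a 0) (- real_of_int v)" unfolding gv_pmon using va by simp
    from gv_mult[OF this l(1)] show ?thesis unfolding l'_def sj .
  qed
  define mu where "mu = (\<lambda>i. if i < j then l' i else if i = j then 1 else 0)"
  have mon: "pmonic mu j" by (auto simp: pmonic_def mu_def)
  have gmu: "gv s mu (- s * real j)"
    using gl' unfolding gv_def mu_def by (auto simp: vge_one)
  \<comment> \<open>At index j only the lowest coefficient has been normalized to 1, so the
    difference there has order at least 1; this is why \<delta> must not exceed 1.\<close>
  define E where "E = l' - mu"
  have gE: "gv s E (- s * real j + \<delta>)"
    unfolding gv_def
  proof
    fix i
    consider "i < j" | "i = j" | "i > j" by linarith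
    then show "vge (E i) (- s * real j + \<delta> + s * real i)"
    proof cases
      case 1 then show ?thesis by (simp add: E_def mu_def)
    next
      case 2
      have "(a \<star> l j) $$ 0 = 1" using lead by (simp add: a_def smon_mult_nth)
      moreover have "(a \<star> l j) $$ m = 0" if "m < 0" for m
        using that by (simp add: a_def smon_mult_nth v_def)
      ultimately have "vge (a \<star> l j - 1) 1"
        unfolding vge_def minus_fls.rep_eq using less_linear by (auto simp: less_le) 
      then have "vge (a \<star> l j - 1) \<delta>" by (rule vge_mono[OF _ \<delta>(2)])
      then show ?thesis using 2 by (simp add: E_def mu_def l'_nth)
    next
      case 3
      have "vge (a \<star> l i) (- real_of_int v + (c + s * real i + \<delta>))" by (rule vge_mult[OF va l(4)[OF 3]])
      moreover have "- real_of_int v + (c + s * real i + \<delta>) = - s * real j + \<delta> + s * real i"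
        using sj by simp
      ultimately have "vge (a \<star> l i) (- s * real j + \<delta> + s * real i)" by metis
      then show ?thesis using 3 by (simp add: E_def mu_def l'_nth)
    qed
  qed
  have finE: "slp_fin E" unfolding E_def l'_def
    by (intro slp_fin_diff slp_fin_mult slp_fin_pmon fin) (auto simp: slp_fin_bound mu_def intro!: exI[of _ "Suc j"])
  show ?thesis
  proof (induction n)
    case 0
    have "gv s (pmon 1 j) (- s * real j + real 0 * \<delta>)" by (simp add: gv_pmon vge_one)
    moreover have "pmon 1 j = 0 + pmon 1 j + 0 \<otimes>\<^sub>p l"
      by (simp only: pmul_zero add_0 add_0_right)
    moreover have "\<forall>i\<ge>j. (0 :: 'k slp) i = 0" by simp
    ultimately show ?case using slp_fin_pmon slp_fin_zero(1) by blast
  next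
    case (Suc n)
    then obtain r e g where IH: "pmon 1 j = r + e + g \<otimes>\<^sub>p l" "slp_fin e" "slp_fin g"
      "\<forall>i\<ge>j. r i = 0" "gv s e (- s * real j + real n * \<delta>)" by blast
    obtain g' r' where D: "e = g' \<otimes>\<^sub>p mu + r'" "slp_fin g'" "\<forall>i\<ge>j. r' i = 0"
        "gv s g' (- s * real j + real n * \<delta> + s * real j)"
      using poly_division[OF mon gmu IH(2,5)] by blast
    \<comment> \<open>As \<open>mu\<close> is \<open>l'\<close> minus \<open>E\<close>, division by
      \<open>mu\<close> is division by l up to the error g' \<open>E\<close>, whose Gauss bound is
      better than that of e by \<delta>.\<close>
    have mu_eq: "g' \<otimes>\<^sub>p mu = (g' \<otimes>\<^sub>p pmon a 0) \<otimes>\<^sub>p l - g' \<otimes>\<^sub>p E"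
      unfolding E_def pmul_diff_right l'_def pmul_assoc by (simp only: diff_diff_eq2 add_diff_cancel_left')
    have "pmon 1 j = (r + r') + (- (g' \<otimes>\<^sub>p E)) + (g + g' \<otimes>\<^sub>p pmon a 0) \<otimes>\<^sub>p l"
      unfolding IH(1) D(1) mu_eq pmul_add_left by (simp only: diff_conv_add_uminus add_ac)
    moreover have "slp_fin (- (g' \<otimes>\<^sub>p E))" by (intro slp_fin_minus slp_fin_mult D(2) finE)
    moreover have "slp_fin (g + g' \<otimes>\<^sub>p pmon a 0)" by (intro slp_fin_add slp_fin_mult D(2) IH(3) slp_fin_pmon)
    moreover have "\<forall>i\<ge>j. (r + r') i = 0" using IH(4) D(3) by simp
    moreover have "gv s (- (g' \<otimes>\<^sub>p E)) (- s * real j + real (Suc n) * \<delta>)"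
    proof -
      have "gv s (g' \<otimes>\<^sub>p E) ((- s * real j + real n * \<delta> + s * real j) + (- s * real j + \<delta>))"
        by (rule gv_mult[OF D(4) gE])
      then show ?thesis by (intro gv_minus) (simp add: algebra_simps)
    qed
    ultimately show ?case by blast
  qed
qed

text \<open>The reversed polynomial t^N f(1/t).\<close>

definition prev :: "nat \<Rightarrow> 'k slp \<Rightarrow> 'k slp" where
  "prev N f = (\<lambda>i. if i \<le> N then f (N - i) else 0)"

lemma prev_add: "prev N (f + g) = prev N f + prev N g" by (rule ext) (simp add: prev_def)
lemma prev_shift:
  assumes "\<And>i. i > M \<Longrightarrow> f i = 0" "M \<le> N"
  shows "prev N f = pmon 1 (N - M) \<otimes>\<^sub>p prev M f"
proof (rule ext)
  fix i
  have 1: "(pmon 1 (N - M) \<otimes>\<^sub>p prev M f) i = (if i < N - M then 0 else prev M f (i - (N - M)))"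
    by (simp add: pmon_pmul)
  show "prev N f i = (pmon 1 (N - M) \<otimes>\<^sub>p prev M f) i"
    unfolding 1 using assms by (auto simp: prev_def)
qed

lemma prev_gv:
  assumes "gv (- s) f c" shows "gv s (prev N f) (c - s * real N)"
  unfolding gv_def
proof
  fix i
  show "vge (prev N f i) (c - s * real N + s * real i)"
  proof (cases "i \<le> N")
    case True
    have "vge (f (N - i)) (c + - s * real (N - i))" using assms unfolding gv_def by blast
    moreover have "c + - s * real (N - i) = c - s * real N + s * real i"
      using True by (simp add: of_nat_diff algebra_simps)
    ultimately have "vge (f (N - i)) (c - s * real N + s * real i)" by metis
    then show ?thesis using True by (simp add: prev_def)
  qed (simp add: prev_def)
qed

text \<open>Reversal is multiplicative and keeps the order of the factors, because t is central;
  reversing \<open>prev H l\<close> gives back l.\<close>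

lemma prev_mult:
  assumes l: "\<And>i. i > H \<Longrightarrow> l i = 0" and g: "\<And>i. i > G \<Longrightarrow> g i = 0" and N: "N = G + H"
  shows "prev N (g \<otimes>\<^sub>p prev H l) = prev G g \<otimes>\<^sub>p l"
proof (rule ext)
  fix i
  define F where "F k = (if k \<le> N - i \<and> N - i - k \<le> H then l (H - (N - i - k)) else 0)" for k
  have R: "(prev G g \<otimes>\<^sub>p l) i = (\<Sum>k\<le>G. g k \<star> (if G - k \<le> i then l (i - (G - k)) else 0))"
  proof -
    have "(prev G g \<otimes>\<^sub>p l) i = (\<Sum>m\<in>{..i} \<inter> {..G}. g (G - m) \<star> l (i - m))"
      unfolding pmul_nth by (rule sum.mono_neutral_cong_right) (auto simp: prev_def)
    also have "\<dots> = (\<Sum>m\<le>G. g (G - m) \<star> (if m \<le> i then l (i - m) else 0))"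
      by (rule sum.mono_neutral_cong_left) auto
    also have "\<dots> = (\<Sum>k\<le>G. g k \<star> (if G - k \<le> i then l (i - (G - k)) else 0))"
      by (rule sum.reindex_bij_witness[of _ "\<lambda>k. G - k" "\<lambda>k. G - k"]) auto
    finally show ?thesis .
  qed
  show "prev N (g \<otimes>\<^sub>p prev H l) i = (prev G g \<otimes>\<^sub>p l) i"
  proof (cases "i \<le> N")
    case True
    have "prev N (g \<otimes>\<^sub>p prev H l) i = (\<Sum>k\<le>N - i. g k \<star> prev H l (N - i - k))"
      unfolding prev_def[of N] if_P[OF True] pmul_nth ..
    also have "\<dots> = (\<Sum>k\<in>{..N - i} \<inter> {..G}. g k \<star> F k)"
      by (rule sum.mono_neutral_cong_right) (auto simp: g F_def prev_def)
    also have "\<dots> = (\<Sum>k\<le>G. g k \<star> F k)"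
      by (rule sum.mono_neutral_cong_left) (auto simp: F_def)
    also have "\<dots> = (\<Sum>k\<le>G. g k \<star> (if G - k \<le> i then l (i - (G - k)) else 0))"
    proof (rule sum.cong)
      fix k assume "k \<in> {..G}"
      then have k: "k \<le> G" by simp
      have "F k = (if G - k \<le> i then l (i - (G - k)) else 0)"
      proof (cases "G - k \<le> i")
        case a: True
        show ?thesis
        proof (cases "k \<le> N - i")
          case b: True
          have "N - i - k \<le> H" using a k N by linarith
          moreover have "H - (N - i - k) = i - (G - k)" using a b k N True by linarith
          ultimately show ?thesis using a b by (simp add: F_def)
        next
          case False
          then have "i - (G - k) > H" using a k N True by linarith
          then show ?thesis using False a l by (simp add: F_def)
        qed
      next
        case False
        then have "\<not> (k \<le> N - i \<and> N - i - k \<le> H)" using k N True by linarith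
        then show ?thesis unfolding F_def if_not_P[OF False] by (rule if_not_P)
      qed
      then show "g k \<star> F k = g k \<star> (if G - k \<le> i then l (i - (G - k)) else 0)" by simp
    qed simp
    finally show ?thesis using R by simp
  next
    case False
    have "(\<Sum>k\<le>G. g k \<star> (if G - k \<le> i then l (i - (G - k)) else 0)) = 0"
      by (rule sum.neutral) (use False N l in auto)
    then show ?thesis using R False by (simp add: prev_def)
  qed
qed

text \<open>For s large enough the line of slope s through the point (h, 0) of the leading
  coefficient passes below all other points, whatever the polygon is. At such slopes division by f
  preserves Gauss bounds.\<close>

lemma pmonic_gv_large: assumes "pmonic f h" shows "\<exists>s0. \<forall>s\<ge>s0. gv s f (- s * real h)"
proof -
  obtain m where m: "\<And>i. i < h \<Longrightarrow> m \<le> real_of_int (fls_subdegree (f i))"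
    using finite_lower by meson
  have "gv s f (- s * real h)" if s: "s \<ge> max 0 (- m)" for s
    unfolding gv_def
  proof
    fix i
    consider "i < h" | "i = h" | "i > h" by linarith
    then show "vge (f i) (- s * real h + s * real i)"
    proof cases
      case 1
      have "s * 1 \<le> s * (real h - real i)" using 1 s by (intro mult_left_mono) auto
      then have "- s * real h + s * real i \<le> - s" by (simp add: algebra_simps)
      also have "\<dots> \<le> real_of_int (fls_subdegree (f i))" using m[OF 1] s by simp
      finally show ?thesis by (rule vge_mono[OF vge_subdegree])
    qed (use assms in \<open>auto simp: pmonic_def vge_one\<close>)
  qed
  then show ?thesis by blast
qed

end

section \<open>The summand of the last invariant factor\<close>

locale tmod_last = tmod_iso q K d D Q Q' lam h
  for q and K :: "'k::field itself" and d and D :: "'k skmat" and Q Q' lam h +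
  assumes d_pos: "d \<ge> 1"
begin

definition ld :: nat where "ld = d - 1"

lemma ld_lt: "ld < d" using d_pos by (simp add: ld_def)

abbreviation L where "L \<equiv> lam ld"
abbreviation H where "H \<equiv> h ld"

text \<open>The class of f in the quotient by the last invariant factor, regarded as an element of
  V. Left multiples of \<open>L\<close> go to 0, and multiplication by t becomes D.\<close>

definition Phi :: "'k slp \<Rightarrow> nat \<Rightarrow> 'k fls" where
  "Phi f = ev (Q' (rsm f (runit ld)))"

lemma unit_row: "slp_fin f \<Longrightarrow> rsm f (runit ld) \<in> rowsp"
  using ld_lt by (intro rowsp_rsm runit_rowsp)

lemma unit_row_nth: "rsm f (runit ld) k = (if k = ld then f else 0)"
  by (simp add: rsm_def runit_def)

lemma L_monic: "pmonic L H" using lam_monic ld_lt by simp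

lemma ev_cong:
  assumes "f \<in> rowsp" "g \<in> rowsp" "f - g \<in> rspan CM" shows "ev f = ev g"
proof (rule ev_unique[OF assms(1) ev_vs[OF assms(2)]])
  have "(f - g) + (g - emb (ev g)) \<in> rspan CM"
    by (rule rspan_add[OF assms(3) ev_rspan[OF assms(2)]])
  then show "f - emb (ev g) \<in> rspan CM" by (simp only: diff_add_cancel add_diff_eq)
qed

lemma Phi_vs: "slp_fin f \<Longrightarrow> Phi f \<in> vs"
  unfolding Phi_def by (intro ev_vs rlin_rowsp[OF Q'] unit_row)

lemma Phi_cong:
  assumes "slp_fin f" "slp_fin e" "slp_fin g" "f = e + g \<otimes>\<^sub>p L"
  shows "Phi f = Phi e"
  unfolding Phi_def
proof (rule ev_cong)
  let ?u = "\<lambda>f. rsm f (runit ld)"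
  show "Q' (?u f) \<in> rowsp" "Q' (?u e) \<in> rowsp"
    by (intro rlin_rowsp[OF Q'] unit_row assms)+
  have "?u (g \<otimes>\<^sub>p L) \<in> diagset lam"
  proof (rule diagsetI)
    show "?u (g \<otimes>\<^sub>p L) \<in> rowsp" using assms(3) pmonic_fin[OF L_monic] by (intro unit_row slp_fin_mult)
    fix i assume "i < d"
    show "\<exists>a. slp_fin a \<and> ?u (g \<otimes>\<^sub>p L) i = a \<otimes>\<^sub>p lam i"
    proof (cases "i = ld")
      case True
      then show ?thesis using assms(3) unit_row_nth by auto
    next
      case False
      then have "?u (g \<otimes>\<^sub>p L) i = 0 \<otimes>\<^sub>p lam i" by (simp only: unit_row_nth if_False pmul_zero)
      then show ?thesis using slp_fin_zero(1) by blast
    qed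
  qed
  then have "Q' (?u (g \<otimes>\<^sub>p L)) \<in> rspan CM" by (rule Q'_diag)
  moreover have "Q' (?u f) = Q' (?u e) + Q' (?u (g \<otimes>\<^sub>p L))"
    unfolding assms(4) rsm_add_left by (rule rlin_add[OF Q'])
  ultimately show "Q' (?u f) - Q' (?u e) \<in> rspan CM" by (simp only: add_diff_cancel_left')
qed

lemma Phi_shift: assumes "slp_fin f" shows "Phi (pmon 1 n \<otimes>\<^sub>p f) = vDn n (Phi f)"
proof -
  let ?u = "\<lambda>f. rsm f (runit ld)"
  have F: "Q' (?u f) \<in> rowsp" by (intro rlin_rowsp[OF Q'] unit_row assms)
  have e: "Q' (?u (pmon 1 n \<otimes>\<^sub>p f)) = rsm (pmon 1 n) (Q' (?u f))"
    unfolding rsm_assoc[symmetric] by (rule rlin_rsm[OF Q'])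
  show ?thesis unfolding Phi_def e
  proof (rule ev_unique)
    show "rsm (pmon 1 n) (Q' (?u f)) \<in> rowsp" using F by (intro rowsp_rsm) auto
    show "vDn n (ev (Q' (?u f))) \<in> vs" by (intro vDn_vs ev_vs F)
    let ?E = "emb (ev (Q' (?u f)))"
    have "rsm (pmon 1 n) (Q' (?u f) - ?E) \<in> rspan CM"
      by (rule rspan_rsm[OF ev_rspan[OF F]]) simp
    moreover have "rsm (pmon 1 n) (Q' (?u f) - ?E) = rsm (pmon 1 n) (Q' (?u f)) - rsm (pmon 1 n) ?E"
      using rsm_add_right[of "pmon 1 n" "Q' (?u f) - ?E" ?E]
      by (simp only: diff_add_cancel) (simp only: add_diff_cancel_right')
    ultimately have a: "rsm (pmon 1 n) (Q' (?u f)) - rsm (pmon 1 n) ?E \<in> rspan CM" by metis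
    show "rsm (pmon 1 n) (Q' (?u f)) - emb (vDn n (ev (Q' (?u f)))) \<in> rspan CM"
      using rspan_add[OF a tn_emb[OF ev_vs[OF F], of n]] by (simp only: diff_add_cancel add_diff_eq)
  qed
qed

text \<open>The reduced representative is recovered from its image in V by \<open>Q\<close> and
  division, at the cost of a constant. No polygon is known here, so the division by the
  \<open>lam i\<close> takes place at a steep slope \<open>s'\<close>, as
  \<open>pmonic_gv_large\<close> permits.\<close>

lemma Phi_lower:
  "\<exists>C2. \<forall>w c i. (\<forall>n\<ge>H. w n = 0) \<longrightarrow> vvge (Phi w) c \<longrightarrow> vge (w i) (c - C2)"
proof -
  have "\<exists>s0. \<forall>s\<ge>s0. gv s (lam i) (- s * real (h i))" if "i < d" for i
    by (rule pmonic_gv_large[OF lam_monic[OF that]])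
  then obtain s0 where s0: "\<And>i s. i < d \<Longrightarrow> s \<ge> s0 i \<Longrightarrow> gv s (lam i) (- s * real (h i))" by metis
  obtain m where m: "\<And>i. i < d \<Longrightarrow> m \<le> - s0 i" using finite_lower[of d "\<lambda>i. - s0 i"] by blast
  \<comment> \<open>At least every \<open>s0 i\<close>, and nonnegative so that the Gauss bound at
    slope \<open>s'\<close> bounds each single coefficient.\<close>
  define s' where "s' = max 0 (- m)"
  have gl: "gv s' (lam i) (- s' * real (h i))" if "i < d" for i
    using s0[OF that, of s'] m[OF that] by (simp add: s'_def max_def split: if_splits)
  obtain C1 where C1: "\<And>x c. x \<in> rowsp \<Longrightarrow> gvr s' x c \<Longrightarrow> gvr s' (Q x) (c - C1)"
    using rlin_gvr[OF Q, of s'] by blast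
  have "vge (w i) (c - C1)" if w: "\<forall>n\<ge>H. w n = 0" "vvge (Phi w) c" for w c i
  proof -
    let ?W = "rsm w (runit ld)"
    have fin: "slp_fin w" using w(1) slp_fin_bound by blast
    have W: "?W \<in> rowsp" by (rule unit_row[OF fin])
    have WR: "?W \<in> redset" using W w(1) by (auto simp: redset_def unit_row_nth)
    have P: "emb (Phi w) \<in> rowsp" by (rule emb_rowsp[OF Phi_vs[OF fin]])
    have "Q (Q' ?W - emb (ev (Q' ?W))) \<in> diagset lam"
      by (rule Q_rspan[OF ev_rspan[OF rlin_rowsp[OF Q' W]]])
    then have a: "?W - Q (emb (Phi w)) \<in> diagset lam"
      unfolding Phi_def by (simp only: rlin_diff[OF Q] QQ')
    have "gvr s' (Q (emb (Phi w))) (c - C1)" by (rule C1[OF P]) (simp add: gvr_emb w(2))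
    then obtain w' where w': "w' \<in> redset" "Q (emb (Phi w)) - w' \<in> diagset lam" "gvr s' w' (c - C1)"
      using reduce[OF gl rlin_rowsp[OF Q P]] by blast
    have "Q (emb (Phi w)) - ?W \<in> diagset lam" using diagset_minus[OF a] by (simp only: minus_diff_eq)
    then have "?W = w'" using reduce_unique[OF WR w'(1) _ w'(2)] by blast
    then have "gvr s' ?W (c - C1)" using w'(3) by metis
    then have "gv s' w (c - C1)" unfolding gvr_def unit_row_nth by (metis (full_types))
    then have "vge (w i) (c - C1 + s' * real i)" unfolding gv_def by blast
    then show ?thesis by (rule vge_mono) (simp add: s'_def)
  qed
  then show ?thesis by blast
qed

text \<open>Zero has every order, so by \<open>Phi_lower\<close> the coefficients of w have every
  order too.\<close>

lemma Phi_inj: assumes "\<forall>n\<ge>H. w n = 0" "Phi w = 0" shows "w = 0"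
proof (rule ccontr)
  assume "w \<noteq> 0"
  then obtain i where i: "w i \<noteq> 0" by (auto simp: fun_eq_iff)
  obtain C2 where C2: "\<And>w c i. \<forall>n\<ge>H. w n = 0 \<Longrightarrow> vvge (Phi w) c \<Longrightarrow> vge (w i) (c - C2)"
    using Phi_lower by blast
  have "vge (w i) (real_of_int (fls_subdegree (w i)) + C2 + 1 - C2)"
    by (rule C2[OF assms(1)]) (simp add: assms(2))
  then show False using i by (simp add: vge_iff)
qed

text \<open>If \<open>L\<close> were t times some mu, then t would kill the class of mu, which is
  nonzero because mu has degree below that of \<open>L\<close>; this contradicts the injectivity of
  D.\<close>

lemma const_nonzero: assumes inj: "\<And>x. x \<in> vs \<Longrightarrow> vD x = 0 \<Longrightarrow> x = 0" shows "L 0 \<noteq> 0"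
proof
  assume L0: "L 0 = 0"
  define mu where "mu n = L (Suc n)" for n
  have Lt: "L = pmon 1 1 \<otimes>\<^sub>p mu"
  proof (rule ext)
    fix n show "L n = (pmon 1 1 \<otimes>\<^sub>p mu) n"
      by (cases n) (simp_all add: pmon_pmul mu_def L0)
  qed
  have fin: "slp_fin L" by (rule pmonic_fin[OF L_monic])
  then have finmu: "slp_fin mu" unfolding slp_fin_bound mu_def by (metis le_SucI)
  have muH: "\<forall>n\<ge>H. mu n = 0" using L_monic by (auto simp: mu_def pmonic_def)
  have "Phi L = Phi 0"
    by (rule Phi_cong[OF fin _ slp_fin_one]) simp_all
  moreover have "Phi L = vD (Phi mu)"
    using Phi_shift[OF finmu, of 1] Lt by (simp only: One_nat_def vDn_Suc vDn_0)
  moreover have "Phi 0 = 0"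
  proof -
    have "Phi 0 = ev 0" unfolding Phi_def by (simp only: rsm_zero rlin_zero[OF Q'])
    also have "\<dots> = evN 0 0" by (rule ev_eq) simp
    finally show ?thesis by (simp add: evN_def)
  qed
  ultimately have "Phi mu = 0" using inj Phi_vs[OF finmu] by metis
  then have "mu = 0" by (rule Phi_inj[OF muH])
  moreover have "H \<noteq> 0" using L0 L_monic by (metis pmonic_def zero_neq_one)
  then have "mu (H - 1) = 1" using L_monic by (simp add: mu_def pmonic_def)
  ultimately show False by simp
qed

end

section \<open>The polygon of the last invariant factor under uniform growth\<close>

locale tmod_growth = tmod_last q K d D Q Q' lam h
  for q and K :: "'k::field itself" and d and D :: "'k skmat" and Q Q' lam h +
  fixes s C :: real
  assumes grow_up: "\<And>n x c. x \<in> vs \<Longrightarrow> vvge x c \<Longrightarrow> vvge (vDn n x) (c - s * real n - C)"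
    and grow_low: "\<And>n x c. x \<in> vs \<Longrightarrow> vvge (vDn n x) (c - s * real n) \<Longrightarrow> vvge x (c - C)"
begin

text \<open>Growth bounds f_n D^n in such a way that s n cancels, so the constant is independent of
  the degree of f; this is the gain over \<open>evN_vvge\<close>.\<close>

lemma Phi_upper: "\<exists>C1. \<forall>f c. slp_fin f \<longrightarrow> gv s f c \<longrightarrow> vvge (Phi f) (c - C1)"
proof -
  obtain C2 where C2: "\<And>x c. x \<in> rowsp \<Longrightarrow> gvr s x c \<Longrightarrow> gvr s (Q' x) (c - C2)"
    using rlin_gvr[OF Q'] by blast
  have "vvge (Phi f) (c - (C2 + C))" if f: "slp_fin f" "gv s f c" for f c
  proof -
    let ?F = "Q' (rsm f (runit ld))"
    have F: "?F \<in> rowsp" by (intro rlin_rowsp[OF Q'] unit_row f)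
    have "gvr s (rsm f (runit ld)) c" unfolding gvr_def unit_row_nth using f(2) by simp
    then have g: "gvr s ?F (c - C2)" by (rule C2[OF unit_row[OF f(1)]])
    obtain N where N: "\<And>k n. n \<ge> N \<Longrightarrow> ?F k n = 0" using rowsp_vanish[OF F] by blast
    have "ev ?F = evN N ?F" by (rule ev_eq) (rule N)
    moreover have "vvge (evN N ?F) (c - (C2 + C))" unfolding evN_def
    proof (rule vvge_sum)
      fix n
      have "vvge (crow ?F n) (c - C2 + s * real n)"
        using g by (simp add: vvge_def crow_def gvr_def gv_def)
      from grow_up[OF crow_vs[OF F] this, of n]
      show "vvge (vDn n (crow ?F n)) (c - (C2 + C))" by (simp add: algebra_simps)
    qed
    ultimately show ?thesis unfolding Phi_def by metis
  qed
  then show ?thesis by blast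
qed

lemma (in -) arch_contra: assumes "\<delta> > 0" "\<And>n. A + real n * \<delta> \<le> (0::real)" shows False
proof -
  obtain n where "- A < real n * \<delta>" using reals_Archimedean3[OF assms(1)] by metis
  then show False using assms(2)[of n] by linarith
qed

text \<open>Otherwise the last vertex of slope s is at some j < \<open>H\<close>. Approximate
  division then produces a reduced w with coefficient 1 at t^j whose image in V is that of an
  arbitrarily small error, against \<open>Phi_lower\<close>.\<close>

lemma growth_imp_upper: "gv s L (- s * real H)"
proof (rule ccontr)
  assume not: "\<not> gv s L (- s * real H)"
  have fin: "slp_fin L" by (rule pmonic_fin[OF L_monic])
  have LH: "L H = 1" using L_monic by (simp add: pmonic_def)
  then have "L \<noteq> 0" by auto
  then obtain c j \<delta>' where v: "\<delta>' > 0" "gv s L c" "L j \<noteq> 0"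
    "real_of_int (fls_subdegree (L j)) = c + s * real j"
    "\<forall>i>j. vge (L i) (c + s * real i + \<delta>')" using newton_vertex[OF fin, of s] by blast
  define \<delta> where "\<delta> = min \<delta>' 1"
  have d: "0 < \<delta>" "\<delta> \<le> 1" using v(1) by (auto simp: \<delta>_def)
  have v5: "vge (L i) (c + s * real i + \<delta>)" if "i > j" for i
    by (rule vge_mono[OF v(5)[rule_format, OF that]]) (simp add: \<delta>_def)
  have "j \<noteq> H"
  proof
    assume "j = H"
    then have "c = - s * real H" using v(4) LH by simp
    then show False using v(2) not by simp
  qed
  moreover have "j \<le> H" using v(3) L_monic by (auto simp: pmonic_def not_le[symmetric])
  ultimately have j: "j < H" by simp
  obtain C1 where C1: "\<And>f c. slp_fin f \<Longrightarrow> gv s f c \<Longrightarrow> vvge (Phi f) (c - C1)"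
    using Phi_upper by blast
  obtain C2 where C2: "\<And>w c i. \<forall>n\<ge>H. w n = 0 \<Longrightarrow> vvge (Phi w) c \<Longrightarrow> vge (w i) (c - C2)"
    using Phi_lower by blast
  have "(- s * real j - C1 - C2) + real n * \<delta> \<le> 0" for n
  proof -
    obtain r e g where W: "pmon 1 j = r + e + g \<otimes>\<^sub>p L" "slp_fin e" "slp_fin g" "\<forall>i\<ge>j. r i = 0"
      "gv s e (- s * real j + real n * \<delta>)"
      using weierstrass_approx[OF v(2,3,4) v5 fin d] by blast
    define w where "w = pmon 1 j - r"
    have w0: "\<forall>n\<ge>H. w n = 0" using j W(4) by (auto simp: w_def pmon_def)
    have "w = e + g \<otimes>\<^sub>p L" unfolding w_def W(1) by (simp only: add.assoc add_diff_cancel_left')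
    then have "Phi w = Phi e" using w0 slp_fin_bound W by (intro Phi_cong) auto
    then have "vvge (Phi w) (- s * real j + real n * \<delta> - C1)" using C1[OF W(2,5)] by simp
    then have "vge (w j) (- s * real j + real n * \<delta> - C1 - C2)" by (rule C2[OF w0])
    moreover have "w j = 1" using W(4) by (simp add: w_def pmon_def)
    ultimately show ?thesis by (simp add: vge_one)
  qed
  then show False by (rule arch_contra[OF d(1)])
qed

text \<open>The argument for the upper bound is repeated for the reversed polynomial with slope - s,
  where the constant coefficient of \<open>L\<close> stands at the far end. Reversing back leaves a
  power of t in front of the reduced polynomial, and the lower growth bound removes it.\<close>

lemma growth_imp_const: "L 0 \<noteq> 0 \<and> real_of_int (fls_subdegree (L 0)) = - s * real H"
proof (rule ccontr)
  assume not: "\<not> ?thesis"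
  have LH: "L H = 1" and L0: "\<And>i. i > H \<Longrightarrow> L i = 0" using L_monic by (simp_all add: pmonic_def)
  have H0: "H \<noteq> 0" using LH not by (cases "H = 0") auto
  have gL: "gv s L (- s * real H)" by (rule growth_imp_upper)
  define R where "R = prev H L"
  have R_nth: "R i = (if i \<le> H then L (H - i) else 0)" for i by (simp add: R_def prev_def)
  have gR: "vge (R i) (- s * real i)" for i
  proof (cases "i \<le> H")
    case True
    have "vge (L (H - i)) (- s * real H + s * real (H - i))" using gL unfolding gv_def by blast
    moreover have "- s * real H + s * real (H - i) = - s * real i"
      using True by (simp add: of_nat_diff algebra_simps)
    ultimately have "vge (L (H - i)) (- s * real i)" by metis
    then show ?thesis using True by (simp add: R_nth)
  qed (simp add: R_nth)
  have R0: "R 0 = 1" using LH by (simp add: R_nth)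
  have finR: "slp_fin R" unfolding slp_fin_bound R_nth by (intro exI[of _ "Suc H"]) auto
  have "R \<noteq> 0" using R0 by auto
  then obtain c j \<delta>' where v: "\<delta>' > 0" "gv (- s) R c" "R j \<noteq> 0"
    "real_of_int (fls_subdegree (R j)) = c + (- s) * real j"
    "\<forall>i>j. vge (R i) (c + (- s) * real i + \<delta>')" using newton_vertex[OF finR, of "- s"] by blast
  \<comment> \<open>R has the point (0, 0) and, by \<open>growth_imp_upper\<close>, no point below
    the line of slope - s through it, so this is the supporting line.\<close>
  have "vge 1 c" using v(2) R0 unfolding gv_def by (metis mult_zero_right of_nat_0 add_0_right)
  then have "c \<le> 0" by (simp add: vge_one)
  moreover have "c \<ge> 0" using gR[of j] v(3,4) by (simp add: vge_iff)
  ultimately have c: "c = 0" by simp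
  define \<delta> where "\<delta> = min \<delta>' 1"
  have d: "0 < \<delta>" "\<delta> \<le> 1" using v(1) by (auto simp: \<delta>_def)
  have v5: "vge (R i) (c + (- s) * real i + \<delta>)" if "i > j" for i
    by (rule vge_mono[OF v(5)[rule_format, OF that]]) (simp add: \<delta>_def)
  have "j \<noteq> H"
  proof
    assume "j = H"
    then have "L 0 \<noteq> 0 \<and> real_of_int (fls_subdegree (L 0)) = - s * real H"
      using v(3,4) c by (simp add: R_nth)
    then show False using not by blast
  qed
  moreover have "j \<le> H" using v(3) by (auto simp: R_nth split: if_splits)
  ultimately have j: "j < H" by simp
  obtain C1 where C1: "\<And>f c. slp_fin f \<Longrightarrow> gv s f c \<Longrightarrow> vvge (Phi f) (c - C1)"
    using Phi_upper by blast
  obtain C2 where C2: "\<And>w c i. \<forall>n\<ge>H. w n = 0 \<Longrightarrow> vvge (Phi w) c \<Longrightarrow> vge (w i) (c - C2)"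
    using Phi_lower by blast
  \<comment> \<open>The constants of \<open>Phi_upper\<close>, of the growth bound and of
    \<open>Phi_lower\<close>; s (1 - H) is what remains when the s N from reversal is cancelled
    against the power t^(N - (H - 1)).\<close>
  have "(s * real j - C1 + s * (1 - real H) - C - C2) + real n * \<delta> \<le> 0" for n
  proof -
    obtain r e g where W: "pmon 1 j = r + e + g \<otimes>\<^sub>p R" "slp_fin e" "slp_fin g" "\<forall>i\<ge>j. r i = 0"
      "gv (- s) e (- (- s) * real j + real n * \<delta>)"
      using weierstrass_approx[OF v(2,3,4) v5 finR d] by blast
    obtain G where G: "\<And>i. i > G \<Longrightarrow> g i = 0" using W(3) slp_fin_bound by (metis less_imp_le)
    define N where "N = G + H"
    define u where "u = pmon 1 j - r"
    have u0: "u i = 0" if "i > H - 1" for i using that j W(4) by (auto simp: u_def pmon_def)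
    have "u = e + g \<otimes>\<^sub>p R" unfolding u_def W(1) by (simp only: add.assoc add_diff_cancel_left')
    then have "prev N u = prev N e + prev N (g \<otimes>\<^sub>p R)" by (simp only: prev_add)
    also have "prev N (g \<otimes>\<^sub>p R) = prev G g \<otimes>\<^sub>p L"
      unfolding R_def by (rule prev_mult[OF L0 G N_def])
    finally have eq: "prev N u = prev N e + prev G g \<otimes>\<^sub>p L" .
    have finp: "slp_fin (prev M f)" for M f
      unfolding slp_fin_bound prev_def by (intro exI[of _ "Suc M"]) auto
    have P1: "Phi (prev N u) = Phi (prev N e)" by (rule Phi_cong[OF finp finp finp eq])
    define w where "w = prev (H - 1) u"
    have w0: "\<forall>n\<ge>H. w n = 0" using H0 by (auto simp: w_def prev_def)
    have "H - 1 \<le> N" by (simp add: N_def)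
    then have "prev N u = pmon 1 (N - (H - 1)) \<otimes>\<^sub>p w" unfolding w_def using u0 by (intro prev_shift)
    then have P2: "Phi (prev N u) = vDn (N - (H - 1)) (Phi w)"
      using Phi_shift[of w] finp by (simp add: w_def)
    have "gv s (prev N e) (s * real j + real n * \<delta> - s * real N)"
      using prev_gv[OF W(5), of N] by simp
    then have "vvge (vDn (N - (H - 1)) (Phi w)) (s * real j + real n * \<delta> - s * real N - C1)"
      using C1[OF finp] P1 P2 by metis
    moreover have "s * real j + real n * \<delta> - s * real N - C1 =
      (s * real j + real n * \<delta> - C1 + s * (1 - real H)) - s * real (N - (H - 1))"
      using H0 by (simp add: N_def of_nat_diff algebra_simps)
    ultimately have "vvge (Phi w) (s * real j + real n * \<delta> - C1 + s * (1 - real H) - C)"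
      using grow_low[OF Phi_vs] finp w_def by metis
    then have "vge (w (H - 1 - j)) (s * real j + real n * \<delta> - C1 + s * (1 - real H) - C - C2)"
      by (rule C2[OF w0])
    moreover have "w (H - 1 - j) = 1" using W(4) j by (simp add: w_def prev_def u_def pmon_def)
    ultimately show ?thesis by (simp add: vge_one)
  qed
  then show False by (rule arch_contra[OF d(1)])
qed

end

section \<open>Newton polygons of monic polynomials\<close>

lemma halfplane_hull:
  assumes "\<And>x y. (x, y) \<in> P \<Longrightarrow> a * x + b \<le> y" "(x, y) \<in> convex hull P"
  shows "a * x + b \<le> (y::real)"
proof -
  have "convex hull P \<subseteq> {p. a * fst p + b \<le> snd p}"
  proof (rule hull_minimal)
    show "P \<subseteq> {p. a * fst p + b \<le> snd p}" using assms(1) by auto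
    have "{p. a * fst p + b \<le> snd p} = {p. inner (a, -1) p \<le> - (b::real)}"
      by (auto simp: inner_prod_def)
    then show "convex {p. a * fst p + b \<le> snd p}" by (simp add: convex_halfspace_le)
  qed
  then show ?thesis using assms(2) by auto
qed

context
  fixes f :: "'k::field slp" and l h :: nat and v :: "nat \<Rightarrow> real"
  assumes fin: "slp_fin f" and ne: "f \<noteq> 0"
  defines "l \<equiv> np_low f" and "h \<equiv> np_deg f" and "v \<equiv> \<lambda>i. real_of_int (fls_subdegree (f i))"
begin

lemma np_low_deg: "f l \<noteq> 0" "f h \<noteq> 0" "f i \<noteq> 0 \<Longrightarrow> l \<le> i \<and> i \<le> h"
proof -
  let ?A = "{n. f n \<noteq> 0}"
  have A: "finite ?A" "?A \<noteq> {}" using fin ne by (auto simp: slp_fin_def fun_eq_iff)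
  show "f l \<noteq> 0" using Min_in[OF A] by (simp add: l_def np_low_def)
  show "f h \<noteq> 0" using Max_in[OF A] by (simp add: h_def np_deg_def)
  show "f i \<noteq> 0 \<Longrightarrow> l \<le> i \<and> i \<le> h" using A by (simp add: l_def np_low_def h_def np_deg_def)
qed

lemma np_in_hull: "f i \<noteq> 0 \<Longrightarrow> (real i, v i) \<in> convex hull (np_points f)"
  by (rule hull_inc) (auto simp: np_points_def v_def)

lemma np_lower_ge:
  assumes "\<And>i. f i \<noteq> 0 \<Longrightarrow> a * real i + b \<le> v i" "(x, y) \<in> convex hull (np_points f)"
  shows "a * x + b \<le> y"
  by (rule halfplane_hull[OF _ assms(2)]) (use assms(1) in \<open>auto simp: np_points_def v_def\<close>)

lemma np_lower_eq:
  assumes "\<And>i. f i \<noteq> 0 \<Longrightarrow> a * real i + b \<le> v i" "(x, a * x + b) \<in> convex hull (np_points f)"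
  shows "np_lower f x = a * x + b"
  unfolding np_lower_def using assms np_lower_ge[OF assms(1)] by (intro cInf_eq_minimum) auto

lemma finite_slope: "\<exists>a. \<forall>i\<in>A. a \<le> (w i :: real)" if "finite A" for A :: "nat set" and w
  using that by (induction A rule: finite_induct) (auto, metis linorder_le_cases order_trans)

text \<open>A line through the leftmost point with sufficiently small slope lies below all points
  and touches the hull there.\<close>

lemma np_lower_low: "np_lower f (real l) = v l"
proof -
  have "finite {n. f n \<noteq> 0}" using fin by (simp add: slp_fin_def)
  then obtain a where a: "\<And>i. f i \<noteq> 0 \<Longrightarrow> a \<le> (v i - v l) / (real i - real l)"
    using finite_slope[of "{n. f n \<noteq> 0}" "\<lambda>i. (v i - v l) / (real i - real l)"] by auto
  have "np_lower f (real l) = a * real l + (v l - a * real l)"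
  proof (rule np_lower_eq)
    show "(real l, a * real l + (v l - a * real l)) \<in> convex hull (np_points f)"
      using np_in_hull[OF np_low_deg(1)] by simp
    fix i assume i: "f i \<noteq> 0"
    show "a * real i + (v l - a * real l) \<le> v i"
    proof (cases "i = l")
      case False
      then have "real i - real l > 0" using np_low_deg(3)[OF i] by simp
      then have "a * (real i - real l) \<le> v i - v l" using a[OF i] by (simp add: pos_le_divide_eq)
      then show ?thesis by (simp add: algebra_simps)
    qed simp
  qed
  then show ?thesis by simp
qed

lemma np_lower_bdd: "bdd_below {y. (x, y) \<in> convex hull (np_points f)}"
proof -
  have "finite {n. f n \<noteq> 0}" using fin by (simp add: slp_fin_def)
  then obtain a where a: "\<And>i. f i \<noteq> 0 \<Longrightarrow> a \<le> v i"
    using finite_slope[of "{n. f n \<noteq> 0}" v] by auto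
  show ?thesis
    by (rule bdd_belowI[of _ a]) (use np_lower_ge[of 0 a x] a in auto)
qed

lemma np_lower_deg: "np_lower f (real h) = v h"
proof -
  have "finite {n. f n \<noteq> 0}" using fin by (simp add: slp_fin_def)
  then obtain a where a: "\<And>i. f i \<noteq> 0 \<Longrightarrow> a \<le> (v i - v h) / (real h - real i)"
    using finite_slope[of "{n. f n \<noteq> 0}" "\<lambda>i. (v i - v h) / (real h - real i)"] by auto
  have "np_lower f (real h) = - a * real h + (v h + a * real h)"
  proof (rule np_lower_eq)
    show "(real h, - a * real h + (v h + a * real h)) \<in> convex hull (np_points f)"
      using np_in_hull[OF np_low_deg(2)] by simp
    fix i assume i: "f i \<noteq> 0"
    show "- a * real i + (v h + a * real h) \<le> v i"
    proof (cases "i = h")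
      case False
      then have "real h - real i > 0" using np_low_deg(3)[OF i] by simp
      then have "a * (real h - real i) \<le> v i - v h" using a[OF i] by (simp add: pos_le_divide_eq)
      then show ?thesis by (simp add: algebra_simps)
    qed simp
  qed
  then show ?thesis by simp
qed

lemma np_slope_eq: "np_slope f = (v h - v l) / (real h - real l)"
  unfolding np_slope_def h_def[symmetric] l_def[symmetric] np_lower_deg np_lower_low ..

text \<open>The chord between the end points lies in the hull, so the polygon is one edge exactly
  when all points are on or above this chord. After this the convex hull is no longer
  needed.\<close>

lemma np_one_edge_iff:
  "np_one_edge f \<longleftrightarrow> l < h \<and> (\<forall>i. f i \<noteq> 0 \<longrightarrow> v l + np_slope f * (real i - real l) \<le> v i)"
proof
  assume e: "np_one_edge f"
  then have lh: "l < h"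
    and eq: "\<And>x. real l \<le> x \<Longrightarrow> x \<le> real h \<Longrightarrow> np_lower f x = v l + np_slope f * (x - real l)"
    unfolding np_one_edge_def h_def[symmetric] l_def[symmetric] np_lower_low by auto
  have "v l + np_slope f * (real i - real l) \<le> v i" if i: "f i \<noteq> 0" for i
  proof -
    have "np_lower f (real i) \<le> v i"
      unfolding np_lower_def by (rule cInf_lower[OF _ np_lower_bdd]) (simp add: np_in_hull[OF i])
    then show ?thesis using eq[of "real i"] np_low_deg(3)[OF i] by simp
  qed
  then show "l < h \<and> (\<forall>i. f i \<noteq> 0 \<longrightarrow> v l + np_slope f * (real i - real l) \<le> v i)" using lh by blast
next
  assume A: "l < h \<and> (\<forall>i. f i \<noteq> 0 \<longrightarrow> v l + np_slope f * (real i - real l) \<le> v i)"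
  define s where "s = np_slope f"
  have s: "s * (real h - real l) = v h - v l" using A by (simp add: s_def np_slope_eq)
  have "np_lower f x = s * x + (v l - s * real l)" if x: "real l \<le> x" "x \<le> real h" for x
  proof (rule np_lower_eq)
    show "s * real i + (v l - s * real l) \<le> v i" if "f i \<noteq> 0" for i
      using A that by (simp add: s_def algebra_simps)
    define u where "u = (x - real l) / (real h - real l)"
    have u: "0 \<le> u" "u \<le> 1" using x A by (auto simp: u_def)
    have ux: "u * (real h - real l) = x - real l" using A by (simp add: u_def)
    have "(1 - u) *\<^sub>R (real l, v l) + u *\<^sub>R (real h, v h) \<in> convex hull (np_points f)"
      using u np_in_hull[OF np_low_deg(1)] np_in_hull[OF np_low_deg(2)]
      by (intro convexD[OF convex_convex_hull]) auto
    moreover have "(1 - u) *\<^sub>R (real l, v l) + u *\<^sub>R (real h, v h) = (x, s * x + (v l - s * real l))"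
    proof -
      have "(1 - u) * real l + u * real h = x" using ux by (simp add: algebra_simps)
      moreover have "(1 - u) * v l + u * v h = s * x + (v l - s * real l)"
      proof -
        have "(1 - u) * v l + u * v h = v l + u * (v h - v l)" by (simp add: algebra_simps)
        also have "\<dots> = v l + s * (u * (real h - real l))" by (simp flip: s)
        finally show ?thesis unfolding ux by (simp add: algebra_simps)
      qed
      ultimately show ?thesis by simp
    qed
    ultimately show "(x, s * x + (v l - s * real l)) \<in> convex hull (np_points f)" by simp
  qed
  then show "np_one_edge f"
    unfolding np_one_edge_def h_def[symmetric] l_def[symmetric] np_lower_low
    using A by (auto simp: s_def algebra_simps)
qed

end

context skew begin

text \<open>The end points of the polygon are (0, v(f_0)) and (h, 0). They determine the slope, and
  the condition on the remaining points becomes a Gauss bound.\<close>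

lemma monic_np:
  assumes f: "pmonic f h" "f 0 \<noteq> 0"
  shows "np_slope f = - real_of_int (fls_subdegree (f 0)) / real h"
    and "np_one_edge f \<longleftrightarrow> h > 0 \<and> gv (np_slope f) f (- np_slope f * real h)"
proof -
  have fin: "slp_fin f" unfolding slp_fin_bound using f(1) unfolding pmonic_def by (metis Suc_le_lessD)
  have ne: "f \<noteq> 0" using f(2) by auto
  have "np_low f \<le> 0" using np_low_deg(3)[OF fin ne f(2)] by simp
  then have l: "np_low f = 0" by simp
  have "f h \<noteq> 0" using f(1) by (simp add: pmonic_def)
  then have "h \<le> np_deg f" using np_low_deg(3)[OF fin ne] by blast
  moreover have "np_deg f \<le> h"
    using np_low_deg(2)[OF fin ne] f(1) unfolding pmonic_def by (meson not_le)
  ultimately have h: "np_deg f = h" by simp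
  have fh: "fls_subdegree (f h) = 0" using f(1) by (simp add: pmonic_def)
  show sl: "np_slope f = - real_of_int (fls_subdegree (f 0)) / real h"
    unfolding np_slope_eq[OF fin ne] l h fh by simp
  show "np_one_edge f \<longleftrightarrow> h > 0 \<and> gv (np_slope f) f (- np_slope f * real h)"
  proof (cases "h > 0")
    case True
    have v0: "real_of_int (fls_subdegree (f 0)) = - np_slope f * real h" using True by (simp add: sl)
    have "(\<forall>i. f i \<noteq> 0 \<longrightarrow> real_of_int (fls_subdegree (f 0)) + np_slope f * (real i - real 0) \<le> real_of_int (fls_subdegree (f i)))
       \<longleftrightarrow> gv (np_slope f) f (- np_slope f * real h)"
      unfolding gv_def v0 by (metis vge_iff vge_0 diff_zero of_nat_0)
    then show ?thesis unfolding np_one_edge_iff[OF fin ne] l h using True by simp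
  next
    case False
    then show ?thesis unfolding np_one_edge_iff[OF fin ne] l h by simp
  qed
qed

section \<open>Factors of polynomials with one slope\<close>

lemma slp_monic_pmonic: "slp_monic f \<longleftrightarrow> (\<exists>h. pmonic f h)"
  unfolding slp_monic_def pmonic_def slp_fin_bound by (metis Suc_le_lessD)

text \<open>Gauss's lemma: at the sum N of the last vertices, all products but one lie strictly
  above c + c' + s N, so the coefficient there has exactly this order.\<close>

lemma gauss_mult_coeff:
  assumes f: "\<delta> > 0" "gv s f c" "f j \<noteq> 0" "real_of_int (fls_subdegree (f j)) = c + s * real j"
      "\<forall>i>j. vge (f i) (c + s * real i + \<delta>)"
    and g: "\<delta>' > 0" "gv s g c'" "g j' \<noteq> 0" "real_of_int (fls_subdegree (g j')) = c' + s * real j'"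
      "\<forall>i>j'. vge (g i) (c' + s * real i + \<delta>')"
    and fg: "gv s (f \<otimes>\<^sub>p g) b"
  shows "b \<le> c + c'"
proof -
  define N where "N = j + j'"
  define e where "e = min \<delta> \<delta>'"
  have e: "e > 0" using f(1) g(1) by (simp add: e_def)
  have other: "vge (f i \<star> g (N - i)) (c + c' + s * real N + e)" if i: "i \<le> N" "i \<noteq> j" for i
  proof -
    have si: "s * real i + s * real (N - i) = s * real N" using i(1) by (simp add: of_nat_diff algebra_simps)
    have fi: "vge (f i) (c + s * real i)" and gi: "vge (g (N - i)) (c' + s * real (N - i))"
      using f(2) g(2) by (auto simp: gv_def)
    show ?thesis
    proof (cases "i > j")
      case True
      then have "vge (f i) (c + s * real i + \<delta>)" using f(5) by blast
      from vge_mult[OF this gi] show ?thesis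
        by (rule vge_mono) (use si in \<open>simp add: e_def\<close>)
    next
      case False
      then have "N - i > j'" using i by (simp add: N_def)
      then have "vge (g (N - i)) (c' + s * real (N - i) + \<delta>')" using g(5) by blast
      from vge_mult[OF fi this] show ?thesis
        by (rule vge_mono) (use si in \<open>simp add: e_def\<close>)
    qed
  qed
  have N: "N - j = j'" by (simp add: N_def)
  have j: "j \<in> {..N}" by (simp add: N_def)
  define R where "R = (\<Sum>i\<in>{..N} - {j}. f i \<star> g (N - i))"
  define b' where "b' = min (b + s * real N) (c + c' + s * real N + e)"
  have "(f \<otimes>\<^sub>p g) N = f j \<star> g j' + R"
    unfolding pmul_nth R_def by (subst sum.remove[OF _ j]) (simp_all add: N)
  then have eq: "f j \<star> g j' = (f \<otimes>\<^sub>p g) N - R" by simp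
  have "vge R (c + c' + s * real N + e)"
    unfolding R_def by (rule vge_sum) (use other in auto)
  then have 1: "vge R b'" by (rule vge_mono) (simp add: b'_def)
  have "vge ((f \<otimes>\<^sub>p g) N) (b + s * real N)" using fg unfolding gv_def by blast
  then have "vge ((f \<otimes>\<^sub>p g) N) b'" by (rule vge_mono) (simp add: b'_def)
  then have "vge (f j \<star> g j') b'" unfolding eq using 1 by (rule vge_diff)
  then have "b' \<le> real_of_int (fls_subdegree (f j \<star> g j'))"
    by (simp only: vge_iff[OF sl_subdegree_mult(1)[OF f(3) g(3)]])
  moreover have "real_of_int (fls_subdegree (f j \<star> g j')) = c + c' + s * real N"
    using sl_subdegree_mult(2)[OF f(3) g(3)] f(4) g(4) by (simp add: N_def algebra_simps)
  ultimately have "b' \<le> c + c' + s * real N" by simp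
  then show ?thesis using e by (simp add: b'_def min_def split: if_splits)
qed

lemma pmonic_mult_right:
  assumes "pmonic f h" "slp_fin x" "pmonic (f \<otimes>\<^sub>p x) n"
  shows "\<exists>k. pmonic x k \<and> n = h + k"
proof -
  have "x \<noteq> 0"
  proof
    assume "x = 0"
    then have "f \<otimes>\<^sub>p x = 0" by (simp only: pmul_zero)
    then show False using assms(3) by (simp add: pmonic_def)
  qed
  then have A: "finite {i. x i \<noteq> 0}" "{i. x i \<noteq> 0} \<noteq> {}"
    using assms(2) by (auto simp: slp_fin_def fun_eq_iff)
  define k where "k = Max {i. x i \<noteq> 0}"
  have k: "x k \<noteq> 0" using Max_in[OF A] by (simp add: k_def)
  have k': "x i = 0" if "i > k" for i using Max_ge[OF A(1), of i] that by (force simp: k_def)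
  have top: "(f \<otimes>\<^sub>p x) (h + k) = x k"
  proof -
    have "(f \<otimes>\<^sub>p x) (h + k) = (\<Sum>i\<le>h+k. if i = h then x k else 0)"
      unfolding pmul_nth
    proof (rule sum.cong)
      fix i assume "i \<in> {..h + k}"
      show "f i \<star> x (h + k - i) = (if i = h then x k else 0)"
        using assms(1) k' by (cases i h rule: linorder_cases) (auto simp: pmonic_def)
    qed simp
    then show ?thesis by simp
  qed
  have "n \<ge> h + k" using assms(3) top k unfolding pmonic_def by (metis not_le)
  moreover have "\<not> n > h + k"
  proof
    assume "n > h + k"
    then have nhk: "n > h + k" .
    have "(f \<otimes>\<^sub>p x) n = 0"
      unfolding pmul_nth
    proof (intro sum.neutral ballI)
      fix i show "f i \<star> x (n - i) = 0"
      proof (cases "i > h")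
        case True
        then show ?thesis using assms(1) by (simp add: pmonic_def)
      next
        case False
        then have "n - i > k" using nhk by linarith
        then show ?thesis using k' by simp
      qed
    qed
    then show False using assms(3) by (simp add: pmonic_def)
  qed
  ultimately have n: "n = h + k" by simp
  then have "x k = 1" using top assms(3) by (simp add: pmonic_def)
  then show ?thesis using k' n by (auto simp: pmonic_def)
qed

lemma straightI:
  assumes "pmonic f h" "gv s f (- s * real h)" "f 0 \<noteq> 0" "real_of_int (fls_subdegree (f 0)) = - s * real h"
  shows "straight s f h"
  unfolding straight_def
proof (intro conjI allI impI assms(1,2))
  fix x c assume A: "vge (x \<star> f 0) (c - s * real h)"
  show "vge x c"
  proof (cases "x = 0")
    case False
    have "c - s * real h \<le> real_of_int (fls_subdegree (x \<star> f 0))"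
      using A by (simp only: vge_iff[OF sl_subdegree_mult(1)[OF False assms(3)]])
    then show ?thesis using sl_subdegree_mult(2)[OF False assms(3)] assms(4)
      by (simp add: vge_iff[OF False])
  qed simp
qed

text \<open>The leading coefficients 1 bound the Gauss valuations of the factors from above by - s h
  and - s k, while their sum is at least - s n by \<open>gauss_mult_coeff\<close>; hence both bounds
  are attained. The orders of the constant coefficients are squeezed in the same way.\<close>

lemma straight_factor:
  assumes f: "pmonic f h" and x: "slp_fin x"
    and fx: "pmonic (f \<otimes>\<^sub>p x) n" "gv s (f \<otimes>\<^sub>p x) (- s * real n)" "(f \<otimes>\<^sub>p x) 0 \<noteq> 0"
      "real_of_int (fls_subdegree ((f \<otimes>\<^sub>p x) 0)) = - s * real n"
  shows "gv s f (- s * real h)" "f 0 \<noteq> 0" "real_of_int (fls_subdegree (f 0)) = - s * real h"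
proof -
  obtain k where k: "pmonic x k" "n = h + k" using pmonic_mult_right[OF f x fx(1)] by blast
  have one: "f h = 1" "x k = 1" using f k by (auto simp: pmonic_def)
  then have ne: "f \<noteq> 0" "x \<noteq> 0" by auto
  obtain c j \<delta> where F: "\<delta> > 0" "gv s f c" "f j \<noteq> 0" "real_of_int (fls_subdegree (f j)) = c + s * real j"
      "\<forall>i>j. vge (f i) (c + s * real i + \<delta>)"
    using newton_vertex[OF _ ne(1), of s] f unfolding slp_fin_bound pmonic_def by (metis Suc_le_lessD)
  obtain c' j' \<delta>' where X: "\<delta>' > 0" "gv s x c'" "x j' \<noteq> 0" "real_of_int (fls_subdegree (x j')) = c' + s * real j'"
      "\<forall>i>j'. vge (x i) (c' + s * real i + \<delta>')"
    using newton_vertex[OF x ne(2), of s] by blast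
  have le: "- s * real n \<le> c + c'" by (rule gauss_mult_coeff[OF F X fx(2)])
  have "vge (f h) (c + s * real h)" "vge (x k) (c' + s * real k)"
    using F(2) X(2) unfolding gv_def by blast+
  then have c: "c \<le> - s * real h" "c' \<le> - s * real k" unfolding one vge_one by auto
  then have ceq: "c = - s * real h" "c' = - s * real k" using le k(2) by (auto simp: algebra_simps)
  show "gv s f (- s * real h)" using F(2) ceq(1) by simp
  have m: "(f \<otimes>\<^sub>p x) 0 = f 0 \<star> x 0" by (simp add: pmul_nth)
  show f0: "f 0 \<noteq> 0" using fx(3) unfolding m by auto
  have x0: "x 0 \<noteq> 0" using fx(3) unfolding m by auto
  have "fls_subdegree ((f \<otimes>\<^sub>p x) 0) = fls_subdegree (f 0) + fls_subdegree (x 0)"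
    unfolding m by (rule sl_subdegree_mult(2)[OF f0 x0])
  moreover have "vge (f 0) (c + s * real 0)" "vge (x 0) (c' + s * real 0)"
    using F(2) X(2) unfolding gv_def by blast+
  then have "c \<le> real_of_int (fls_subdegree (f 0))" "c' \<le> real_of_int (fls_subdegree (x 0))"
    by (simp_all add: vge_iff[OF f0] vge_iff[OF x0])
  ultimately show "real_of_int (fls_subdegree (f 0)) = - s * real h"
    using fx(4) ceq k(2) by (simp add: algebra_simps)
qed

end

context tmod begin

lemma invariant_factors_iso:
  assumes "invariant_factors q d D lam" "d \<ge> 1"
  shows "\<exists>Q Q' h. tmod_last q K d D Q Q' lam h"
proof -
  from assms(1) obtain B where B: "elem_equiv q d CM B"
      "(\<forall>i<d. \<forall>j<d. i \<noteq> j \<longrightarrow> B i j = (\<lambda>_. 0)) \<and> (\<forall>i<d. B i i = lam i)"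
    unfolding invariant_factors_def by (elim conjE exE) (rule that, assumption, rule conjI, assumption+)
  have mon: "\<forall>i<d. slp_monic (lam i)"
    using assms(1) unfolding invariant_factors_def by (elim conjE)
  then have "\<forall>i. \<exists>h. i < d \<longrightarrow> pmonic (lam i) h"
    unfolding slp_monic_pmonic by blast
  then obtain h where h: "\<And>i. i < d \<Longrightarrow> pmonic (lam i) (h i)" by metis
  obtain Q Q' where Q: "rlin Q" "rlin Q'" "\<forall>x. Q' (Q x) = x" "\<forall>x. Q (Q' x) = x"
     "\<forall>x\<in>rspan CM. Q x \<in> rspan B" "\<forall>x\<in>rspan B. Q' x \<in> rspan CM"
    using elem_equiv_row_iso[OF B(1)] unfolding row_iso_def by blast
  \<comment> \<open>The rows of \<open>B\<close> are recognized as polynomial rows by carrying them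
    into the span of t - D with \<open>Q'\<close> and back with \<open>Q\<close>.\<close>
  have "B i \<in> rowsp" if "i < d" for i
  proof -
    have "Q' (B i) \<in> rowsp" using Q(6) rspan_row[OF that, of B] rspan_CM_rowsp by blast
    then have "Q (Q' (B i)) \<in> rowsp" by (rule rlin_rowsp[OF Q(1)])
    then show ?thesis using Q(4) by metis
  qed
  then have dg: "rspan B = diagset lam"
    by (rule diagset_rspan) (use B(2) in \<open>simp_all add: zero_fun_def\<close>)
  have "tmod_last q K d D Q Q' lam h"
  proof unfold_locales
    show "rlin Q" "rlin Q'" "1 \<le> d" by fact+
    show "Q' (Q x) = x" "Q (Q' x) = x" for x using Q(3,4) by blast+
    show "x \<in> rspan CM \<Longrightarrow> Q x \<in> diagset lam" for x using Q(5) unfolding dg by blast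
    show "x \<in> diagset lam \<Longrightarrow> Q' x \<in> rspan CM" for x using Q(6) unfolding dg by blast
    show "i < d \<Longrightarrow> pmonic (lam i) (h i)" for i by (rule h)
  qed
  then show ?thesis by blast
qed

end

context tmod_last begin

text \<open>Induction downwards from the last index: each \<open>lam i\<close> is a left factor of
  the next, and \<open>straight_factor\<close> hands the slope on.\<close>

lemma all_straight:
  assumes dv: "\<And>i. i + 1 < d \<Longrightarrow> \<exists>x. slp_fin x \<and> lam (i + 1) = lam i \<otimes>\<^sub>p x"
    and top: "gv s L (- s * real H)" "L 0 \<noteq> 0" "real_of_int (fls_subdegree (L 0)) = - s * real H"
    and i: "i < d"
  shows "straight s (lam i) (h i)"
proof -
  have "gv s (lam i) (- s * real (h i)) \<and> lam i 0 \<noteq> 0 \<and>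
     real_of_int (fls_subdegree (lam i 0)) = - s * real (h i)"
    using i
  proof (induction "d - 1 - i" arbitrary: i)
    case 0
    then have "i = ld" by (simp add: ld_def)
    then show ?case using top by simp
  next
    case (Suc n)
    then have i: "i + 1 < d" by simp
    then obtain x where x: "slp_fin x" "lam (i + 1) = lam i \<otimes>\<^sub>p x" using dv by blast
    have IH: "gv s (lam (i + 1)) (- s * real (h (i + 1)))" "lam (i + 1) 0 \<noteq> 0"
     "real_of_int (fls_subdegree (lam (i + 1) 0)) = - s * real (h (i + 1))"
      using Suc.hyps(1)[of "i + 1"] Suc.hyps(2) i by auto
    show ?case
      using straight_factor[OF lam_monic[OF Suc.prems] x(1), folded x(2), OF lam_monic[OF i] IH] by blast
  qed
  then show ?thesis using lam_monic[OF i] by (intro straightI) auto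
qed

text \<open>If the last factor had degree 0, all of them would be 1 and the cokernel V would vanish,
  although d is positive.\<close>

lemma H_pos:
  assumes dv: "\<And>i. i + 1 < d \<Longrightarrow> \<exists>x. slp_fin x \<and> lam (i + 1) = lam i \<otimes>\<^sub>p x"
  shows "H > 0"
proof (rule ccontr)
  assume "\<not> H > 0"
  then have H0: "H = 0" by simp
  have h0: "h i = 0" if "i < d" for i
    using that
  proof (induction "d - 1 - i" arbitrary: i)
    case 0
    then have "i = ld" by (simp add: ld_def)
    then show ?case using H0 by simp
  next
    case (Suc n)
    then have i: "i + 1 < d" by simp
    then obtain x where x: "slp_fin x" "lam (i + 1) = lam i \<otimes>\<^sub>p x" using dv by blast
    have "h (i + 1) = 0" using Suc.hyps(1)[of "i + 1"] Suc.hyps(2) i by auto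
    then show ?case
      using pmonic_mult_right[OF lam_monic[OF Suc.prems] x(1), folded x(2), OF lam_monic[OF i]] by simp
  qed
  have lam1: "lam i = slp_one" if "i < d" for i
    using lam_monic[OF that] h0[OF that] unfolding pmonic_def slp_one_def by (auto simp: fun_eq_iff)
  define x :: "nat \<Rightarrow> 'k fls" where "x k = (if k = 0 then 1 else 0)" for k
  have xv: "x \<in> vs" using d_pos by (auto simp: vs_def x_def)
  have "Q (emb x) \<in> diagset lam"
  proof (rule diagsetI)
    show "Q (emb x) \<in> rowsp" by (rule rlin_rowsp[OF Q emb_rowsp[OF xv]])
    then show "\<exists>g. slp_fin g \<and> Q (emb x) i = g \<otimes>\<^sub>p lam i" if "i < d" for i
      unfolding lam1[OF that] pmul_one by (auto simp: rowsp_def)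
  qed
  then have "emb x \<in> rspan CM" using Q'_diag Q'Q by metis
  then have "x = 0" by (rule emb_rspan_zero)
  then have "x 0 = 0" by simp
  then show False by (simp add: x_def)
qed

end

section \<open>The motive as a subspace of row vectors\<close>

context skew begin

lemma skp_fin_bound: "skp_fin (a::'k skp) \<longleftrightarrow> (\<exists>N. \<forall>n\<ge>N. a n = 0)"
proof
  assume "skp_fin a"
  then obtain N where "\<forall>x\<in>{n. a n \<noteq> 0}. x < N"
    unfolding skp_fin_def using finite_nat_set_iff_bounded by blast
  then show "\<exists>N. \<forall>n\<ge>N. a n = 0" by (metis mem_Collect_eq linorder_not_less)
next
  assume "\<exists>N. \<forall>n\<ge>N. a n = 0"
  then obtain N where "\<forall>n\<ge>N. a n = 0" by blast
  then have "{n. a n \<noteq> 0} \<subseteq> {..<N}" by (auto simp: not_le[symmetric])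
  then show "skp_fin a" unfolding skp_fin_def using finite_subset by blast
qed

lemma skp_mult_fin: assumes "skp_fin (a::'k skp)" "skp_fin b" shows "skp_fin (skp_mult q a b)"
proof -
  obtain N M where N: "\<And>n. n \<ge> N \<Longrightarrow> a n = 0" and M: "\<And>n. n \<ge> M \<Longrightarrow> b n = 0"
    using assms skp_fin_bound by metis
  have "skp_mult q a b n = 0" if "n \<ge> N + M" for n
    unfolding skp_mult_def
  proof (intro sum.neutral ballI)
    fix i show "a i * b (n - i) ^ q ^ i = 0"
      by (cases "i \<ge> N") (use N M that in auto)
  qed
  then show ?thesis using skp_fin_bound by blast
qed

lemma tts_nth: assumes "skp_fin (a::'k skp)"
  shows "tau_to_sigma a $$ k = (if k \<le> 0 then a (nat (- k)) else 0)"
proof -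
  obtain N where N: "\<And>n. n \<ge> N \<Longrightarrow> a n = 0" using assms skp_fin_bound by metis
  show ?thesis unfolding tau_to_sigma_def
    by (rule nth_Abs_fls_lower_bound[where N="- int N"]) (use N in auto)
qed

text \<open>Replacing the exponent i by - i turns the twist of tau^i into that of sigma^(-i);
  outside the common finite range the summands vanish.\<close>

lemma tts_mult: assumes a: "skp_fin (a::'k skp)" and b: "skp_fin b"
  shows "tau_to_sigma (skp_mult q a b) = tau_to_sigma a \<star> tau_to_sigma b"
proof (rule fls_eqI)
  fix n
  obtain N M where N: "\<And>n. n \<ge> N \<Longrightarrow> a n = 0" and M: "\<And>n. n \<ge> M \<Longrightarrow> b n = 0"
    using assms skp_fin_bound by metis
  have A: "tau_to_sigma a $$ k = 0" if "k < - int N" for k using that N by (auto simp: tts_nth[OF a])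
  have B: "tau_to_sigma b $$ k = 0" if "k < - int M" for k using that M by (auto simp: tts_nth[OF b])
  define F where "F i = tau_to_sigma a $$ i * phi_int (- i) (tau_to_sigma b $$ (n - i))" for i
  have 1: "(tau_to_sigma a \<star> tau_to_sigma b) $$ n = (\<Sum>i\<in>{- int N..n - - int M}. F i)"
    unfolding F_def by (rule sl_nth[OF A B])
  have F0: "F i = 0" if "i > 0 \<or> i < n" for i using that by (auto simp: F_def tts_nth[OF a] tts_nth[OF b])
  have F1: "F i = 0" if "i < - int N \<or> n - i < - int M" for i
    using that A B by (auto simp: F_def)
  have "(\<Sum>i\<in>{- int N..n - - int M}. F i) = (\<Sum>i\<in>{n..0}. F i)"
  proof -
    have "(\<Sum>i\<in>{- int N..n - - int M}. F i) = (\<Sum>i\<in>{n..0} \<inter> {- int N..n - - int M}. F i)"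
      by (rule sum.mono_neutral_right) (use F0 in auto)
    also have "\<dots> = (\<Sum>i\<in>{n..0}. F i)"
      by (rule sum.mono_neutral_left) (use F1 in auto)
    finally show ?thesis .
  qed
  also have "\<dots> = tau_to_sigma (skp_mult q a b) $$ n"
  proof (cases "n \<le> 0")
    case True
    have e: "nat (- n) - nat (- a) = nat (a - n)" if "n \<le> a" "a \<le> 0" for a using that by simp
    have "(\<Sum>i\<in>{n..0}. F i) = (\<Sum>i\<le>nat (- n). a i * b (nat (- n) - i) ^ q ^ i)"
      by (rule sum.reindex_bij_witness[of _ "\<lambda>i. - int i" "\<lambda>i. nat (- i)"])
        (use True in \<open>auto simp: F_def tts_nth[OF a] tts_nth[OF b] phi_nat[symmetric] e\<close>)
    then show ?thesis unfolding tts_nth[OF skp_mult_fin[OF a b]] using True by (simp add: skp_mult_def)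
  next
    case False
    then show ?thesis by (simp add: tts_nth[OF skp_mult_fin[OF a b]])
  qed
  finally show "tau_to_sigma (skp_mult q a b) $$ n = (tau_to_sigma a \<star> tau_to_sigma b) $$ n"
    using 1 by simp
qed

end

context tmod begin

abbreviation Mot :: "'k skvec set" where "Mot \<equiv> motive d"
abbreviation tact :: "'k skvec \<Rightarrow> 'k skvec" where "tact m \<equiv> vecmat q d m D"
abbreviation tp :: "'k skvec \<Rightarrow> nat \<Rightarrow> 'k skvec" where "tp m n \<equiv> tpow q d D m n"

definition ks :: "'k \<Rightarrow> 'k skvec \<Rightarrow> 'k skvec" where "ks c m = (\<lambda>j n. c * m j n)"

lemma ks_nth: "ks c m j n = c * m j n" by (simp add: ks_def)

sublocale kv: vector_space ks
  by unfold_locales (auto simp: ks_def fun_eq_iff algebra_simps)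

text \<open>One degree bound serves all columns, as there are only d of them.\<close>

lemma motive_alt: "m \<in> Mot \<longleftrightarrow> (\<forall>j n. d \<le> j \<longrightarrow> m j n = 0) \<and> (\<exists>N. \<forall>j. \<forall>n\<ge>N. m j n = 0)"
proof
  assume m: "m \<in> Mot"
  then have "\<forall>j. \<exists>N. j < d \<longrightarrow> (\<forall>n\<ge>N. m j n = 0)" unfolding motive_def using skp_fin_bound by blast
  then obtain N where N: "\<And>j n. j < d \<Longrightarrow> n \<ge> N j \<Longrightarrow> m j n = 0" by metis
  have 0: "m j n = 0" if "d \<le> j" for j n using m that by (simp add: motive_def)
  have "m j n = 0" if "n \<ge> (\<Sum>j<d. N j)" for j n
  proof (cases "j < d")
    case True
    then have "N j \<le> (\<Sum>j<d. N j)" by (intro member_le_sum) auto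
    then show ?thesis using N[OF True] that by force
  qed (simp add: 0)
  then show "(\<forall>j n. d \<le> j \<longrightarrow> m j n = 0) \<and> (\<exists>N. \<forall>j. \<forall>n\<ge>N. m j n = 0)" using 0 by blast
next
  assume "(\<forall>j n. d \<le> j \<longrightarrow> m j n = 0) \<and> (\<exists>N. \<forall>j. \<forall>n\<ge>N. m j n = 0)"
  then have 0: "\<forall>j n. d \<le> j \<longrightarrow> m j n = 0" and f: "\<exists>N. \<forall>n\<ge>N. m j n = 0" for j by blast+
  have "skp_fin (m j)" for j using f[of j] unfolding skp_fin_bound .
  then show "m \<in> Mot" unfolding motive_def using 0 by auto
qed

lemma motive_bound: "m \<in> Mot \<Longrightarrow> \<exists>N. \<forall>j n. n \<ge> N \<longrightarrow> m j n = 0"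
  unfolding motive_alt by blast

lemma motive_fin: "m \<in> Mot \<Longrightarrow> skp_fin (m j)"
  unfolding motive_alt skp_fin_bound by blast

text \<open>Degree in tau at most c, with c real because bounds such as s n + C occur.\<close>

definition Gf :: "real \<Rightarrow> 'k skvec set" where
  "Gf c = {m \<in> Mot. \<forall>j n. real n > c \<longrightarrow> m j n = 0}"

lemma Gf_Mot: "m \<in> Gf c \<Longrightarrow> m \<in> Mot" by (simp add: Gf_def)
lemma Gf_mono: "m \<in> Gf c \<Longrightarrow> c \<le> c' \<Longrightarrow> m \<in> Gf c'" by (auto simp: Gf_def)

lemma kv_subspace_Mot: "kv.subspace Mot"
proof (rule kv.subspaceI)
  show "0 \<in> Mot" by (auto simp: motive_alt)
  show "x + y \<in> Mot" if xy: "x \<in> Mot" "y \<in> Mot" for x y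
  proof -
    obtain N where N: "\<forall>j n. n \<ge> N \<longrightarrow> x j n = 0" using motive_bound[OF xy(1)] ..
    obtain M where M: "\<forall>j n. n \<ge> M \<longrightarrow> y j n = 0" using motive_bound[OF xy(2)] ..
    have "\<forall>j. \<forall>n\<ge>max N M. (x + y) j n = 0" using N M by simp
    moreover have "\<forall>j n. d \<le> j \<longrightarrow> (x + y) j n = 0" using xy unfolding motive_alt by simp
    ultimately show ?thesis unfolding motive_alt by blast
  qed
  show "ks a x \<in> Mot" if "x \<in> Mot" for a x
    using that unfolding motive_alt by (auto simp: ks_def)
qed

lemma kv_subspace_Gf: "kv.subspace (Gf c)"
proof (rule kv.subspaceI)
  show "0 \<in> Gf c" using kv.subspace_0[OF kv_subspace_Mot] by (simp add: Gf_def)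
  show "x + y \<in> Gf c" if "x \<in> Gf c" "y \<in> Gf c" for x y
    using that kv.subspace_add[OF kv_subspace_Mot, of x y] by (simp add: Gf_def)
  show "ks a x \<in> Gf c" if "x \<in> Gf c" for a x
    using that kv.subspace_scale[OF kv_subspace_Mot, of x a] by (simp add: Gf_def ks_nth)
qed

lemmas Mot_add = kv.subspace_add[OF kv_subspace_Mot]
  and Mot_ks = kv.subspace_scale[OF kv_subspace_Mot]
  and Mot_sum = kv.subspace_sum[OF kv_subspace_Mot]
lemmas Gf_add = kv.subspace_add[OF kv_subspace_Gf]
  and Gf_zero = kv.subspace_0[OF kv_subspace_Gf]
  and Gf_ks = kv.subspace_scale[OF kv_subspace_Gf]
  and Gf_diff = kv.subspace_diff[OF kv_subspace_Gf]
  and Gf_sum = kv.subspace_sum[OF kv_subspace_Gf]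

lemma Mot_Gf: assumes "m \<in> Mot" shows "\<exists>N::nat. m \<in> Gf (real N)"
proof -
  obtain N where "\<forall>j. \<forall>n\<ge>N. m j n = 0" using assms by (auto simp: motive_alt)
  then show ?thesis using assms by (intro exI[of _ N]) (auto simp: Gf_def)
qed

lemma Gf_neg: "m \<in> Gf c \<Longrightarrow> c < 0 \<Longrightarrow> m = 0"
  by (auto simp: Gf_def fun_eq_iff)

text \<open>The inclusion of M in V.\<close>

definition iota :: "'k skvec \<Rightarrow> nat \<Rightarrow> 'k fls" where "iota m = (\<lambda>k. tau_to_sigma (m k))"

lemma iota_nth: "m \<in> Mot \<Longrightarrow> iota m k $$ n = (if n \<le> 0 then m k (nat (- n)) else 0)"
  by (simp add: iota_def tts_nth motive_fin)

lemma iota_vs: assumes "m \<in> Mot" shows "iota m \<in> vs"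
proof -
  have "m k n = 0" if "k \<ge> d" for k n using assms that by (simp add: motive_alt)
  then have "iota m k = 0" if "k \<ge> d" for k
    by (intro fls_eqI) (simp add: iota_nth[OF assms] that)
  then show ?thesis by (simp add: vs_def)
qed

lemma iota_inj: assumes "m \<in> Mot" "m' \<in> Mot" "iota m = iota m'" shows "m = m'"
proof (intro ext)
  fix k n
  have "iota m k $$ (- int n) = iota m' k $$ (- int n)" using assms(3) by simp
  then show "m k n = m' k n" using assms(1,2) by (simp add: iota_nth)
qed

text \<open>Since tau is sigma^(-1), the degree is minus the order.\<close>

lemma Gf_iff: assumes "m \<in> Mot" shows "m \<in> Gf c \<longleftrightarrow> vvge (iota m) (- c)"
proof
  assume m: "m \<in> Gf c"
  show "vvge (iota m) (- c)" unfolding vvge_def vge_def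
    using m by (auto simp: iota_nth[OF assms] Gf_def)
next
  assume v: "vvge (iota m) (- c)"
  have "m j n = 0" if "real n > c" for j n
  proof -
    have "iota m j $$ (- int n) = 0" using v that unfolding vvge_def vge_def by simp
    then show ?thesis by (simp add: iota_nth[OF assms])
  qed
  then show "m \<in> Gf c" using assms by (simp add: Gf_def)
qed

lemma tact_Mot: assumes "m \<in> Mot" shows "tact m \<in> Mot"
proof -
  have "skp_fin (tact m j)" if "j < d" for j
  proof -
    have "\<forall>i. \<exists>N. i < d \<longrightarrow> (\<forall>n\<ge>N. skp_mult q (m i) (D i j) n = 0)"
      using skp_mult_fin[OF motive_fin[OF assms] D_fin[OF _ that]] skp_fin_bound by blast
    then obtain N where N: "\<And>i n. i < d \<Longrightarrow> n \<ge> N i \<Longrightarrow> skp_mult q (m i) (D i j) n = 0" by metis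
    have "tact m j n = 0" if n: "n \<ge> (\<Sum>i<d. N i)" for n
    proof -
      have "N i \<le> n" if "i < d" for i
      proof -
        have "N i \<le> (\<Sum>i<d. N i)" using that by (intro member_le_sum) auto
        then show ?thesis using n by simp
      qed
      then show ?thesis using N by (simp add: vecmat_def)
    qed
    then show ?thesis using skp_fin_bound by blast
  qed
  then show ?thesis by (auto simp: motive_def vecmat_def)
qed

lemma iota_tact: assumes "m \<in> Mot" shows "iota (tact m) = vD (iota m)"
proof (intro ext fls_eqI)
  fix j n
  show "iota (tact m) j $$ n = vD (iota m) j $$ n"
  proof (cases "j < d")
    case True
    have "vD (iota m) j $$ n = (\<Sum>i<d. (tau_to_sigma (m i) \<star> DS i j) $$ n)"
      using True by (simp add: vD_def iota_def fls_nth_sum)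
    also have "\<dots> = (\<Sum>i<d. tau_to_sigma (skp_mult q (m i) (D i j)) $$ n)"
      by (rule sum.cong) (use True motive_fin[OF assms] D_fin in \<open>auto simp: tts_mult\<close>)
    also have "\<dots> = (\<Sum>i<d. if n \<le> 0 then skp_mult q (m i) (D i j) (nat (- n)) else 0)"
      by (rule sum.cong) (use True motive_fin[OF assms] D_fin in \<open>auto simp: tts_nth skp_mult_fin\<close>)
    also have "\<dots> = iota (tact m) j $$ n"
      unfolding iota_nth[OF tact_Mot[OF assms]] using True by (simp add: vecmat_def)
    finally show ?thesis by simp
  next
    case False
    then show ?thesis unfolding iota_nth[OF tact_Mot[OF assms]] by (simp add: vecmat_def vD_def)
  qed
qed

lemma tp_Mot: "m \<in> Mot \<Longrightarrow> tp m n \<in> Mot"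
  by (induction n) (auto simp: tact_Mot)

lemma iota_tp: "m \<in> Mot \<Longrightarrow> iota (tp m n) = vDn n (iota m)"
  by (induction n) (auto simp: iota_tact tp_Mot vDn_Suc)

lemma skp_mult_add_left: "skp_mult q (a + b) c n = skp_mult q a c n + skp_mult q b (c :: 'k skp) n"
  by (simp add: skp_mult_def algebra_simps sum.distrib)

lemma tact_add: "tact (m + m') = tact m + tact m'"
  by (intro ext) (simp add: vecmat_def skp_mult_add_left sum.distrib)

lemma tact_ks: "tact (ks c m) = ks c (tact m)"
  by (intro ext) (simp add: vecmat_def ks_def skp_mult_def sum_distrib_left mult.assoc)

lemma tact_zero: "tact 0 = 0" using tact_ks[of 0 0] by (simp add: kv.scale_zero_left)

lemma tact_sum: "tact (sum f A) = (\<Sum>i\<in>A. tact (f i))"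
  using sum_comp_morphism[of tact f A] by (simp add: o_def tact_add tact_zero)

lemma tp_tp: "tp (tp m n) k = tp m (n + k)"
  by (induction k) auto

lemma tp_add: "tp (m + m') n = tp m n + tp m' n"
  by (induction n) (simp_all only: tpow.simps tact_add)

lemma tp_ks: "tp (ks c m) n = ks c (tp m n)"
  by (induction n) (simp_all only: tpow.simps tact_ks)

lemma tp_zero: "tp 0 n = 0"
  by (induction n) (simp_all only: tpow.simps tact_zero)

lemma tp_sum: "tp (sum f A) n = (\<Sum>i\<in>A. tp (f i) n)"
  using sum_comp_morphism[of "\<lambda>m. tp m n" f A] by (simp add: o_def tp_add tp_zero)

lemma tau_act_nth: "tau_act q m j n = (if n = 0 then 0 else (m j (n - 1) :: 'k) ^ q)"
proof -
  have "tau_act q m j n = (\<Sum>i\<le>n. if i = 1 then m j (n - 1) ^ q else 0)"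
    unfolding tau_act_def skp_mult_def skp_tau_def by (intro sum.cong) auto
  then show ?thesis by auto
qed

lemma tau_Mot: "m \<in> Mot \<Longrightarrow> tau_act q m \<in> Mot"
proof -
  assume m: "m \<in> Mot"
  obtain N where N: "\<forall>j n. n \<ge> N \<longrightarrow> m j n = 0" using motive_bound[OF m] ..
  have "\<forall>j. \<forall>n\<ge>Suc N. tau_act q m j n = 0" using N by (auto simp: tau_act_nth power_0_left)
  moreover have "\<forall>j n. d \<le> j \<longrightarrow> tau_act q m j n = 0"
    using m unfolding motive_alt by (auto simp: tau_act_nth power_0_left)
  ultimately show ?thesis unfolding motive_alt by blast
qed

lemma iota_tau: "m \<in> Mot \<Longrightarrow> iota (tau_act q m) = ssm (smon 1 (-1)) (iota m)"
  by (intro ext fls_eqI)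
    (auto simp: iota_nth tau_Mot tau_act_nth ssm_def smon_mult_nth phi_Suc[of 0, simplified] power_0_left nat_diff_distrib')

text \<open>In V, tau is left multiplication by sigma^(-1) and t is right multiplication by D, so
  they commute.\<close>

lemma tau_tact: assumes "m \<in> Mot" shows "tau_act q (tact m) = tact (tau_act q m)"
proof (rule iota_inj)
  show "iota (tau_act q (tact m)) = iota (tact (tau_act q m))"
    by (simp add: iota_tau iota_tact tact_Mot tau_Mot assms vD_ssm)
qed (simp_all add: tau_Mot tact_Mot assms)

section \<open>Growth on V and on the motive\<close>

definition growthV :: "real \<Rightarrow> real \<Rightarrow> bool" where
  "growthV s C \<longleftrightarrow> (\<forall>n. \<forall>x\<in>vs. \<forall>c. (vvge x c \<longrightarrow> vvge (vDn n x) (c - s * real n - C)) \<and>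
     (vvge (vDn n x) (c - s * real n) \<longrightarrow> vvge x (c - C)))"

text \<open>The degree changes by s n up to C in both directions; the point is that C does not
  depend on n.\<close>

definition growthM :: "real \<Rightarrow> real \<Rightarrow> bool" where
  "growthM s C \<longleftrightarrow> (\<forall>n. \<forall>m\<in>Mot. \<forall>c. (m \<in> Gf c \<longrightarrow> tp m n \<in> Gf (c + s * real n + C)) \<and>
     (tp m n \<in> Gf (c + s * real n) \<longrightarrow> m \<in> Gf (c + C)))"

lemma growthV_M: assumes "growthV s C" shows "growthM s C"
  unfolding growthM_def
proof (intro allI ballI conjI impI)
  fix n m and c :: real assume m: "m \<in> Mot"
  have V: "(vvge (iota m) (- c) \<longrightarrow> vvge (vDn n (iota m)) (- c - s * real n - C)) \<and>
     (vvge (vDn n (iota m)) (- c - s * real n) \<longrightarrow> vvge (iota m) (- c - C))"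
    using assms iota_vs[OF m] unfolding growthV_def by blast
  show "tp m n \<in> Gf (c + s * real n + C)" if "m \<in> Gf c"
    using V that by (simp add: Gf_iff tp_Mot m iota_tp)
  show "m \<in> Gf (c + C)" if "tp m n \<in> Gf (c + s * real n)"
    using V that by (simp add: Gf_iff tp_Mot m iota_tp)
qed

text \<open>The part of tau^N x with nonnegative powers of tau; moving tau^N past the coefficients
  raises them to the power q^N.\<close>

definition ktrunc :: "nat \<Rightarrow> (nat \<Rightarrow> 'k fls) \<Rightarrow> 'k skvec" where
  "ktrunc N x = (\<lambda>k n. phi_int (int N) (x k $$ (int N - int n)))"

abbreviation tauS :: "nat \<Rightarrow> (nat \<Rightarrow> 'k fls) \<Rightarrow> nat \<Rightarrow> 'k fls" where
  "tauS N x \<equiv> ssm (smon 1 (- int N)) x"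

lemma tauS_nth: "tauS N x k $$ n = phi_int (int N) (x k $$ (n + int N))"
  by (simp add: ssm_def smon_mult_nth)

lemma tauS_vvge: "vvge (tauS N x) c \<longleftrightarrow> vvge x (c + real N)"
proof
  assume A: "vvge (tauS N x) c"
  show "vvge x (c + real N)" unfolding vvge_def vge_def
  proof (intro allI impI)
    fix k n assume n: "real_of_int n < c + real N"
    have "tauS N x k $$ (n - int N) = 0" using A n unfolding vvge_def vge_def by simp
    then show "x k $$ n = 0" by (simp add: tauS_nth)
  qed
next
  assume A: "vvge x (c + real N)"
  then show "vvge (tauS N x) c" unfolding vvge_def vge_def by (simp add: tauS_nth)
qed

lemma ktrunc_Mot: assumes "x \<in> vs" shows "ktrunc N x \<in> Mot"
  unfolding motive_alt
proof (intro conjI allI impI)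
  show "ktrunc N x j n = 0" if "d \<le> j" for j n using assms that by (simp add: ktrunc_def vs_def)
  obtain c where c: "vvge x c" using vvge_ex[OF assms] by blast
  have "ktrunc N x j n = 0" if "n \<ge> nat \<lceil>real N - c + 1\<rceil>" for j n
  proof -
    have "real_of_int (int N - int n) < c" using that by linarith
    then show ?thesis using c unfolding vvge_def vge_def ktrunc_def by simp
  qed
  then show "\<exists>M. \<forall>j. \<forall>n\<ge>M. ktrunc N x j n = 0" by blast
qed

lemma ktrunc_approx: assumes "x \<in> vs" shows "vvge (tauS N x - iota (ktrunc N x)) 1"
  unfolding vvge_def vge_def minus_apply minus_fls.rep_eq tauS_nth iota_nth[OF ktrunc_Mot[OF assms]]
  by (auto simp: ktrunc_def algebra_simps)

text \<open>Multiplication by tau^N commutes with D and shifts orders exactly, and tau^N x differs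
  from an element of M by an error of order at least 1. This error may grow under D^n, but N is
  chosen after n and c, so it stays beyond the bound to be proved.\<close>

lemma growthM_V: assumes g: "growthM s C" shows "growthV s C"
  unfolding growthV_def
proof (intro allI ballI)
  fix n x c assume x: "x \<in> vs"
  obtain e where e: "\<And>n x c. vvge x c \<Longrightarrow> vvge (vDn n x) (c - real n * e)" using vDn_vvge by blast
  define N where "N = nat \<lceil>\<bar>c\<bar> + \<bar>C\<bar> + \<bar>s * real n\<bar> + \<bar>real n * e\<bar>\<rceil>"
  have N: "real N \<ge> \<bar>c\<bar> + \<bar>C\<bar> + \<bar>s * real n\<bar> + \<bar>real n * e\<bar>" unfolding N_def by linarith
  define m where "m = ktrunc N x"
  define z where "z = tauS N x - iota m"
  have m: "m \<in> Mot" unfolding m_def by (rule ktrunc_Mot[OF x])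
  have z: "vvge z 1" unfolding z_def m_def by (rule ktrunc_approx[OF x])
  have z': "vvge (vDn n z) (1 - real n * e)" by (rule e[OF z])
  have xz: "tauS N x = iota m + z" by (simp add: z_def)
  have Dxz: "tauS N (vDn n x) = iota (tp m n) + vDn n z"
    unfolding vDn_ssm[symmetric] xz vDn_add iota_tp[OF m] ..
  have gm: "m \<in> Gf b \<Longrightarrow> tp m n \<in> Gf (b + s * real n + C)" "tp m n \<in> Gf (b + s * real n) \<Longrightarrow> m \<in> Gf (b + C)" for b
    using g m unfolding growthM_def by blast+
  show "(vvge x c \<longrightarrow> vvge (vDn n x) (c - s * real n - C)) \<and> (vvge (vDn n x) (c - s * real n) \<longrightarrow> vvge x (c - C))"
  proof (intro conjI impI)
    assume "vvge x c"
    then have "vvge (tauS N x) (c - real N)" by (simp add: tauS_vvge)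
    then have "vvge (tauS N x - z) (c - real N)" by (intro vvge_diff vvge_mono[OF z]) (use N in auto)
    then have "m \<in> Gf (real N - c)" by (simp add: xz Gf_iff[OF m])
    then have "vvge (iota (tp m n)) (- (real N - c + s * real n + C))"
      using gm(1) Gf_iff[OF tp_Mot[OF m]] by blast
    then have "vvge (iota (tp m n) + vDn n z) (c - s * real n - C - real N)"
      by (intro vvge_add vvge_mono[OF z']) (use N in \<open>auto simp: algebra_simps abs_if split: if_splits\<close>)
    then show "vvge (vDn n x) (c - s * real n - C)" unfolding Dxz[symmetric] tauS_vvge by simp
  next
    assume "vvge (vDn n x) (c - s * real n)"
    then have "vvge (tauS N (vDn n x)) (c - s * real n - real N)" by (simp add: tauS_vvge)
    then have "vvge (tauS N (vDn n x) - vDn n z) (c - s * real n - real N)"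
      by (intro vvge_diff vvge_mono[OF z']) (use N in \<open>auto simp: algebra_simps abs_if split: if_splits\<close>)
    then have "vvge (iota (tp m n)) (c - s * real n - real N)" by (simp add: Dxz)
    then have "tp m n \<in> Gf ((real N - c) + s * real n)"
      by (simp add: Gf_iff[OF tp_Mot[OF m]] diff_diff_eq diff_diff_eq2 algebra_simps)
    then have "m \<in> Gf (real N - c + C)" by (rule gm(2))
    then have "vvge (iota m) (c - C - real N)" by (simp add: Gf_iff[OF m] algebra_simps)
    then have "vvge (iota m + z) (c - C - real N)" by (intro vvge_add vvge_mono[OF z]) (use N in auto)
    then show "vvge x (c - C)" unfolding xz[symmetric] tauS_vvge by simp
  qed
qed

end

section \<open>Generators and bases over the polynomial ring\<close>

lemma diff_add_add_cancel: "(x - z) + (y + z) + w = x + y + (w :: 'a :: ab_group_add)"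
  by simp

text \<open>Counting dimensions needs both that the members of the family are distinct and that
  their set is independent.\<close>

lemma (in vector_space) indep_family:
  assumes "finite A" and u: "\<And>u. (\<Sum>a\<in>A. scale (u a) (f a)) = 0 \<Longrightarrow> \<forall>a\<in>A. u a = 0"
  shows "inj_on f A" "independent (f ` A)"
proof -
  show inj: "inj_on f A"
  proof (rule inj_onI, rule ccontr)
    fix a b assume ab: "a \<in> A" "b \<in> A" "f a = f b" "a \<noteq> b"
    define w where "w = (\<lambda>x. if x = a then 1 else if x = b then - 1 else (0::'a))"
    have "(\<Sum>x\<in>A. scale (w x) (f x)) = (\<Sum>x\<in>{a,b}. scale (w x) (f x))"
      by (rule sum.mono_neutral_right) (use assms(1) ab in \<open>auto simp: w_def scale_zero_left\<close>)
    also have "\<dots> = 0" using ab(3,4) by (simp add: w_def scale_minus_left)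
    finally have "w a = 0" using u ab(1) by blast
    then show False by (simp add: w_def)
  qed
  show "independent (f ` A)"
  proof (rule independent_if_scalars_zero)
    fix w x assume "(\<Sum>x\<in>f ` A. scale (w x) x) = 0" and x: "x \<in> f ` A"
    then have "(\<Sum>a\<in>A. scale (w (f a)) (f a)) = 0" by (simp add: sum.reindex[OF inj])
    then have "\<forall>a\<in>A. w (f a) = 0" by (rule u)
    then show "w x = 0" using x by blast
  qed (use assms(1) in simp)
qed

context tmod begin

abbreviation kact :: "'k poly \<Rightarrow> 'k skvec \<Rightarrow> 'k skvec" where "kact p m \<equiv> kt_act q d D p m"
abbreviation comb :: "nat \<Rightarrow> (nat \<Rightarrow> 'k poly) \<Rightarrow> (nat \<Rightarrow> 'k skvec) \<Rightarrow> 'k skvec"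
  where "comb r ps bs \<equiv> kt_comb q d D r ps bs"

lemma kact_eq: assumes "degree p < N" shows "kact p m = (\<Sum>k<N. ks (coeff p k) (tp m k))"
proof (intro ext)
  fix j n
  have "(\<Sum>k<N. ks (coeff p k) (tp m k)) j n = (\<Sum>k<N. coeff p k * tp m k j n)"
    by (simp add: sum_fun_apply ks_nth)
  also have "\<dots> = (\<Sum>k\<le>degree p. coeff p k * tp m k j n)"
    by (rule sum.mono_neutral_right) (use assms in \<open>auto simp: coeff_eq_0\<close>)
  finally show "kact p m j n = (\<Sum>k<N. ks (coeff p k) (tp m k)) j n" by (simp add: kt_act_def)
qed

lemma comb_eq: "comb r ps bs = (\<Sum>k<r. kact (ps k) (bs k))"
  by (intro ext) (simp add: kt_comb_def sum_fun_apply)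

lemma kact_Mot: assumes "m \<in> Mot" shows "kact p m \<in> Mot"
  unfolding kact_eq[OF lessI] by (intro Mot_sum Mot_ks tp_Mot assms)

lemma kact_add_left: "kact (p + p') m = kact p m + kact p' m"
proof -
  define N where "N = Suc (max (degree p) (degree p'))"
  have "degree p < N" "degree p' < N" "degree (p + p') < N"
    using degree_add_le_max[of p p'] by (auto simp: N_def)
  then show ?thesis by (simp add: kact_eq kv.scale_left_distrib sum.distrib)
qed

lemma kact_add_right: "kact p (m + m') = kact p m + kact p m'"
  unfolding kact_eq[OF lessI] tp_add kv.scale_right_distrib sum.distrib ..

lemma kact_zero: "kact 0 m = 0" "kact p 0 = 0"
proof -
  show "kact 0 m = 0" unfolding kact_eq[OF lessI] by (simp add: kv.scale_zero_left)
  show "kact p 0 = 0" unfolding kact_eq[OF lessI] tp_zero by (simp add: kv.scale_zero_right)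
qed

lemma kact_smult: "kact (smult c p) m = ks c (kact p m)"
proof -
  have "degree (smult c p) < Suc (degree p)" "degree p < Suc (degree p)" by auto
  then show ?thesis by (simp only: kact_eq kv.scale_sum_right kv.scale_scale coeff_smult)
qed

lemma kact_pCons: "kact (pCons a p) m = ks a m + tact (kact p m)"
proof -
  have 1: "degree (pCons a p) < Suc (Suc (degree p))" by (simp add: degree_pCons_le less_Suc_eq_le)
  have 2: "degree p < Suc (degree p)" by simp
  show ?thesis
    unfolding kact_eq[OF 1] kact_eq[OF 2] sum.lessThan_Suc_shift[of _ "Suc (degree p)"] tact_sum tact_ks
    by simp
qed

lemma kact_mult: "kact (p * p') m = kact p (kact p' m)"
proof (induction p)
  case (pCons a p)
  then show ?case
    by (simp add: kact_add_left kact_smult kact_pCons kv.scale_zero_left)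
qed (simp add: kact_zero)

lemma kact_minus: "kact (- p) m = - kact p m"
  using kact_smult[of "-1" p m] by simp

lemma kact_diff: "kact (p - p') m = kact p m - kact p' m"
  using kact_add_left[of p "- p'" m] by (simp add: kact_minus)

definition gen :: "nat \<Rightarrow> (nat \<Rightarrow> 'k skvec) \<Rightarrow> bool" where
  "gen r bs \<longleftrightarrow> (\<forall>k<r. bs k \<in> Mot) \<and> (\<forall>m\<in>Mot. \<exists>ps. m = comb r ps bs)"

text \<open>tau^n in the coordinate j; for j < d these form a K-basis of M.\<close>

definition Eb :: "nat \<Rightarrow> nat \<Rightarrow> 'k skvec" where
  "Eb j n = (\<lambda>j' n'. if j' = j \<and> n' = n then 1 else 0)"

lemma Eb_Gf: "j < d \<Longrightarrow> Eb j n \<in> Gf (real n)"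
  unfolding Gf_def motive_alt by (auto simp: Eb_def intro!: exI[of _ "Suc n"])

lemma Gf_expand:
  assumes "m \<in> Gf (real N)" shows "m = (\<Sum>(j,n)\<in>{..<d} \<times> {..N}. ks (m j n) (Eb j n))"
proof (intro ext)
  fix j' n'
  have "(\<Sum>(j,n)\<in>{..<d} \<times> {..N}. ks (m j n) (Eb j n)) j' n' =
      (\<Sum>a\<in>{..<d} \<times> {..N}. if a = (j', n') then m j' n' else 0)"
    unfolding sum_fun_apply by (rule sum.cong) (auto simp: ks_nth Eb_def split: if_splits)
  also have "\<dots> = m j' n'"
    using assms by (auto simp: Gf_def motive_alt)
  finally show "m j' n' = (\<Sum>(j,n)\<in>{..<d} \<times> {..N}. ks (m j n) (Eb j n)) j' n'" by simp
qed

definition Eset :: "nat \<Rightarrow> 'k skvec set" where "Eset N = (\<lambda>(j,n). Eb j n) ` ({..<d} \<times> {..N})"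

lemma Eset_card: "finite (Eset N)" "card (Eset N) \<le> d * (N + 1)"
proof -
  show "finite (Eset N)" by (simp add: Eset_def)
  have "card (Eset N) \<le> card ({..<d} \<times> {..N})" unfolding Eset_def by (rule card_image_le) simp
  then show "card (Eset N) \<le> d * (N + 1)" by simp
qed

lemma Gf_span: "Gf (real N) \<subseteq> kv.span (Eset N)"
proof
  fix m assume "m \<in> Gf (real N)"
  then have "m = (\<Sum>(j,n)\<in>{..<d} \<times> {..N}. ks (m j n) (Eb j n))" by (rule Gf_expand)
  also have "\<dots> \<in> kv.span (Eset N)"
    by (rule kv.span_sum) (auto simp: Eset_def intro!: kv.span_scale[OF kv.span_base])
  finally show "m \<in> kv.span (Eset N)" .
qed

lemma Eset_indep: "kv.independent (Eset N)" "card (Eset N) = d * (N + 1)"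
proof -
  have "\<forall>a\<in>{..<d} \<times> {..N}. u a = 0"
    if "(\<Sum>a\<in>{..<d} \<times> {..N}. ks (u a) ((\<lambda>(j,n). Eb j n) a)) = 0" for u
  proof
    fix a assume a: "a \<in> {..<d} \<times> {..N}"
    have "0 = (\<Sum>a\<in>{..<d} \<times> {..N}. ks (u a) ((\<lambda>(j,n). Eb j n) a)) (fst a) (snd a)"
      unfolding that by simp
    also have "\<dots> = (\<Sum>b\<in>{..<d} \<times> {..N}. if b = a then u a else 0)"
      unfolding sum_fun_apply by (rule sum.cong) (auto simp: ks_nth Eb_def split: if_splits)
    also have "\<dots> = u a" using a by simp
    finally show "u a = 0" by simp
  qed
  note z = this
  show "kv.independent (Eset N)" unfolding Eset_def
    by (rule kv.indep_family(2)) (simp, rule z)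
  have "inj_on (\<lambda>(j,n). Eb j n) ({..<d} \<times> {..N})"
    by (rule kv.indep_family(1)) (simp, rule z)
  then show "card (Eset N) = d * (N + 1)" unfolding Eset_def by (simp add: card_image)
qed

text \<open>In column l the truncation of tau^N x has degree N - e, where e is the order of
  \<open>x l\<close>. These degrees increase strictly with N.\<close>

lemma ktrunc_indep:
  assumes x: "x l \<noteq> 0" and N0: "fls_subdegree (x l) \<le> int N0"
  shows "kv.independent ((\<lambda>N. ktrunc N x) ` {N0..<N0 + P}) \<and> card ((\<lambda>N. ktrunc N x) ` {N0..<N0 + P}) = P"
proof (induction P)
  case (Suc P)
  define e where "e = fls_subdegree (x l)"
  define n where "n = nat (int (N0 + P) - e)"
  have n: "int n = int (N0 + P) - e" using N0 by (simp add: n_def e_def)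
  let ?S = "(\<lambda>N. ktrunc N x) ` {N0..<N0 + P}"
  let ?y = "ktrunc (N0 + P) x"
  have sub: "kv.subspace {m. m l n = 0}"
    by (rule kv.subspaceI) (auto simp: ks_nth)
  have "?S \<subseteq> {m. m l n = 0}"
  proof clarify
    fix N assume "N \<in> {N0..<N0 + P}"
    then have "int N - int n < e" using n by auto
    then show "ktrunc N x l n = 0" by (simp add: ktrunc_def e_def)
  qed
  then have "kv.span ?S \<subseteq> {m. m l n = 0}" using sub by (rule kv.span_minimal)
  moreover have "int (N0 + P) - int n = e" using n by simp
  then have "?y l n \<noteq> 0" using x unfolding ktrunc_def by (simp only: phi_eq_0 e_def) simp
  ultimately have y: "?y \<notin> kv.span ?S" by blast
  then have y': "?y \<notin> ?S" using kv.span_base[of ?y ?S] by blast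
  have "{N0..<N0 + Suc P} = insert (N0 + P) {N0..<N0 + P}" by auto
  then have eq: "(\<lambda>N. ktrunc N x) ` {N0..<N0 + Suc P} = insert ?y ?S" by simp
  show ?case unfolding eq using Suc y y' kv.independent_insertI[OF y] by simp
qed (simp add: kv.independent_empty)

text \<open>Let U k be spanned over K by the t^i b with i < k. If t maps many independent elements of U k
  into a small space then U (k + 1), which is t (U k) plus the span of the generators, would have smaller
  dimension than U k.\<close>

lemma vD_injective:
  assumes gen: "gen r bs" and x: "x \<in> vs" "vD x = 0"
  shows "x = 0"
proof (rule ccontr)
  assume "x \<noteq> 0"
  then obtain l where l: "x l \<noteq> 0" by (auto simp: fun_eq_iff)
  obtain e where e: "e \<ge> 0" "\<And>x c. vvge x c \<Longrightarrow> vvge (vD x) (c - e)" using vD_vvge by blast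
  define E where "E = nat \<lceil>e\<rceil>"
  have E: "real E \<ge> e" unfolding E_def using e(1) by linarith
  define N0 where "N0 = nat (fls_subdegree (x l))"
  \<comment> \<open>More than the final count can absorb, namely the dimension of the small space
    and the r generators.\<close>
  define P where "P = card (Eset E) + r + 1"
  define S where "S = (\<lambda>N. ktrunc N x) ` {N0..<N0 + P}"
  have S: "kv.independent S" "card S = P" "finite S"
    using ktrunc_indep[of x l N0 P] l by (auto simp: S_def N0_def)
  have SM: "S \<subseteq> Mot" unfolding S_def using ktrunc_Mot[OF x(1)] by auto
  have ST: "tact m \<in> kv.span (Eset E)" if "m \<in> S" for m
  proof -
    obtain N where m: "m = ktrunc N x" using \<open>m \<in> S\<close> by (auto simp: S_def)
    have mM: "m \<in> Mot" using that SM by blast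
    \<comment> \<open>D kills tau^N x, so up to sign it takes the same value on the truncation as on
      the truncation error. The error has order at least 1, hence the image has bounded degree,
      uniformly in N.\<close>
    have "vD (tauS N x - iota m) = - vD (iota m)" unfolding vD_diff vD_ssm x(2) by (simp add: ssm_def fun_eq_iff)
    moreover have "vvge (vD (tauS N x - iota m)) (1 - e)"
      unfolding m by (rule e(2)[OF ktrunc_approx[OF x(1)]])
    ultimately have "vvge (- vD (iota m)) (1 - e)" by metis
    then have "vvge (0 - (- vD (iota m))) (1 - e)" by (intro vvge_diff) simp_all
    then have "vvge (iota (tact m)) (1 - e)" by (simp add: iota_tact[OF mM])
    then have "vvge (iota (tact m)) (- real E)" by (rule vvge_mono) (use E in simp)
    then have "tact m \<in> Gf (real E)" by (simp add: Gf_iff[OF tact_Mot[OF mM]])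
    then show ?thesis using Gf_span by blast
  qed
  define W where "W k = (\<lambda>(j,i). tp (bs j) i) ` ({..<r} \<times> {..<k})" for k
  have W_mono: "kv.span (W k) \<subseteq> kv.span (W k')" if "k \<le> k'" for k k'
    by (rule kv.span_mono) (use that in \<open>auto simp: W_def\<close>)
  have in_W: "\<exists>k. m \<in> kv.span (W k)" if m: "m \<in> Mot" for m
  proof -
    obtain ps where ps: "m = comb r ps bs" using gen m unfolding gen_def by blast
    define N where "N = Suc (\<Sum>k<r. degree (ps k))"
    have "kact (ps k) (bs k) \<in> kv.span (W N)" if k: "k < r" for k
    proof -
      have "degree (ps k) \<le> (\<Sum>k<r. degree (ps k))" using k by (intro member_le_sum) auto
      then have "degree (ps k) < N" by (simp add: N_def)
      then have eq: "kact (ps k) (bs k) = (\<Sum>i<N. ks (coeff (ps k) i) (tp (bs k) i))" by (rule kact_eq)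
      show ?thesis unfolding eq
        by (intro kv.span_sum kv.span_scale[OF kv.span_base]) (use k in \<open>auto simp: W_def\<close>)
    qed
    then have "m \<in> kv.span (W N)" unfolding ps comb_eq by (intro kv.span_sum) auto
    then show ?thesis by blast
  qed
  have "\<exists>k. S \<subseteq> kv.span (W k)"
    using S(3) SM
  proof (induction S rule: finite_induct)
    case (insert a S)
    then obtain k1 where "S \<subseteq> kv.span (W k1)" by auto
    moreover obtain k2 where "a \<in> kv.span (W k2)" using in_W[of a] insert by auto
    ultimately have "insert a S \<subseteq> kv.span (W (max k1 k2))"
      using W_mono[of k1 "max k1 k2"] W_mono[of k2 "max k1 k2"] by auto
    then show ?case by blast
  qed auto
  then obtain k where k: "S \<subseteq> kv.span (W k)" by blast
  obtain B where B: "S \<subseteq> B" "B \<subseteq> kv.span (W k)" "kv.independent B" "kv.span (W k) \<subseteq> kv.span B"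
    using kv.maximal_independent_subset_extend[OF k S(1)] by blast
  have finB: "finite B" using kv.independent_span_bound[OF _ B(3,2)] by (auto simp: W_def)
  \<comment> \<open>The part S of the basis B goes into the span of \<open>Eset E\<close>, so this
    set spans \<open>W (Suc k)\<close> but has fewer elements than B by the choice of P.\<close>
  define Z where "Z = tact ` (B - S) \<union> Eset E \<union> bs ` {..<r}"
  have finZ: "finite Z" unfolding Z_def using finB Eset_card(1) by auto
  have tB: "tact m \<in> kv.span Z" if "m \<in> kv.span B" for m
    using that
  proof (induction rule: kv.span_induct_alt)
    case base
    show ?case by (simp only: tact_zero kv.span_zero)
  next
    case (step c a y)
    have "tact a \<in> kv.span Z"
    proof (cases "a \<in> S")
      case True
      have "kv.span (Eset E) \<subseteq> kv.span Z" by (rule kv.span_mono) (auto simp: Z_def)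
      then show ?thesis using ST[OF True] by blast
    next
      case False
      then show ?thesis using step(1) by (intro kv.span_base) (auto simp: Z_def)
    qed
    then show ?case using step(2) unfolding tact_add tact_ks by (intro kv.span_add kv.span_scale)
  qed
  have "W (Suc k) \<subseteq> kv.span Z"
  proof
    fix y assume "y \<in> W (Suc k)"
    then obtain j i where y: "y = tp (bs j) i" "j < r" "i < Suc k" by (auto simp: W_def)
    show "y \<in> kv.span Z"
    proof (cases i)
      case 0
      then show ?thesis using y by (intro kv.span_base) (auto simp: Z_def)
    next
      case (Suc i')
      then have "tp (bs j) i' \<in> kv.span (W k)" using y by (intro kv.span_base) (auto simp: W_def)
      then have "tact (tp (bs j) i') \<in> kv.span Z" using tB B(4) by blast
      then show ?thesis using y(1) Suc by simp
    qed
  qed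
  then have "kv.span (W (Suc k)) \<subseteq> kv.span Z" by (intro kv.span_minimal) auto
  then have "B \<subseteq> kv.span Z" using B(2) W_mono[of k "Suc k"] by auto
  then have "card B \<le> card Z" using kv.independent_span_bound[OF finZ B(3)] by blast
  also have "card Z \<le> card (tact ` (B - S)) + card (Eset E) + card (bs ` {..<r})"
    unfolding Z_def by (meson add_le_mono1 card_Un_le le_trans)
  also have "\<dots> \<le> card (B - S) + card (Eset E) + r"
    using card_image_le[of "B - S" tact] card_image_le[of "{..<r}" bs] finB by simp
  also have "card (B - S) = card B - P" using B(1) S by (simp add: card_Diff_subset)
  finally have "card B \<le> card B - P + card (Eset E) + r" .
  moreover have "P \<le> card B" using card_mono[OF finB B(1)] S(2) by simp
  ultimately show False by (simp add: P_def)
qed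

lemma tp_kact_bound:
  assumes "\<And>i. tp m i \<in> Gf c" shows "kact p m \<in> Gf c"
  unfolding kact_eq[OF lessI] by (intro Gf_sum Gf_ks assms)

text \<open>For s at most 0 the elements t^i b, for generators b, would have bounded degree, hence
  so would all of M, which contains every power of tau.\<close>

lemma growth_pos:
  assumes gen: "gen r bs" and g: "growthM s C" and "d \<ge> 1" shows "s > 0"
proof (rule ccontr)
  assume s: "\<not> s > 0"
  have "\<forall>k. \<exists>N::nat. k < r \<longrightarrow> bs k \<in> Gf (real N)" using gen Mot_Gf unfolding gen_def by blast
  then obtain N where N: "\<And>k. k < r \<Longrightarrow> bs k \<in> Gf (real (N k))" by metis
  define c where "c = real (\<Sum>k<r. N k)"
  have bs: "tp (bs k) i \<in> Gf (c + C)" if k: "k < r" for k i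
  proof -
    have "N k \<le> (\<Sum>k<r. N k)" using k by (intro member_le_sum) auto
    then have "bs k \<in> Gf c" using Gf_mono[OF N[OF k], of c] unfolding c_def by (simp only: of_nat_mono)
    then have "tp (bs k) i \<in> Gf (c + s * real i + C)" using g Gf_Mot unfolding growthM_def by blast
    then show ?thesis by (rule Gf_mono) (use s in \<open>simp add: mult_nonpos_nonneg\<close>)
  qed
  have all: "m \<in> Gf (c + C)" if m: "m \<in> Mot" for m
  proof -
    obtain ps where ps: "m = comb r ps bs" using gen m unfolding gen_def by blast
    show ?thesis unfolding ps comb_eq by (intro Gf_sum tp_kact_bound bs) auto
  qed
  define M where "M = nat \<lceil>c + C\<rceil> + 1"
  have "Eb 0 M \<in> Gf (real M)" by (rule Eb_Gf) (use assms(3) in simp)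
  then have "Eb 0 M \<in> Gf (c + C)" by (intro all) (rule Gf_Mot)
  then have "real M > c + C \<Longrightarrow> Eb 0 M 0 M = 0" by (simp add: Gf_def)
  then have "\<not> real M > c + C" by (auto simp: Eb_def)
  moreover have "real M > c + C" unfolding M_def by linarith
  ultimately show False by simp
qed

text \<open>A relation p m = 0 expresses all t^i m through the first deg p of them, so their degrees
  stay bounded. As t^i raises degrees by s i up to a constant, m has negative degree and is
  0.\<close>

lemma torsion_free:
  assumes g: "growthM s C" "s > 0" and m: "m \<in> Mot" and p: "p \<noteq> 0" "kact p m = 0"
  shows "m = 0"
proof -
  define N where "N = degree p"
  define a where "a = coeff p N"
  have a: "a \<noteq> 0" using p(1) by (simp add: a_def N_def)
  have "kact p m = (\<Sum>k<N. ks (coeff p k) (tp m k)) + ks a (tp m N)"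
    by (subst kact_eq[of p "Suc N"]) (simp_all add: N_def a_def)
  then have "(\<Sum>k<N. ks (coeff p k) (tp m k)) + ks a (tp m N) = 0" using p(2) by metis
  then have "ks a (tp m N) = - (\<Sum>k<N. ks (coeff p k) (tp m k))" by (simp only: add_eq_0_iff)
  then have "ks (1 / a) (ks a (tp m N)) = ks (- 1 / a) (\<Sum>k<N. ks (coeff p k) (tp m k))"
    by (simp add: kv.scale_minus_right kv.scale_minus_left)
  then have top: "tp m N = (\<Sum>k<N. ks (- coeff p k / a) (tp m k))"
    using a by (simp add: kv.scale_sum_right)
  have "\<forall>k. \<exists>n::nat. tp m k \<in> Gf (real n)" using Mot_Gf tp_Mot[OF m] by blast
  then obtain n where n: "\<And>k. tp m k \<in> Gf (real (n k))" by metis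
  define c where "c = real (\<Sum>k<N. n k)"
  have all: "tp m i \<in> Gf c" for i
  proof (induction i rule: less_induct)
    case (less i)
    show ?case
    proof (cases "i < N")
      case True
      then have "n i \<le> (\<Sum>k<N. n k)" by (intro member_le_sum) auto
      then show ?thesis using Gf_mono[OF n[of i], of c] unfolding c_def by (simp only: of_nat_mono)
    next
      case False
      have "tp m i = tp (tp m N) (i - N)" using False by (simp add: tp_tp)
      also have "\<dots> = (\<Sum>k<N. ks (- coeff p k / a) (tp m (k + (i - N))))"
        unfolding top tp_sum tp_ks tp_tp ..
      also have "\<dots> \<in> Gf c" by (intro Gf_sum Gf_ks less) (use False in auto)
      finally show ?thesis .
    qed
  qed
  obtain i where "c + C < real i * s" using reals_Archimedean3[OF g(2)] by metis
  then have i: "c - s * real i + C < 0" by (simp add: algebra_simps)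
  have "tp m i \<in> Gf ((c - s * real i) + s * real i)" using all[of i] by simp
  then have "m \<in> Gf (c - s * real i + C)" using g(1) m unfolding growthM_def by blast
  then show ?thesis using i by (rule Gf_neg)
qed

lemma comb_split:
  assumes "k < r" shows "comb r ps bs = kact (ps k) (bs k) + (\<Sum>j\<in>{..<r} - {k}. kact (ps j) (bs j))"
  unfolding comb_eq using assms by (subst sum.remove[of _ k]) auto

lemma comb_split2:
  assumes "k < r" "l < r" "k \<noteq> l"
  shows "comb r ps bs = kact (ps k) (bs k) + kact (ps l) (bs l) + (\<Sum>j\<in>{..<r} - {k,l}. kact (ps j) (bs j))"
proof -
  have "{..<r} - {k} - {l} = {..<r} - {k,l}" by auto
  then show ?thesis
    unfolding comb_split[OF assms(1)] using assms by (subst sum.remove[of _ l]) (auto simp: add.assoc)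
qed

text \<open>Euclid's algorithm on the coefficients of a relation. While two are nonzero, the one of
  larger degree is reduced by a multiple of the other, compensated by a change of generators. When
  only one is left, torsion-freeness makes its generator 0.\<close>

lemma gen_reduce:
  assumes tf: "\<And>p m. m \<in> Mot \<Longrightarrow> p \<noteq> 0 \<Longrightarrow> kact p m = 0 \<Longrightarrow> m = 0"
    and "gen r bs" "comb r ps bs = 0" "\<exists>k<r. ps k \<noteq> 0"
  shows "\<exists>bs'. r > 0 \<and> gen (r - 1) bs'"
  using assms(2-)
\<comment> \<open>Nonzero constants count 1, so the measure also drops when a coefficient becomes
  0.\<close>
proof (induction "\<Sum>k<r. if ps k = 0 then 0 else Suc (degree (ps k))" arbitrary: bs ps rule: less_induct)
  case less
  note gen = less.prems(1) and rel = less.prems(2)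
  obtain k where k: "k < r" "ps k \<noteq> 0" using less.prems(3) by blast
  show ?case
  proof (cases "\<exists>l<r. l \<noteq> k \<and> ps l \<noteq> 0")
    case True
    then obtain l0 where l0: "l0 < r" "l0 \<noteq> k" "ps l0 \<noteq> 0" by blast
    have "\<exists>a b. a < r \<and> b < r \<and> a \<noteq> b \<and> ps a \<noteq> 0 \<and> ps b \<noteq> 0 \<and> degree (ps b) \<le> degree (ps a)"
      using k l0 linear[of "degree (ps l0)" "degree (ps k)"] by metis
    then obtain a b where ab: "a < r" "b < r" "a \<noteq> b" "ps a \<noteq> 0" "ps b \<noteq> 0" "degree (ps b) \<le> degree (ps a)" by blast
    define g where "g = monom (lead_coeff (ps a) / lead_coeff (ps b)) (degree (ps a) - degree (ps b))"
    define p' where "p' = ps a - g * ps b"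
    have p': "p' = 0 \<or> degree p' < degree (ps a)"
    proof (rule disjCI)
      assume nd: "\<not> degree p' < degree (ps a)"
      have g0: "g \<noteq> 0" using ab by (simp add: g_def)
      have "degree g = degree (ps a) - degree (ps b)"
        unfolding g_def by (rule degree_monom_eq) (use ab in simp)
      then have dg: "degree (g * ps b) = degree (ps a)"
        using ab g0 by (simp add: degree_mult_eq)
      have lg: "lead_coeff g = lead_coeff (ps a) / lead_coeff (ps b)"
        unfolding g_def by (rule lead_coeff_monom)
      have "lead_coeff (g * ps b) = lead_coeff (ps a)"
        unfolding lead_coeff_mult lg using ab(5) by simp
      then have c0: "coeff p' (degree (ps a)) = 0" using dg by (simp add: p'_def)
      have "degree p' \<le> degree (ps a)" unfolding p'_def using dg by (intro degree_diff_le) auto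
      then have "degree p' = degree (ps a)" using nd by simp
      then show "p' = 0" using c0 by (metis leading_coeff_0_iff)
    qed
    \<comment> \<open>The term \<open>g * ps b\<close> taken from the coefficient of
      \<open>bs a\<close> reappears inside the new generator of index b.\<close>
    define bs' where "bs' = bs(b := bs b + kact g (bs a))"
    define ps' where "ps' = ps(a := p')"
    have change: "comb r (qs(a := qs a - g * qs b)) bs' = comb r qs bs" for qs
    proof -
      have rest: "(\<Sum>j\<in>{..<r} - {a,b}. kact ((qs(a := qs a - g * qs b)) j) (bs' j)) = (\<Sum>j\<in>{..<r} - {a,b}. kact (qs j) (bs j))"
        by (rule sum.cong) (auto simp: bs'_def)
      have gq: "kact (g * qs b) (bs a) = kact (qs b) (kact g (bs a))"
        by (simp add: mult.commute[of g] kact_mult)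
      have 1: "bs' a = bs a" "bs' b = bs b + kact g (bs a)" "(qs(a := qs a - g * qs b)) a = qs a - g * qs b"
         "(qs(a := qs a - g * qs b)) b = qs b" using ab(3) by (auto simp: bs'_def)
      show ?thesis
        unfolding comb_split2[OF ab(1-3)] rest 1 kact_diff kact_add_right gq by (rule diff_add_add_cancel)
    qed
    have gen': "gen r bs'"
      unfolding gen_def
    proof (intro conjI allI impI ballI)
      show "bs' j \<in> Mot" if "j < r" for j
        using gen ab(1,2) that unfolding gen_def bs'_def by (auto intro!: Mot_add kact_Mot)
      fix m assume "m \<in> Mot"
      then obtain qs where "m = comb r qs bs" using gen unfolding gen_def by blast
      then show "\<exists>ps. m = comb r ps bs'" using change by metis
    qed
    have "comb r ps' bs' = 0" unfolding ps'_def p'_def change rel ..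
    moreover have "\<exists>k<r. ps' k \<noteq> 0" using ab by (intro exI[of _ b]) (auto simp: ps'_def)
    moreover have "(\<Sum>k<r. if ps' k = 0 then 0 else Suc (degree (ps' k))) < (\<Sum>k<r. if ps k = 0 then 0 else Suc (degree (ps k)))"
      by (rule sum_strict_mono_ex1) (use p' ab in \<open>auto simp: ps'_def intro!: bexI[of _ a]\<close>)
    ultimately show ?thesis using less.hyps gen' by blast
  next
    case False
    have "comb r ps bs = kact (ps k) (bs k) + (\<Sum>j\<in>{..<r} - {k}. kact (ps j) (bs j))"
      by (rule comb_split[OF k(1)])
    also have "(\<Sum>j\<in>{..<r} - {k}. kact (ps j) (bs j)) = 0"
      by (rule sum.neutral) (use False kact_zero in auto)
    finally have "kact (ps k) (bs k) = 0" using rel by (metis add.right_neutral)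
    moreover have "bs k \<in> Mot" using gen k(1) unfolding gen_def by blast
    ultimately have bk: "bs k = 0" using tf k(2) by blast
    \<comment> \<open>The last generator takes the vacant place k.\<close>
    define bs' where "bs' = bs(k := bs (r - 1))"
    have "gen (r - 1) bs'"
      unfolding gen_def
    proof (intro conjI allI impI ballI)
      show "bs' j \<in> Mot" if "j < r - 1" for j
        using gen that unfolding gen_def bs'_def by auto
      fix m assume "m \<in> Mot"
      then obtain qs where qs: "m = comb r qs bs" using gen unfolding gen_def by blast
      define qs' where "qs' = qs(k := qs (r - 1))"
      have "m = (\<Sum>j\<in>{..<r} - {k}. kact (qs j) (bs j))"
        unfolding qs comb_split[OF k(1)] bk by (simp add: kact_zero)
      also have "\<dots> = (\<Sum>j<r - 1. kact (qs' j) (bs' j))"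
        by (rule sum.reindex_bij_witness[of _ "\<lambda>j. if j = k then r - 1 else j" "\<lambda>j. if j = r - 1 then k else j"])
          (use k(1) in \<open>auto simp: qs'_def bs'_def split: if_splits\<close>)
      finally show "\<exists>ps. m = comb (r - 1) ps bs'" unfolding comb_eq by blast
    qed
    then show ?thesis using k(1) by auto
  qed
qed

text \<open>A generating family of least length admits no relation, by
  \<open>gen_reduce\<close>.\<close>

lemma basis_exists:
  assumes gen: "gen r bs" and g: "growthM s C" "s > 0"
  shows "\<exists>r bs. kt_basis q d D r bs"
proof -
  define r0 where "r0 = (LEAST r. \<exists>bs. gen r bs)"
  have "\<exists>bs. gen r0 bs" unfolding r0_def using gen by (intro LeastI_ex[where P="\<lambda>r. \<exists>bs. gen r bs"]) blast
  then obtain b0 where b0: "gen r0 b0" by blast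
  have min: "\<not> gen r' b'" if "r' < r0" for r' b'
    using not_less_Least[of r' "\<lambda>r. \<exists>bs. gen r bs"] that unfolding r0_def by blast
  have "\<forall>k<r0. ps k = 0" if rel: "comb r0 ps b0 = 0" for ps
  proof (rule ccontr)
    assume "\<not> (\<forall>k<r0. ps k = 0)"
    then have "\<exists>k<r0. ps k \<noteq> 0" by blast
    then have "\<exists>bs'. r0 > 0 \<and> gen (r0 - 1) bs'"
      by (intro gen_reduce[OF _ b0 rel]) (rule torsion_free[OF g])
    then obtain bs' where "r0 > 0" "gen (r0 - 1) bs'" by blast
    then show False using min[of "r0 - 1"] by simp
  qed
  then have "kt_basis q d D r0 b0"
    using b0 unfolding kt_basis_def gen_def zero_fun_def by blast
  then show ?thesis by blast
qed

end

section \<open>Comparison of the two degree filtrations\<close>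

text \<open>Here F and G are the exhaustive filtrations of M by the degree in X and by another degree, in which
  X has degree s up to a bounded error. Both are filtrations by finite-dimensional spaces, so in
  m = f + X^k m' the remainder m' lies in a fixed step of F.\<close>

lemma filtration_compare:
  fixes F G :: "real \<Rightarrow> 'm::ab_group_add set" and X :: "nat \<Rightarrow> 'm \<Rightarrow> 'm"
  assumes s: "s > 0" and C: "B \<ge> 0"
    and FG: "\<And>c. F c \<subseteq> G (s * c + B)"
    and X_low: "\<And>k m c. m \<in> M \<Longrightarrow> X k m \<in> G (c + s * real k) \<Longrightarrow> m \<in> G (c + C)"
    and split: "\<And>k m. m \<in> M \<Longrightarrow> \<exists>f\<in>F (real k). \<exists>m'\<in>M. m = f + X k m'"
    and bound: "\<And>c. \<exists>c'. G c \<subseteq> F c'"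
    and X_F: "\<And>k m c. m \<in> F c \<Longrightarrow> X k m \<in> F (c + real k)"
    and F_mono: "\<And>c c'. c \<le> c' \<Longrightarrow> F c \<subseteq> F c'" and G_mono: "\<And>c c'. c \<le> c' \<Longrightarrow> G c \<subseteq> G c'"
    and F_add: "\<And>x y c. x \<in> F c \<Longrightarrow> y \<in> F c \<Longrightarrow> x + y \<in> F c"
    and G_diff: "\<And>x y c. x \<in> G c \<Longrightarrow> y \<in> G c \<Longrightarrow> x - y \<in> G c"
    and G_neg: "\<And>c. c < 0 \<Longrightarrow> G c \<subseteq> {0}" and F_zero: "\<And>c. 0 \<in> F c" and GM: "\<And>c. G c \<subseteq> M"
  shows "\<exists>C2\<ge>0. \<forall>c. G (s * c) \<subseteq> F (c + C2)"
proof -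
  obtain c' where c': "G (B + C) \<subseteq> F c'" using bound by blast
  define C2 where "C2 = 1 + max 0 c'"
  have "m \<in> F (c + C2)" if m: "m \<in> G (s * c)" for m c
  proof (cases "c < 0")
    case True
    then have "s * c < 0" using s by (simp add: mult_pos_neg)
    then have "m = 0" using m G_neg by blast
    then show ?thesis using F_zero by simp
  next
    case False
    \<comment> \<open>Rounding c up costs at most 1, which is the 1 in \<open>C2\<close>.\<close>
    define k where "k = nat \<lceil>c\<rceil>"
    have k: "c \<le> real k" "real k \<le> c + 1" using False unfolding k_def by linarith+
    obtain f m' where f: "f \<in> F (real k)" "m' \<in> M" "m = f + X k m'" using split m GM by blast
    have "s * c \<le> s * real k + B" using k(1) s C by (simp add: add_increasing2)
    then have "m \<in> G (s * real k + B)" using m G_mono by blast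
    moreover have "f \<in> G (s * real k + B)" using f(1) FG by blast
    ultimately have "m - f \<in> G (s * real k + B)" by (rule G_diff)
    \<comment> \<open>Both m and f have degree at most s k + B, so undoing X^k puts m' into the step
      G (B + C), which is independent of c.\<close>
    then have "X k m' \<in> G (B + s * real k)" using f(3) by (simp add: add.commute)
    then have "m' \<in> F c'" using X_low[OF f(2)] c' by blast
    then have "X k m' \<in> F (c' + real k)" by (rule X_F)
    moreover have "c' + real k \<le> c + C2" "real k \<le> c + C2"
      using k(2) max.cobounded1[of 0 c'] max.cobounded2[of c' 0] unfolding C2_def by linarith+
    ultimately have "X k m' \<in> F (c + C2)" "f \<in> F (c + C2)" using F_mono f(1) by blast+
    then show ?thesis using f(3) F_add by simp
  qed
  then show ?thesis by (intro exI[of _ C2]) (auto simp: C2_def)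
qed

lemma nat_floor_less: assumes "real i > real (nat \<lfloor>c\<rfloor>)" shows "real i > c"
proof -
  have "\<lfloor>c\<rfloor> < int i" using assms by linarith
  then show ?thesis by linarith
qed

context tmod begin

definition taun :: "nat \<Rightarrow> 'k skvec \<Rightarrow> 'k skvec" where "taun n = tau_act q ^^ n"

lemma taun_0 [simp]: "taun 0 m = m" by (simp add: taun_def)
lemma taun_Suc: "taun (Suc n) m = tau_act q (taun n m)" by (simp add: taun_def)

lemma taun_nth: "taun n m j i = (if i < n then 0 else (m j (i - n) :: 'k) ^ (q ^ n))"
proof (induction n arbitrary: i)
  case (Suc n)
  show ?case
  proof (cases i)
    case (Suc i')
    then show ?thesis by (simp add: taun_Suc tau_act_nth Suc.IH power_0_left mult.commute flip: power_mult)
  qed (simp add: taun_Suc tau_act_nth)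
qed simp

lemma taun_Mot: "m \<in> Mot \<Longrightarrow> taun n m \<in> Mot"
  by (induction n) (auto simp: taun_Suc tau_Mot)

lemma taun_Gf: assumes "m \<in> Mot" shows "taun n m \<in> Gf (c + real n) \<longleftrightarrow> m \<in> Gf c"
proof
  assume A: "taun n m \<in> Gf (c + real n)"
  have "m j i = 0" if "real i > c" for j i
  proof -
    have "taun n m j (i + n) = 0" using A that by (simp add: Gf_def)
    then show ?thesis by (simp add: taun_nth)
  qed
  then show "m \<in> Gf c" using assms by (simp add: Gf_def)
next
  assume "m \<in> Gf c"
  then have "m j (i - n) = 0" if "i \<ge> n" "real i > c + real n" for i j
    using that by (simp add: Gf_def of_nat_diff)
  then show "taun n m \<in> Gf (c + real n)" using taun_Mot[OF assms] by (auto simp: Gf_def taun_nth power_0_left)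
qed

lemma Eb_taun: "Eb j n = taun n (Eb j 0)"
  by (intro ext) (auto simp: taun_nth Eb_def power_0_left)

text \<open>Terms of degree at least k are left multiples of tau^k because K is perfect: the
  coefficients of the cofactor are roots of order q^k.\<close>

lemma taun_split: assumes m: "m \<in> Mot" shows "\<exists>f\<in>Gf (real k). \<exists>m'\<in>Mot. m = f + taun k m'"
proof -
  define f where "f = (\<lambda>j n. if n < k then m j n else 0)"
  define m' where "m' = (\<lambda>j n. phi_int (- int k) (m j (n + k)))"
  obtain N where N: "\<forall>j n. n \<ge> N \<longrightarrow> m j n = 0" using motive_bound[OF m] ..
  have z: "\<forall>j n. d \<le> j \<longrightarrow> m j n = 0" using m unfolding motive_alt by blast
  have "f \<in> Gf (real k)" unfolding Gf_def motive_alt using z by (auto simp: f_def intro!: exI[of _ k])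
  moreover have "m' \<in> Mot" unfolding motive_alt using z N by (auto simp: m'_def intro!: exI[of _ N])
  moreover have "m = f + taun k m'"
    by (intro ext) (simp add: f_def m'_def taun_nth phi_nat[symmetric])
  ultimately show ?thesis by blast
qed

end

section \<open>The degree in t relative to a basis\<close>

locale tbasis = tmod q K d D for q and K :: "'k::field itself" and d and D :: "'k skmat" +
  fixes r :: nat and bs :: "nat \<Rightarrow> 'k skvec"
  assumes basis: "kt_basis q d D r bs"
begin

lemma bs_Mot: "k < r \<Longrightarrow> bs k \<in> Mot" using basis by (simp add: kt_basis_def)

lemma comb_add: "comb r (\<lambda>k. ps k + ps' k) bs = comb r ps bs + comb r ps' bs"
  unfolding comb_eq kact_add_left sum.distrib ..
lemma comb_diff: "comb r (\<lambda>k. ps k - ps' k) bs = comb r ps bs - comb r ps' bs"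
  unfolding comb_eq kact_diff sum_subtractf ..
lemma comb_smult: "comb r (\<lambda>k. smult c (ps k)) bs = ks c (comb r ps bs)"
  unfolding comb_eq kact_smult kv.scale_sum_right ..
lemma comb_Mot: "comb r ps bs \<in> Mot"
  unfolding comb_eq by (intro Mot_sum kact_Mot bs_Mot) auto

lemma comb_unique: assumes "comb r ps bs = comb r ps' bs" "k < r" shows "ps k = ps' k"
proof -
  have "comb r (\<lambda>k. ps k - ps' k) bs = 0" unfolding comb_diff assms(1) by (rule diff_self)
  then have "ps k - ps' k = 0" using basis assms(2) unfolding kt_basis_def zero_fun_def by blast
  then show ?thesis by simp
qed

lemma comb_ex: assumes "m \<in> Mot" shows "\<exists>ps. m = comb r ps bs"
  using basis assms by (simp add: kt_basis_def)

definition Ff :: "real \<Rightarrow> 'k skvec set" where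
  "Ff c = {comb r ps bs | ps. \<forall>k<r. \<forall>i. real i > c \<longrightarrow> coeff (ps k) i = 0}"

lemma comb_Ff: "comb r ps bs \<in> Ff c \<longleftrightarrow> (\<forall>k<r. \<forall>i. real i > c \<longrightarrow> coeff (ps k) i = 0)"
proof
  assume "comb r ps bs \<in> Ff c"
  then obtain ps' where "comb r ps bs = comb r ps' bs" "\<forall>k<r. \<forall>i. real i > c \<longrightarrow> coeff (ps' k) i = 0"
    unfolding Ff_def by blast
  then show "\<forall>k<r. \<forall>i. real i > c \<longrightarrow> coeff (ps k) i = 0" using comb_unique by metis
qed (auto simp: Ff_def)

lemma Ff_Mot: "m \<in> Ff c \<Longrightarrow> m \<in> Mot" unfolding Ff_def using comb_Mot by blast

lemma Ff_mono: assumes "c \<le> c'" shows "Ff c \<subseteq> Ff c'"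
proof
  fix m assume "m \<in> Ff c"
  then obtain ps where "m = comb r ps bs" "\<forall>k<r. \<forall>i. real i > c \<longrightarrow> coeff (ps k) i = 0"
    unfolding Ff_def by blast
  then show "m \<in> Ff c'" using assms by (auto simp: comb_Ff)
qed

lemma kv_subspace_Ff: "kv.subspace (Ff c)"
proof (rule kv.subspaceI)
  have "comb r (\<lambda>_. 0) bs = 0" unfolding comb_eq by (simp add: kact_zero)
  then show "0 \<in> Ff c" using comb_Ff[of "\<lambda>_. 0" c] by simp
  show "x + y \<in> Ff c" if xy: "x \<in> Ff c" "y \<in> Ff c" for x y
  proof -
    obtain ps ps' where e: "x = comb r ps bs" "y = comb r ps' bs" using xy unfolding Ff_def by blast
    show ?thesis using xy unfolding e comb_add[symmetric] comb_Ff by simp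
  qed
  show "ks a x \<in> Ff c" if x: "x \<in> Ff c" for a x
  proof -
    obtain ps where e: "x = comb r ps bs" using x unfolding Ff_def by blast
    show ?thesis using x unfolding e comb_smult[symmetric] comb_Ff by simp
  qed
qed

lemmas Ff_add = kv.subspace_add[OF kv_subspace_Ff]
  and Ff_zero = kv.subspace_0[OF kv_subspace_Ff]
  and Ff_ks = kv.subspace_scale[OF kv_subspace_Ff]
  and Ff_diff = kv.subspace_diff[OF kv_subspace_Ff]
  and Ff_sum = kv.subspace_sum[OF kv_subspace_Ff]

lemma Ff_neg: assumes "c < 0" shows "Ff c \<subseteq> {0}"
proof
  fix m assume "m \<in> Ff c"
  then obtain ps where m: "m = comb r ps bs" "\<forall>k<r. \<forall>i. real i > c \<longrightarrow> coeff (ps k) i = 0"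
    unfolding Ff_def by blast
  have "ps k = 0" if "k < r" for k
    using m(2) that assms by (intro poly_eqI) (simp add: less_le_trans[OF assms])
  then have "m = 0" unfolding m(1) comb_eq by (simp add: kact_zero)
  then show "m \<in> {0}" by simp
qed

lemma Mot_Ff: assumes "m \<in> Mot" shows "\<exists>N::nat. m \<in> Ff (real N)"
proof -
  obtain ps where ps: "m = comb r ps bs" using comb_ex[OF assms] by blast
  have "coeff (ps k) i = 0" if "k < r" "real i > real (\<Sum>k<r. degree (ps k))" for k i
  proof -
    have "degree (ps k) \<le> (\<Sum>k<r. degree (ps k))" using that(1) by (intro member_le_sum) auto
    then show ?thesis using that(2) by (intro coeff_eq_0) linarith
  qed
  then show ?thesis unfolding ps comb_Ff by blast
qed

lemma kact_monom: "kact (monom 1 n) m = tp m n"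
proof -
  have "kact (monom 1 n) m = (\<Sum>k<Suc n. ks (coeff (monom 1 n) k) (tp m k))"
    by (rule kact_eq) (simp add: degree_monom_eq)
  also have "\<dots> = (\<Sum>k<Suc n. if k = n then tp m n else 0)"
    by (rule sum.cong) (auto simp: kv.scale_zero_left)
  finally show ?thesis by simp
qed

lemma tp_comb: "tp (comb r ps bs) n = comb r (\<lambda>k. monom 1 n * ps k) bs"
  unfolding comb_eq tp_sum kact_mult kact_monom ..

text \<open>The coordinates are multiplied by t^n, so on this filtration the shift is exact.\<close>

lemma tp_Ff: assumes "m \<in> Mot" shows "tp m n \<in> Ff (c + real n) \<longleftrightarrow> m \<in> Ff c"
proof -
  obtain ps where ps: "m = comb r ps bs" using comb_ex[OF assms] by blast
  have "(\<forall>i. real i > c + real n \<longrightarrow> coeff (monom 1 n * p) i = 0) \<longleftrightarrow> (\<forall>i. real i > c \<longrightarrow> coeff p i = 0)"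
    for p :: "'k poly"
  proof
    assume A: "\<forall>i. real i > c + real n \<longrightarrow> coeff (monom 1 n * p) i = 0"
    show "\<forall>i. real i > c \<longrightarrow> coeff p i = 0"
      using A[rule_format, of "_ + n"] by (simp add: coeff_monom_mult)
  next
    assume A: "\<forall>i. real i > c \<longrightarrow> coeff p i = 0"
    show "\<forall>i. real i > c + real n \<longrightarrow> coeff (monom 1 n * p) i = 0"
      using A by (auto simp: coeff_monom_mult of_nat_diff)
  qed
  then show ?thesis unfolding ps tp_comb comb_Ff by simp
qed

text \<open>Division of all coordinates by t^k.\<close>

lemma tp_split: assumes "m \<in> Mot" shows "\<exists>f\<in>Ff (real k). \<exists>m'\<in>Mot. m = f + tp m' k"
proof -
  obtain ps where ps: "m = comb r ps bs" using comb_ex[OF assms] by blast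
  have e: "(\<lambda>j. ps j mod monom 1 k + monom 1 k * (ps j div monom 1 k)) = ps" by (rule ext) simp
  have "m = comb r (\<lambda>j. ps j mod monom 1 k) bs + tp (comb r (\<lambda>j. ps j div monom 1 k) bs) k"
    unfolding tp_comb comb_add[symmetric] e by (rule ps)
  moreover have "comb r (\<lambda>j. ps j mod monom 1 k) bs \<in> Ff (real k)"
    unfolding comb_Ff
  proof (intro allI impI)
    fix j i assume i: "real i > real k"
    have "monom (1::'k) k \<noteq> 0" by simp
    then have "ps j mod monom 1 k = 0 \<or> degree (ps j mod monom 1 k) < k"
      using degree_mod_less[of "monom 1 k" "ps j"] by (simp add: degree_monom_eq)
    then show "coeff (ps j mod monom 1 k) i = 0" using i by (auto intro: coeff_eq_0)
  qed
  ultimately show ?thesis using comb_Mot by blast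
qed

lemma Ff_expand:
  assumes "m \<in> Ff (real N)"
  shows "\<exists>u. m = (\<Sum>(k,i)\<in>{..<r} \<times> {..N}. ks (u k i) (tp (bs k) i))"
proof -
  obtain ps where ps: "m = comb r ps bs" "\<forall>k<r. \<forall>i. real i > real N \<longrightarrow> coeff (ps k) i = 0"
    using assms unfolding Ff_def by blast
  have "kact (ps k) (bs k) = (\<Sum>i\<le>N. ks (coeff (ps k) i) (tp (bs k) i))" if "k < r" for k
  proof -
    have "degree (ps k) \<le> N" using ps(2) that by (intro degree_le) auto
    then have "degree (ps k) < Suc N" by simp
    then show ?thesis by (simp only: kact_eq lessThan_Suc_atMost)
  qed
  then have "m = (\<Sum>k<r. \<Sum>i\<le>N. ks (coeff (ps k) i) (tp (bs k) i))"
    unfolding ps(1) comb_eq by (intro sum.cong) auto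
  also have "\<dots> = (\<Sum>(k,i)\<in>{..<r} \<times> {..N}. ks (coeff (ps k) i) (tp (bs k) i))"
    by (simp add: sum.cartesian_product)
  finally show ?thesis by (intro exI[of _ "\<lambda>k. coeff (ps k)"])
qed

lemma Gf_real_nat: "\<exists>N::nat. Gf c \<subseteq> Gf (real N)"
proof -
  have "c \<le> real (nat \<lceil>c\<rceil>)" by linarith
  then show ?thesis using Gf_mono by blast
qed

lemma Ff_real_nat: "\<exists>N::nat. Ff c \<subseteq> Ff (real N)"
proof -
  have "c \<le> real (nat \<lceil>c\<rceil>)" by linarith
  then show ?thesis using Ff_mono by blast
qed

lemma finite_Ff: assumes "finite A" "\<And>a. a \<in> A \<Longrightarrow> f a \<in> Mot" shows "\<exists>N::nat. \<forall>a\<in>A. f a \<in> Ff (real N)"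
  using assms
proof (induction A rule: finite_induct)
  case (insert a A)
  then obtain N where "\<forall>a\<in>A. f a \<in> Ff (real N)" by auto
  moreover obtain M where "f a \<in> Ff (real M)" using Mot_Ff insert by blast
  ultimately have "\<forall>a\<in>insert a A. f a \<in> Ff (real (max N M))"
    using Ff_mono[of "real N" "real (max N M)"] Ff_mono[of "real M" "real (max N M)"] by auto
  then show ?case by blast
qed auto

lemma finite_Gf: assumes "finite A" "\<And>a. a \<in> A \<Longrightarrow> f a \<in> Mot" shows "\<exists>N::nat. \<forall>a\<in>A. f a \<in> Gf (real N)"
  using assms
proof (induction A rule: finite_induct)
  case (insert a A)
  then obtain N where "\<forall>a\<in>A. f a \<in> Gf (real N)" by auto
  moreover obtain M where "f a \<in> Gf (real M)" using Mot_Gf insert by blast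
  ultimately have "\<forall>a\<in>insert a A. f a \<in> Gf (real (max N M))"
    using Gf_mono[of _ "real N" "real (max N M)"] Gf_mono[of _ "real M" "real (max N M)"] by auto
  then show ?case by blast
qed auto

text \<open>The step is contained in the K-span of finitely many elements, and each of these lies in
  some step of the other filtration.\<close>

lemma Gf_sub_Ff: "\<exists>c'. Gf c \<subseteq> Ff c'"
proof -
  obtain N where N: "Gf c \<subseteq> Gf (real N)" using Gf_real_nat by blast
  have "\<exists>M::nat. \<forall>a\<in>{..<d} \<times> {..N}. (\<lambda>(j,n). Eb j n) a \<in> Ff (real M)"
    by (rule finite_Ff) (auto intro: Gf_Mot[OF Eb_Gf])
  then obtain M where M: "\<And>j n. j < d \<Longrightarrow> n \<le> N \<Longrightarrow> Eb j n \<in> Ff (real M)" by auto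
  have "m \<in> Ff (real M)" if "m \<in> Gf c" for m
  proof -
    have m: "m \<in> Gf (real N)" using that N by blast
    show ?thesis by (subst Gf_expand[OF m], rule Ff_sum) (auto intro!: Ff_ks M)
  qed
  then show ?thesis by blast
qed

lemma Ff_sub_Gf: "\<exists>c'. Ff c \<subseteq> Gf c'"
proof -
  obtain N where N: "Ff c \<subseteq> Ff (real N)" using Ff_real_nat by blast
  have "\<exists>M::nat. \<forall>a\<in>{..<r} \<times> {..N}. (\<lambda>(k,i). tp (bs k) i) a \<in> Gf (real M)"
    by (rule finite_Gf) (auto intro: tp_Mot bs_Mot)
  then obtain M where M: "\<And>k i. k < r \<Longrightarrow> i \<le> N \<Longrightarrow> tp (bs k) i \<in> Gf (real M)" by auto
  have "m \<in> Gf (real M)" if "m \<in> Ff c" for m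
  proof -
    have "m \<in> Ff (real N)" using that N by blast
    then obtain u where "m = (\<Sum>(k,i)\<in>{..<r} \<times> {..N}. ks (u k i) (tp (bs k) i))" using Ff_expand by blast
    also have "\<dots> \<in> Gf (real M)" by (rule Gf_sum) (auto intro!: Gf_ks M)
    finally show ?thesis .
  qed
  then show ?thesis by blast
qed

definition growthF :: "real \<Rightarrow> real \<Rightarrow> bool" where
  "growthF w C \<longleftrightarrow> (\<forall>n. \<forall>m\<in>Mot. \<forall>c. (m \<in> Ff c \<longrightarrow> taun n m \<in> Ff (c + w * real n + C)) \<and>
     (taun n m \<in> Ff (c + w * real n) \<longrightarrow> m \<in> Ff (c + C)))"

text \<open>The two degrees agree up to the factor s and a bounded error. This mediates between the
  growth of t in the degree in tau and the growth of tau in the degree in t.\<close>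

definition QM :: "real \<Rightarrow> real \<Rightarrow> bool" where
  "QM s C \<longleftrightarrow> (\<forall>c. Ff c \<subseteq> Gf (s * c + C) \<and> Gf (s * c) \<subseteq> Ff (c + C))"

text \<open>\<open>Ff c\<close> is spanned by the t^i b with i at most c, whose degree in tau is at
  most s c up to a constant; the other inclusion is \<open>filtration_compare\<close> for X =
  t.\<close>

lemma growthM_QM: assumes g: "growthM s C" and s: "s > 0" shows "\<exists>C. QM s C"
proof -
  have gup: "m \<in> Gf c \<Longrightarrow> tp m n \<in> Gf (c + s * real n + C)" for n m c
    using g Gf_Mot unfolding growthM_def by blast
  have glow: "m \<in> Mot \<Longrightarrow> tp m n \<in> Gf (c + s * real n) \<Longrightarrow> m \<in> Gf (c + C)" for n m c
    using g unfolding growthM_def by blast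
  have "\<exists>N::nat. \<forall>k\<in>{..<r}. bs k \<in> Gf (real N)" by (rule finite_Gf) (auto intro: bs_Mot)
  then obtain N where N: "\<And>k. k < r \<Longrightarrow> bs k \<in> Gf (real N)" by auto
  define C1 where "C1 = real N + \<bar>C\<bar>"
  have FG: "Ff c \<subseteq> Gf (s * c + C1)" for c
  proof
    fix m assume m: "m \<in> Ff c"
    show "m \<in> Gf (s * c + C1)"
    proof (cases "c < 0")
      case True
      then have "m = 0" using m Ff_neg by blast
      then show ?thesis using Gf_zero by simp
    next
      case False
      \<comment> \<open>Exponents are integers, so rounding c down does not change the step.\<close>
      define M where "M = nat \<lfloor>c\<rfloor>"
      have M: "real M \<le> c" using False unfolding M_def by linarith
      have M2: "real i > c" if "real i > real M" for i using that unfolding M_def by (rule nat_floor_less)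
      have "m \<in> Ff (real M)" using m M2 unfolding Ff_def by blast
      then obtain u where u: "m = (\<Sum>(k,i)\<in>{..<r} \<times> {..M}. ks (u k i) (tp (bs k) i))" using Ff_expand by blast
      show ?thesis unfolding u
      proof (rule Gf_sum)
        fix a assume "a \<in> {..<r} \<times> {..M}"
        then obtain k i where a: "a = (k, i)" and ki: "k \<in> {..<r}" "i \<in> {..M}" by blast
        from ki have "tp (bs k) i \<in> Gf (real N + s * real i + C)" using gup N by simp
        moreover have "s * real i \<le> s * c" using ki M s by (intro mult_left_mono) auto
        ultimately have "tp (bs k) i \<in> Gf (s * c + C1)" by (elim Gf_mono) (simp add: C1_def)
        then show "(case a of (k, i) \<Rightarrow> ks (u k i) (tp (bs k) i)) \<in> Gf (s * c + C1)"
          unfolding a by (simp add: Gf_ks)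
      qed
    qed
  qed
  have "\<exists>C2\<ge>0. \<forall>c. Gf (s * c) \<subseteq> Ff (c + C2)"
  proof -
    have XF: "tp m k \<in> Ff (c + real k)" if "m \<in> Ff c" for k m c using tp_Ff[OF Ff_Mot[OF that]] that by simp
    have Gm: "Gf c \<subseteq> Gf c'" if "c \<le> c'" for c c' using Gf_mono that by blast
    have Gn: "Gf c \<subseteq> {0}" if "c < 0" for c using Gf_neg that by blast
    have GM: "Gf c \<subseteq> Mot" for c using Gf_Mot by blast
    have C1: "C1 \<ge> 0" by (simp add: C1_def)
    show ?thesis
      by (rule filtration_compare[where F=Ff and G=Gf and M=Mot and X="\<lambda>k m. tp m k" and B=C1 and C=C and s=s,
          OF s C1 FG glow tp_split Gf_sub_Ff XF Ff_mono Gm Ff_add Gf_diff Gn Ff_zero GM])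
  qed
  then obtain C2 where C2: "C2 \<ge> 0" "\<And>c. Gf (s * c) \<subseteq> Ff (c + C2)" by blast
  have C1: "C1 \<ge> 0" by (simp add: C1_def)
  have "QM s (C1 + C2)"
    unfolding QM_def
  proof (intro allI conjI)
    show "Ff c \<subseteq> Gf (s * c + (C1 + C2))" for c using FG[of c] Gf_mono[of _ "s * c + C1" "s * c + (C1 + C2)"] C2(1) by auto
    show "Gf (s * c) \<subseteq> Ff (c + (C1 + C2))" for c using C2(2)[of c] Ff_mono[of "c + C2" "c + (C1 + C2)"] C1 by auto
  qed
  then show ?thesis by blast
qed

text \<open>The roles of t and tau are exchanged: the elements tau^n in the coordinates replace the
  t^i b.\<close>

lemma growthF_QM: assumes g: "growthF w C" and w: "w > 0" shows "\<exists>C. QM (1 / w) C"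
proof -
  have gup: "m \<in> Ff c \<Longrightarrow> taun n m \<in> Ff (c + w * real n + C)" for n m c
    using g Ff_Mot unfolding growthF_def by blast
  have glow: "m \<in> Mot \<Longrightarrow> taun n m \<in> Ff (c + w * real n) \<Longrightarrow> m \<in> Ff (c + C)" for n m c
    using g unfolding growthF_def by blast
  have "\<exists>N::nat. \<forall>j\<in>{..<d}. Eb j 0 \<in> Ff (real N)" by (rule finite_Ff) (auto intro: Gf_Mot[OF Eb_Gf])
  then obtain N where N: "\<And>j. j < d \<Longrightarrow> Eb j 0 \<in> Ff (real N)" by auto
  define C1 where "C1 = real N + \<bar>C\<bar>"
  have GF: "Gf c \<subseteq> Ff (w * c + C1)" for c
  proof
    fix m assume m: "m \<in> Gf c"
    show "m \<in> Ff (w * c + C1)"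
    proof (cases "c < 0")
      case True
      then have "m = 0" using m Gf_neg by blast
      then show ?thesis using Ff_zero by simp
    next
      case False
      define M where "M = nat \<lfloor>c\<rfloor>"
      have M: "real M \<le> c" using False unfolding M_def by linarith
      have M2: "real i > c" if "real i > real M" for i using that unfolding M_def by (rule nat_floor_less)
      have mM: "m \<in> Gf (real M)" using m M2 unfolding Gf_def by blast
      show ?thesis
      proof (subst Gf_expand[OF mM], rule Ff_sum)
        fix a assume "a \<in> {..<d} \<times> {..M}"
        then obtain j n where a: "a = (j, n)" and jn: "j \<in> {..<d}" "n \<in> {..M}" by blast
        from jn have "Eb j n \<in> Ff (real N + w * real n + C)" unfolding Eb_taun[of j n] using gup N by simp
        moreover have "w * real n \<le> w * c" using jn M w by (intro mult_left_mono) auto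
        then have "real N + w * real n + C \<le> w * c + C1" unfolding C1_def by linarith
        ultimately have "Eb j n \<in> Ff (w * c + C1)" using Ff_mono by blast
        then show "(case a of (j, n) \<Rightarrow> ks (m j n) (Eb j n)) \<in> Ff (w * c + C1)"
          unfolding a by (simp add: Ff_ks)
      qed
    qed
  qed
  have "\<exists>C2\<ge>0. \<forall>c. Ff (w * c) \<subseteq> Gf (c + C2)"
  proof -
    have XF: "taun k m \<in> Gf (c + real k)" if "m \<in> Gf c" for k m c using taun_Gf[OF Gf_Mot[OF that]] that by simp
    have Gm: "Gf c \<subseteq> Gf c'" if "c \<le> c'" for c c' using Gf_mono that by blast
    have GM: "Ff c \<subseteq> Mot" for c using Ff_Mot by blast
    have C1: "C1 \<ge> 0" by (simp add: C1_def)
    show ?thesis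
      by (rule filtration_compare[where F=Gf and G=Ff and M=Mot and X=taun and B=C1 and C=C and s=w,
          OF w C1 GF glow taun_split Ff_sub_Gf XF Gm Ff_mono Gf_add Ff_diff Ff_neg Gf_zero GM])
  qed
  then obtain C2 where C2: "C2 \<ge> 0" "\<And>c. Ff (w * c) \<subseteq> Gf (c + C2)" by blast
  have C1: "C1 \<ge> 0" by (simp add: C1_def)
  have "QM (1 / w) (C1 + C2)"
    unfolding QM_def
  proof (intro allI conjI)
    fix c
    have "Ff c \<subseteq> Gf (1 / w * c + C2)" using C2(2)[of "1 / w * c"] w by simp
    then show "Ff c \<subseteq> Gf (1 / w * c + (C1 + C2))"
      using Gf_mono[of _ "1 / w * c + C2" "1 / w * c + (C1 + C2)"] C1 by auto
    have "Gf (1 / w * c) \<subseteq> Ff (c + C1)" using GF[of "1 / w * c"] w by simp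
    then show "Gf (1 / w * c) \<subseteq> Ff (c + (C1 + C2))"
      using Ff_mono[of "c + C1" "c + (C1 + C2)"] C2(1) by auto
  qed
  then show ?thesis by blast
qed

lemma QM_D: assumes "QM s C" shows "m \<in> Ff c \<Longrightarrow> m \<in> Gf (s * c + C)" "m \<in> Gf (s * c) \<Longrightarrow> m \<in> Ff (c + C)"
  using assms unfolding QM_def by blast+

lemma QM_D2: assumes "QM s C" "s > 0" "m \<in> Gf c" shows "m \<in> Ff (c / s + C)"
  using QM_D(2)[OF assms(1), of m "c / s"] assms(2,3) by simp

text \<open>t^n acts exactly on \<open>Ff\<close>. The constant collects s C from entering that
  filtration and C from leaving it.\<close>

lemma QM_growthM: assumes Q: "QM s C" and s: "s > 0" shows "growthM s ((s + 1) * C)"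
  unfolding growthM_def
proof (intro allI ballI conjI impI)
  fix n m and c :: real assume m: "m \<in> Mot"
  show "tp m n \<in> Gf (c + s * real n + (s + 1) * C)" if "m \<in> Gf c"
  proof -
    have "m \<in> Ff (c / s + C)" by (rule QM_D2[OF Q s that])
    then have "tp m n \<in> Ff (c / s + C + real n)" by (simp add: tp_Ff[OF m])
    then have "tp m n \<in> Gf (s * (c / s + C + real n) + C)" by (rule QM_D(1)[OF Q])
    moreover have "s * (c / s + C + real n) + C = c + s * real n + (s + 1) * C"
      using s by (simp add: field_simps)
    ultimately show ?thesis by metis
  qed
  show "m \<in> Gf (c + (s + 1) * C)" if "tp m n \<in> Gf (c + s * real n)"
  proof -
    have "tp m n \<in> Ff ((c + s * real n) / s + C)" by (rule QM_D2[OF Q s that])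
    moreover have "(c + s * real n) / s + C = (c / s + C) + real n" using s by (simp add: field_simps)
    ultimately have "tp m n \<in> Ff ((c / s + C) + real n)" by metis
    then have "m \<in> Ff (c / s + C)" by (simp only: tp_Ff[OF m])
    then have "m \<in> Gf (s * (c / s + C) + C)" by (rule QM_D(1)[OF Q])
    moreover have "s * (c / s + C) + C = c + (s + 1) * C" using s by (simp add: field_simps)
    ultimately show ?thesis by metis
  qed
qed

text \<open>tau^n acts exactly on \<open>Gf\<close>. Passing to that filtration costs C, which the
  scaling back turns into C / s, and the return costs another C.\<close>

lemma QM_growthF: assumes Q: "QM s C" and s: "s > 0" shows "growthF (1 / s) (C / s + C)"
  unfolding growthF_def
proof (intro allI ballI conjI impI)
  fix n m and c :: real assume m: "m \<in> Mot"
  show "taun n m \<in> Ff (c + 1 / s * real n + (C / s + C))" if "m \<in> Ff c"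
  proof -
    have "m \<in> Gf (s * c + C)" by (rule QM_D(1)[OF Q that])
    then have "taun n m \<in> Gf (s * c + C + real n)" by (simp only: taun_Gf[OF m])
    then have "taun n m \<in> Ff ((s * c + C + real n) / s + C)" by (rule QM_D2[OF Q s])
    moreover have "(s * c + C + real n) / s + C = c + 1 / s * real n + (C / s + C)"
      using s by (simp add: field_simps)
    ultimately show ?thesis by metis
  qed
  show "m \<in> Ff (c + (C / s + C))" if "taun n m \<in> Ff (c + 1 / s * real n)"
  proof -
    have "taun n m \<in> Gf (s * (c + 1 / s * real n) + C)" by (rule QM_D(1)[OF Q that])
    moreover have "s * (c + 1 / s * real n) + C = (s * c + C) + real n" using s by (simp add: field_simps)
    ultimately have "taun n m \<in> Gf ((s * c + C) + real n)" by metis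
    then have "m \<in> Gf (s * c + C)" by (simp only: taun_Gf[OF m])
    then have "m \<in> Ff ((s * c + C) / s + C)" by (rule QM_D2[OF Q s])
    moreover have "(s * c + C) / s + C = c + (C / s + C)" using s by (simp add: field_simps)
    ultimately show ?thesis by metis
  qed
qed

section \<open>Counting dimensions\<close>

definition Tset :: "nat \<Rightarrow> 'k skvec set" where "Tset N = (\<lambda>(k,i). tp (bs k) i) ` ({..<r} \<times> {..N})"

lemma Tset_span: "Ff (real N) \<subseteq> kv.span (Tset N)"
proof
  fix m assume "m \<in> Ff (real N)"
  then obtain u where "m = (\<Sum>(k,i)\<in>{..<r} \<times> {..N}. ks (u k i) (tp (bs k) i))" using Ff_expand by blast
  also have "\<dots> \<in> kv.span (Tset N)"
    by (rule kv.span_sum) (auto simp: Tset_def intro!: kv.span_scale[OF kv.span_base])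
  finally show "m \<in> kv.span (Tset N)" .
qed

lemma Tset_sub: "Tset N \<subseteq> Ff (real N)"
proof -
  have "bs k \<in> Ff 0" if k: "k < r" for k
  proof -
    have "comb r (\<lambda>j. if j = k then 1 else 0) bs = (\<Sum>j<r. if j = k then bs k else 0)"
      unfolding comb_eq using kact_monom[of 0] by (intro sum.cong) (auto simp: kact_zero)
    then have "bs k = comb r (\<lambda>j. if j = k then 1 else 0) bs" using k by simp
    then show ?thesis using comb_Ff[of "\<lambda>j. if j = k then 1 else 0" 0] by simp
  qed
  then have "tp (bs k) i \<in> Ff (0 + real i)" if "k < r" for k i using tp_Ff[OF bs_Mot[OF that]] that by blast
  then have "tp (bs k) i \<in> Ff (real N)" if "k < r" "i \<le> N" for k i
    using Ff_mono[of "0 + real i" "real N"] that by auto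
  then show ?thesis by (auto simp: Tset_def)
qed

lemma Tset_indep: "kv.independent (Tset N)" "card (Tset N) = r * (N + 1)"
proof -
  let ?A = "{..<r} \<times> {..N}"
  have z: "\<forall>a\<in>?A. u a = 0" if su: "(\<Sum>a\<in>?A. ks (u a) ((\<lambda>(k,i). tp (bs k) i) a)) = 0" for u
  proof
    fix a assume a: "a \<in> ?A"
    define ps where "ps k = (\<Sum>i\<le>N. monom (u (k,i)) i)" for k
    have cps: "coeff (ps k) i = (if i \<le> N then u (k,i) else 0)" for k i by (simp add: ps_def coeff_sum)
    have "kact (ps k) (bs k) = (\<Sum>i\<le>N. ks (u (k,i)) (tp (bs k) i))" for k
    proof -
      have "degree (ps k) \<le> N" by (intro degree_le) (auto simp: cps)
      then have "degree (ps k) < Suc N" by simp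
      then have "kact (ps k) (bs k) = (\<Sum>i<Suc N. ks (coeff (ps k) i) (tp (bs k) i))" by (rule kact_eq)
      then show ?thesis by (simp add: cps lessThan_Suc_atMost)
    qed
    then have "comb r ps bs = (\<Sum>k<r. \<Sum>i\<le>N. ks (u (k,i)) (tp (bs k) i))" unfolding comb_eq by simp
    also have "\<dots> = (\<Sum>a\<in>?A. ks (u a) ((\<lambda>(k,i). tp (bs k) i) a))"
      by (simp add: sum.cartesian_product case_prod_beta)
    finally have "comb r ps bs = 0" using su by simp
    then have "\<forall>k<r. ps k = 0" using basis unfolding kt_basis_def zero_fun_def by blast
    then show "u a = 0" using a cps[of "fst a" "snd a"] by auto
  qed
  show "kv.independent (Tset N)" unfolding Tset_def by (rule kv.indep_family(2)) (simp, rule z)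
  have "inj_on (\<lambda>(k,i). tp (bs k) i) ?A" by (rule kv.indep_family(1)) (simp, rule z)
  then show "card (Tset N) = r * (N + 1)" unfolding Tset_def by (simp add: card_image)
qed

lemma archimedean_le: assumes "\<And>N::nat. real N * a \<le> real N * b + c" shows "a \<le> (b::real)"
proof (rule ccontr)
  assume "\<not> a \<le> b"
  then have "a - b > 0" by simp
  then obtain N where "c < real N * (a - b)" using reals_Archimedean3 by blast
  then show False using assms[of N] by (simp add: algebra_simps)
qed

text \<open>Over K the steps \<open>Ff N\<close> and \<open>Gf M\<close> have the dimensions r (N +
  1) and d (M + 1). Each inclusion in \<open>QM\<close> gives one of the inequalities as N
  grows.\<close>

lemma rank_eq: assumes Q: "QM s C" and s: "s > 0" shows "real r = s * real d"
proof (rule antisym)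
  show "real r \<le> s * real d"
  proof (rule archimedean_le)
    fix N :: nat
    define M where "M = nat \<lceil>s * real N + C\<rceil>"
    have "0 \<le> s * real N" using s by simp
    then have M: "s * real N + C \<le> real M" "real M \<le> s * real N + \<bar>C\<bar> + 1" unfolding M_def by linarith+
    have "Tset N \<subseteq> Gf (real M)" using Tset_sub QM_D(1)[OF Q] Gf_mono M(1) by blast
    then have "Tset N \<subseteq> kv.span (Eset M)" using Gf_span by blast
    then have "card (Tset N) \<le> card (Eset M)"
      using kv.independent_span_bound[OF Eset_card(1) Tset_indep(1)] by blast
    then have "r * (N + 1) \<le> d * (M + 1)" by (simp only: Tset_indep(2) Eset_indep(2))
    then have "real r * (real N + 1) \<le> real d * (real M + 1)"
      by (metis of_nat_1 of_nat_add of_nat_le_iff of_nat_mult)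
    also have "\<dots> \<le> real d * (s * real N + \<bar>C\<bar> + 1 + 1)" using M(2) by (intro mult_left_mono) auto
    finally show "real N * real r \<le> real N * (s * real d) + real d * (\<bar>C\<bar> + 2)"
      by (simp add: algebra_simps)
  qed
  show "s * real d \<le> real r"
  proof (rule archimedean_le)
    fix N :: nat
    define M where "M = nat \<lceil>real N / s + C\<rceil>"
    have "0 \<le> real N / s" using s by simp
    then have M: "real N / s + C \<le> real M" "real M \<le> real N / s + \<bar>C\<bar> + 1" unfolding M_def by linarith+
    have "Eset N \<subseteq> Gf (real N)" by (auto simp: Eset_def intro: Gf_mono[OF Eb_Gf])
    then have "Eset N \<subseteq> Ff (real M)" using QM_D2[OF Q s] Ff_mono[OF M(1)] by blast
    then have "Eset N \<subseteq> kv.span (Tset M)" using Tset_span by blast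
    then have "card (Eset N) \<le> card (Tset M)"
      using kv.independent_span_bound[OF _ Eset_indep(1), of "Tset M" N] by (auto simp: Tset_def)
    then have "d * (N + 1) \<le> r * (M + 1)" by (simp only: Tset_indep(2) Eset_indep(2))
    then have "real d * (real N + 1) \<le> real r * (real M + 1)"
      by (metis of_nat_1 of_nat_add of_nat_le_iff of_nat_mult)
    also have "\<dots> \<le> real r * (real N / s + \<bar>C\<bar> + 1 + 1)" using M(2) by (intro mult_left_mono) auto
    finally have "s * (real d * (real N + 1)) \<le> s * (real r * (real N / s + \<bar>C\<bar> + 1 + 1))"
      using s by (intro mult_left_mono) auto
    also have "\<dots> = real N * real r + s * real r * (\<bar>C\<bar> + 2)" using s by (simp add: field_simps)
    finally have "s * (real d * (real N + 1)) \<le> real N * real r + s * real r * (\<bar>C\<bar> + 2)" .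
    moreover have "real N * (s * real d) \<le> s * (real d * (real N + 1))" using s by (simp add: algebra_simps)
    ultimately show "real N * (s * real d) \<le> real N * real r + s * real r * (\<bar>C\<bar> + 2)" by linarith
  qed
qed

end

context tmod begin

text \<open>Every basis has s d elements, so the definite description in \<open>motive_rank\<close>
  is unambiguous.\<close>

lemma motive_rank_eq:
  assumes "kt_basis q d D r bs" "growthM s C" "s > 0"
  shows "motive_rank q d D = r" "real r = s * real d"
proof -
  have *: "real r' = s * real d" if "kt_basis q d D r' bs'" for r' bs'
  proof -
    interpret tbasis q K d D r' bs' by unfold_locales (rule that)
    obtain C' where "QM s C'" using growthM_QM[OF assms(2,3)] by blast
    then show ?thesis by (rule rank_eq) (rule assms(3))
  qed
  show "real r = s * real d" by (rule *[OF assms(1)])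
  show "motive_rank q d D = r" unfolding motive_rank_def
  proof (rule the_equality)
    show "\<exists>bs. kt_basis q d D r bs" using assms(1) by blast
    show "r' = r" if "\<exists>bs. kt_basis q d D r' bs" for r' using * that assms(1) by (metis of_nat_eq_iff)
  qed
qed

end

section \<open>The operator tau on vectors of Laurent series in 1/t\<close>

context skew begin

lemma frob_nth: "fls_frob q f $$ n = (f $$ n :: 'k) ^ q"
  unfolding fls_frob_def by (rule nth_Abs_fls_lower_bound[where N="fls_subdegree f"]) (simp add: power_0_left)

lemma frob_zero [simp]: "fls_frob q (0 :: 'k fls) = 0"
  by (rule fls_eqI) (simp add: frob_nth power_0_left)
lemma frob_plus: "fls_frob q (f + g :: 'k fls) = fls_frob q f + fls_frob q g"
  by (rule fls_eqI) (simp add: frob_nth frob_add)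
lemma frob_shift: "fls_frob q (fls_shift n f :: 'k fls) = fls_shift n (fls_frob q f)"
  by (rule fls_eqI) (simp add: frob_nth)

lemma frob_eq_0 [simp]: "fls_frob q (f :: 'k fls) = 0 \<longleftrightarrow> f = 0"
proof
  assume f: "fls_frob q f = 0"
  show "f = 0"
  proof (rule fls_eqI)
    fix n
    have "fls_frob q f $$ n = 0" using f by simp
    then show "f $$ n = 0 $$ n" by (simp add: frob_nth)
  qed
qed simp

lemma frob_subdegree: "fls_subdegree (fls_frob q f :: 'k fls) = fls_subdegree f"
proof (cases "f = 0")
  case False
  then show ?thesis by (intro fls_subdegree_eqI) (auto simp: frob_nth power_0_left)
qed simp

lemma power_q_sum: "(sum f A :: 'k) ^ q = (\<Sum>i\<in>A. f i ^ q)"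
  by (induction A rule: infinite_finite_induct) (auto simp: power_0_left frob_add)

lemma frob_times: "fls_frob q (f * g :: 'k fls) = fls_frob q f * fls_frob q g"
  by (rule fls_eqI)
    (simp add: frob_nth fls_times_nth(2) frob_subdegree power_q_sum power_mult_distrib)

text \<open>Perfectness of K, applied to each coefficient.\<close>

lemma fls_frob_surj: "\<exists>f. fls_frob q f = (g :: 'k fls)"
proof -
  have "Abs_fls (\<lambda>n. invfrob q (g $$ n)) $$ n = invfrob q (g $$ n)" for n
    using invfrob_of_pow[of 0] by (intro nth_Abs_fls_lower_bound[where N="fls_subdegree g"]) (simp add: power_0_left)
  then have "fls_frob q (Abs_fls (\<lambda>n. invfrob q (g $$ n))) = g"
    by (intro fls_eqI) (simp add: frob_nth)
  then show ?thesis by blast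
qed

lemma vge_times: assumes "vge f a" "vge g b" shows "vge (f * g) (a + b)"
  unfolding vge_def
proof (intro allI impI)
  fix n :: int assume n: "real_of_int n < a + b"
  have "f $$ i * g $$ (n - i) = 0" for i
    using assms n unfolding vge_def by (cases "real_of_int i < a") auto
  then show "(f * g) $$ n = 0" unfolding fls_times_nth(2) by (intro sum.neutral) blast
qed

lemma vge_frob: "vge f c \<Longrightarrow> vge (fls_frob q f) c"
  by (simp add: vge_def frob_nth power_0_left)

lemma vge_shift: "vge (fls_shift n f) c \<longleftrightarrow> vge f (c + real_of_int n)"
proof
  assume A: "vge (fls_shift n f) c"
  show "vge f (c + real_of_int n)" unfolding vge_def
  proof (intro allI impI)
    fix k assume "real_of_int k < c + real_of_int n"
    then have "real_of_int (k - n) < c" by simp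
    then have "fls_shift n f $$ (k - n) = 0" using A unfolding vge_def by blast
    then show "f $$ k = 0" by simp
  qed
qed (simp add: vge_def)

lemma vge_pows: "vge f 0 \<longleftrightarrow> f \<in> pows_ring"
  by (cases "f = 0") (auto simp: vge_iff pows_ring_def)

section \<open>Polynomials inside K((1/t))\<close>

lemma kt_nth: "kt_to_fls (p :: 'k poly) $$ n = (if n \<le> 0 then coeff p (nat (- n)) else 0)"
proof -
  have "kt_to_fls p $$ n = (\<Sum>k\<le>degree p. if k = nat (- n) \<and> n \<le> 0 then coeff p k else 0)"
    unfolding kt_to_fls_def fls_nth_sum by (intro sum.cong) auto
  then show ?thesis by (auto simp: coeff_eq_0 if_distrib)
qed

lemma kt_add: "kt_to_fls (p + p' :: 'k poly) = kt_to_fls p + kt_to_fls p'"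
  by (rule fls_eqI) (simp add: kt_nth)
lemma kt_zero [simp]: "kt_to_fls (0 :: 'k poly) = 0"
  by (rule fls_eqI) (simp add: kt_nth)
lemma kt_sum: "kt_to_fls (sum f A :: 'k poly) = (\<Sum>i\<in>A. kt_to_fls (f i))"
  using sum_comp_morphism[of kt_to_fls f A] by (simp add: o_def kt_add)
lemma kt_smult: "kt_to_fls (smult c p :: 'k poly) = fls_const c * kt_to_fls p"
  by (rule fls_eqI) (simp add: kt_nth)

lemma kt_pCons: "kt_to_fls (pCons a p :: 'k poly) = fls_const a + fls_X_inv * kt_to_fls p"
proof (rule fls_eqI)
  fix n
  show "kt_to_fls (pCons a p) $$ n = (fls_const a + fls_X_inv * kt_to_fls p) $$ n"
  proof (cases "n < 0")
    case True
    then have "nat (- n) = Suc (nat (- (n + 1)))" by simp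
    then show ?thesis using True by (simp add: kt_nth fls_X_inv_times_conv_shift)
  qed (simp add: kt_nth fls_X_inv_times_conv_shift)
qed

lemma kt_times: "kt_to_fls (p * p' :: 'k poly) = kt_to_fls p * kt_to_fls p'"
proof (induction p)
  case (pCons a p)
  then show ?case by (simp add: kt_add kt_smult kt_pCons algebra_simps)
qed simp

lemma kt_eq_0 [simp]: "kt_to_fls (p :: 'k poly) = 0 \<longleftrightarrow> p = 0"
proof
  assume p: "kt_to_fls p = 0"
  show "p = 0"
  proof (rule poly_eqI)
    fix n
    have "kt_to_fls p $$ (- int n) = 0" using p by simp
    then show "coeff p n = coeff 0 n" by (simp add: kt_nth)
  qed
qed simp

abbreviation fpoly :: "'k poly \<Rightarrow> 'k poly" where "fpoly \<equiv> map_poly (\<lambda>x. x ^ q)"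

lemma coeff_fpoly: "coeff (fpoly p) n = coeff p n ^ q"
  by (rule coeff_map_poly) (simp add: power_0_left)

lemma frob_kt: "fls_frob q (kt_to_fls p) = kt_to_fls (fpoly p)"
  by (rule fls_eqI) (simp add: frob_nth kt_nth coeff_fpoly power_0_left)

lemma vge_kt_iff: "vge (kt_to_fls (p :: 'k poly)) (- c) \<longleftrightarrow> (\<forall>i. real i > c \<longrightarrow> coeff p i = 0)"
proof
  assume A: "vge (kt_to_fls p) (- c)"
  show "\<forall>i. real i > c \<longrightarrow> coeff p i = 0"
  proof (intro allI impI)
    fix i assume "real i > c"
    then have "kt_to_fls p $$ (- int i) = 0" using A unfolding vge_def by simp
    then show "coeff p i = 0" by (simp add: kt_nth)
  qed
qed (auto simp: vge_def kt_nth)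

lemma kt_approx: "\<exists>p. vge (f - kt_to_fls p) 1"
proof -
  define M where "M = nat (- fls_subdegree f)"
  define p where "p = (\<Sum>i\<le>M. monom (f $$ (- int i)) i)"
  have p: "coeff p i = (if i \<le> M then f $$ (- int i) else 0)" for i by (simp add: p_def coeff_sum)
  have "coeff p i = f $$ (- int i)" for i
  proof (cases "i \<le> M")
    case False
    then have "- int i < fls_subdegree f" by (simp add: M_def)
    then show ?thesis using False by (simp add: p)
  qed (simp add: p)
  then have "vge (f - kt_to_fls p) 1" by (simp add: vge_def kt_nth)
  then show ?thesis by blast
qed

end

locale tfls = tbasis q K d D r bs for q and K :: "'k::field itself" and d and D :: "'k skmat" and r bs +
  fixes A :: "nat \<Rightarrow> nat \<Rightarrow> 'k poly"
  assumes tauA: "\<And>k. k < r \<Longrightarrow> tau_act q (bs k) = comb r (A k) bs"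
begin

abbreviation Fl :: "(nat \<Rightarrow> 'k fls) set" where "Fl \<equiv> flvec_space r"
abbreviation T :: "(nat \<Rightarrow> 'k fls) \<Rightarrow> nat \<Rightarrow> 'k fls" where "T \<equiv> tau_fl q r A"

definition csm :: "'k fls \<Rightarrow> (nat \<Rightarrow> 'k fls) \<Rightarrow> nat \<Rightarrow> 'k fls" where "csm c x = (\<lambda>i. c * x i)"

lemma csm_nth: "csm c x i = c * x i" by (simp add: csm_def)

sublocale lv: vector_space csm
  by unfold_locales (auto simp: csm_def fun_eq_iff algebra_simps)

text \<open>Multiplication by t^a for an integer a, written as a shift in the variable 1/t.\<close>

definition shv :: "int \<Rightarrow> (nat \<Rightarrow> 'k fls) \<Rightarrow> nat \<Rightarrow> 'k fls" where "shv a x = (\<lambda>i. fls_shift a (x i))"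

lemma lv_subspace_Fl: "lv.subspace Fl"
  by (rule lv.subspaceI) (auto simp: flvec_space_def csm_def)

lemmas Fl_zero = lv.subspace_0[OF lv_subspace_Fl]
  and Fl_add = lv.subspace_add[OF lv_subspace_Fl]
  and Fl_diff = lv.subspace_diff[OF lv_subspace_Fl]
  and Fl_csm = lv.subspace_scale[OF lv_subspace_Fl]
  and Fl_sum = lv.subspace_sum[OF lv_subspace_Fl]

lemma Fl_shv: "x \<in> Fl \<Longrightarrow> shv a x \<in> Fl" by (simp add: flvec_space_def shv_def)

lemma shv_shv: "shv a (shv b x) = shv (a + b) x" by (simp add: shv_def add.commute)
lemma shv_0 [simp]: "shv 0 x = x" by (simp add: shv_def)
lemma shv_vvge: "vvge (shv a x) c \<longleftrightarrow> vvge x (c + real_of_int a)"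
  by (simp add: vvge_def shv_def vge_shift)
lemma X_inv_shv: "(\<lambda>x i. fls_X_inv ^ u * x i) = shv (int u)"
  by (simp add: shv_def fun_eq_iff fls_X_inv_power_times_conv_shift)

lemma T_Fl: "T x \<in> Fl" by (simp add: flvec_space_def tau_fl_def)

lemma T_add: "T (x + y) = T x + T y"
  by (rule ext) (simp add: tau_fl_def frob_plus sum.distrib algebra_simps)
lemma T_zero: "T 0 = 0" by (rule ext) (simp add: tau_fl_def)
lemma T_csm: "T (csm c x) = csm (fls_frob q c) (T x)"
  by (rule ext) (simp add: tau_fl_def csm_def frob_times sum_distrib_left mult.assoc)
lemma T_sum: "T (sum f S) = (\<Sum>i\<in>S. T (f i))"
  using sum_comp_morphism[of T f S] by (simp add: o_def T_add T_zero)
lemma T_shv: "T (shv a x) = shv a (T x)"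
proof
  fix l
  have "fls_shift a (\<Sum>k<r. f k) = (\<Sum>k<r. fls_shift a (f k))" for f :: "nat \<Rightarrow> 'k fls"
    by (rule fls_eqI) (simp add: fls_nth_sum)
  then show "T (shv a x) l = shv a (T x) l"
    by (simp add: tau_fl_def shv_def frob_shift fls_shifted_times_simps)
qed

lemma T_vvge: "\<exists>e\<ge>0. \<forall>x c. vvge x c \<longrightarrow> vvge (T x) (c - e)"
proof -
  define e where "e = real (\<Sum>k<r. \<Sum>l<r. degree (A k l))"
  have "vvge (T x) (c - e)" if x: "vvge x c" for x c
    unfolding vvge_def
  proof
    fix l
    show "vge (T x l) (c - e)"
    proof (cases "l < r")
      case True
      have "vge (fls_frob q (x k) * kt_to_fls (A k l)) (c - e)" if k: "k < r" for k
      proof -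
        have "degree (A k l) \<le> (\<Sum>l<r. degree (A k l))" using True by (intro member_le_sum) auto
        also have "\<dots> \<le> (\<Sum>k<r. \<Sum>l<r. degree (A k l))"
          by (rule member_le_sum[where f="\<lambda>k. \<Sum>l<r. degree (A k l)"]) (use k in auto)
        finally have "real (degree (A k l)) \<le> e" unfolding e_def by (rule of_nat_mono)
        then have "vge (kt_to_fls (A k l)) (- e)" unfolding vge_kt_iff by (auto intro!: coeff_eq_0)
        then have "vge (fls_frob q (x k) * kt_to_fls (A k l)) (c + - e)"
          using x by (intro vge_times vge_frob) (auto simp: vvge_def)
        then show ?thesis by simp
      qed
      then show ?thesis using True by (auto simp: tau_fl_def intro!: vge_sum)
    qed (simp add: tau_fl_def)
  qed
  then show ?thesis by (intro exI[of _ e]) (simp add: e_def sum_nonneg)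
qed

abbreviation Tn :: "nat \<Rightarrow> (nat \<Rightarrow> 'k fls) \<Rightarrow> nat \<Rightarrow> 'k fls" where "Tn n \<equiv> T ^^ n"

lemma Tn_add: "Tn n (x + y) = Tn n x + Tn n y"
  by (induction n) (simp_all only: funpow.simps id_apply o_apply T_add)
lemma Tn_shv: "Tn n (shv a x) = shv a (Tn n x)"
  by (induction n) (simp_all only: funpow.simps id_apply o_apply T_shv)
lemma Tn_Tn: "Tn m (Tn n x) = Tn (m + n) x" by (simp add: funpow_add)
lemma Tn_Fl: "x \<in> Fl \<Longrightarrow> Tn n x \<in> Fl"
  by (cases n) (simp_all add: T_Fl)
text \<open>The new scalar is the n-fold Frobenius twist of c; the existential form keeps only that
  integrality is preserved.\<close>

lemma Tn_csm: "\<exists>c'. (vge c 0 \<longrightarrow> vge c' 0) \<and> Tn n (csm c x) = csm c' (Tn n x)"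
proof (induction n)
  case (Suc n)
  then obtain c' where c': "vge c 0 \<longrightarrow> vge c' 0" "Tn n (csm c x) = csm c' (Tn n x)" by blast
  then show ?case using vge_frob[of c' 0] by (intro exI[of _ "fls_frob q c'"]) (simp add: T_csm)
qed auto

lemma Tn_vvge: "\<exists>e\<ge>0. \<forall>n x c. vvge x c \<longrightarrow> vvge (Tn n x) (c - real n * e)"
proof -
  obtain e where e: "e \<ge> 0" "\<And>x c. vvge x c \<Longrightarrow> vvge (T x) (c - e)" using T_vvge by blast
  have "vvge (Tn n x) (c - real n * e)" if "vvge x c" for n x c
  proof (induction n)
    case (Suc n)
    have "vvge (T (Tn n x)) (c - real n * e - e)" by (rule e(2)[OF Suc])
    then show ?case by (simp add: algebra_simps)
  qed (simp add: that)
  then show ?thesis using e(1) by blast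
qed

text \<open>The coordinates of an element of M as a vector over K((1/t)); \<open>tps\<close> is tau
  in these coordinates.\<close>

definition kap :: "(nat \<Rightarrow> 'k poly) \<Rightarrow> nat \<Rightarrow> 'k fls" where
  "kap ps = (\<lambda>k. if k < r then kt_to_fls (ps k) else 0)"
definition tps :: "(nat \<Rightarrow> 'k poly) \<Rightarrow> nat \<Rightarrow> 'k poly" where
  "tps ps = (\<lambda>l. \<Sum>k<r. fpoly (ps k) * A k l)"

lemma kap_Fl: "kap ps \<in> Fl" by (simp add: kap_def flvec_space_def)

lemma T_kap: "T (kap ps) = kap (tps ps)"
  by (rule ext) (simp add: tau_fl_def kap_def tps_def frob_kt kt_sum kt_times)

lemma tau_add: "tau_act q (m + m') = tau_act q m + tau_act q (m' :: 'k skvec)"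
  by (intro ext) (simp add: tau_act_nth frob_add)
lemma tau_zero: "tau_act q 0 = (0 :: 'k skvec)"
  by (intro ext) (simp add: tau_act_nth power_0_left)
lemma tau_sum: "tau_act q (sum f S) = (\<Sum>i\<in>S. tau_act q (f i) :: 'k skvec)"
  using sum_comp_morphism[of "tau_act q" f S] by (simp add: o_def tau_add tau_zero)
lemma tau_ks: "tau_act q (ks c m) = ks (c ^ q) (tau_act q m)"
  by (intro ext) (simp add: tau_act_nth ks_nth power_mult_distrib)
lemma tau_tp: "m \<in> Mot \<Longrightarrow> tau_act q (tp m n) = tp (tau_act q m) n"
  by (induction n) (simp_all add: tau_tact tp_Mot)

lemma tau_kact: assumes "m \<in> Mot" shows "tau_act q (kact p m) = kact (fpoly p) (tau_act q m)"
proof -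
  have "degree (fpoly p) \<le> degree p" by (rule degree_le) (simp add: coeff_fpoly coeff_eq_0 power_0_left)
  then have "degree (fpoly p) < Suc (degree p)" by simp
  then have 1: "kact (fpoly p) (tau_act q m) = (\<Sum>k<Suc (degree p). ks (coeff p k ^ q) (tp (tau_act q m) k))"
    by (simp only: kact_eq coeff_fpoly)
  show ?thesis unfolding 1 kact_eq[of p "Suc (degree p)" m, OF lessI] tau_sum tau_ks tau_tp[OF assms] ..
qed

lemma kact_sum_left: "kact (sum f S) m = (\<Sum>i\<in>S. kact (f i) m)"
  using sum_comp_morphism[of "\<lambda>p. kact p m" f S] by (simp add: o_def kact_add_left kact_zero)
lemma kact_sum_right: "kact p (sum f S) = (\<Sum>i\<in>S. kact p (f i))"
  using sum_comp_morphism[of "kact p" f S] by (simp add: o_def kact_add_right kact_zero)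

lemma tau_comb: "tau_act q (comb r ps bs) = comb r (tps ps) bs"
proof -
  have "tau_act q (comb r ps bs) = (\<Sum>k<r. kact (fpoly (ps k)) (comb r (A k) bs))"
    unfolding comb_eq[of r ps] tau_sum by (rule sum.cong) (simp_all add: tau_kact bs_Mot tauA)
  also have "\<dots> = (\<Sum>k<r. \<Sum>l<r. kact (fpoly (ps k) * A k l) (bs l))"
    unfolding comb_eq kact_sum_right kact_mult ..
  also have "\<dots> = comb r (tps ps) bs"
    unfolding comb_eq tps_def kact_sum_left by (rule sum.swap)
  finally show ?thesis .
qed

lemma taun_comb: "taun n (comb r ps bs) = comb r ((tps ^^ n) ps) bs"
  by (induction n) (simp_all add: taun_Suc tau_comb)

lemma Tn_kap: "Tn n (kap ps) = kap ((tps ^^ n) ps)"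
  by (induction n) (simp_all add: T_kap)

lemma comb_Ff_kap: "comb r ps bs \<in> Ff c \<longleftrightarrow> vvge (kap ps) (- c)"
proof -
  have "vvge (kap ps) (- c) \<longleftrightarrow> (\<forall>k<r. vge (kt_to_fls (ps k)) (- c))"
    by (auto simp: vvge_def kap_def)
  then show ?thesis by (simp add: comb_Ff vge_kt_iff)
qed

definition growthT :: "real \<Rightarrow> real \<Rightarrow> bool" where
  "growthT w C \<longleftrightarrow> (\<forall>n. \<forall>x\<in>Fl. \<forall>c. (vvge x c \<longrightarrow> vvge (Tn n x) (c - w * real n - C)) \<and>
     (vvge (Tn n x) (c - w * real n) \<longrightarrow> vvge x (c - C)))"

lemma growthT_F: assumes g: "growthT w C" shows "growthF w C"
  unfolding growthF_def
proof (intro allI ballI)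
  fix n m c assume "m \<in> Mot"
  then obtain ps where m: "m = comb r ps bs" using comb_ex by blast
  have "(vvge (kap ps) (- c) \<longrightarrow> vvge (Tn n (kap ps)) (- c - w * real n - C)) \<and>
     (vvge (Tn n (kap ps)) (- c - w * real n) \<longrightarrow> vvge (kap ps) (- c - C))"
    using g kap_Fl unfolding growthT_def by blast
  moreover have "- c - w * real n - C = - (c + w * real n + C)" "- c - w * real n = - (c + w * real n)"
    "- c - C = - (c + C)" by simp_all
  ultimately show "(m \<in> Ff c \<longrightarrow> taun n m \<in> Ff (c + w * real n + C)) \<and>
     (taun n m \<in> Ff (c + w * real n) \<longrightarrow> m \<in> Ff (c + C))"
    unfolding m taun_comb comb_Ff_kap Tn_kap by metis
qed

lemma kap_approx: assumes "x \<in> Fl" shows "\<exists>ps. vvge (x - kap ps) 1"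
proof -
  have "\<forall>k. \<exists>p. vge (x k - kt_to_fls p) 1" using kt_approx by blast
  then obtain ps where "\<And>k. vge (x k - kt_to_fls (ps k)) 1" by metis
  then have "vvge (x - kap ps) 1" using assms by (auto simp: vvge_def kap_def flvec_space_def)
  then show ?thesis by blast
qed

text \<open>The approximation argument of \<open>growthM_V\<close>, now with t^N, which commutes
  with tau and shifts orders of pole exactly: t^N x differs from the coordinates of an element of M
  by order at least 1.\<close>

lemma growthF_T: assumes g: "growthF w C" shows "growthT w C"
  unfolding growthT_def
proof (intro allI ballI)
  fix n x c assume x: "x \<in> Fl"
  obtain e where e: "\<And>n x c. vvge x c \<Longrightarrow> vvge (Tn n x) (c - real n * e)" using Tn_vvge by blast
  define N where "N = nat \<lceil>\<bar>c\<bar> + \<bar>C\<bar> + \<bar>w * real n\<bar> + \<bar>real n * e\<bar>\<rceil>"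
  have N: "real N \<ge> \<bar>c\<bar> + \<bar>C\<bar> + \<bar>w * real n\<bar> + \<bar>real n * e\<bar>" unfolding N_def by linarith
  define y where "y = shv (int N) x"
  obtain ps where z: "vvge (y - kap ps) 1" using kap_approx[OF Fl_shv[OF x]] unfolding y_def by blast
  define z where "z = y - kap ps"
  have z: "vvge z 1" using z by (simp add: z_def)
  have z': "vvge (Tn n z) (1 - real n * e)" by (rule e[OF z])
  have yz: "y = kap ps + z" by (simp add: z_def)
  define m where "m = comb r ps bs"
  have m: "m \<in> Mot" unfolding m_def by (rule comb_Mot)
  have Dyz: "shv (int N) (Tn n x) = Tn n (kap ps) + Tn n z"
    unfolding Tn_shv[symmetric] y_def[symmetric] yz Tn_add ..
  have mF: "m \<in> Ff b \<longleftrightarrow> vvge (kap ps) (- b)" "taun n m \<in> Ff b \<longleftrightarrow> vvge (Tn n (kap ps)) (- b)" for b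
    unfolding m_def taun_comb Tn_kap comb_Ff_kap by simp_all
  have gm: "vvge (kap ps) (- b) \<Longrightarrow> vvge (Tn n (kap ps)) (- (b + w * real n + C))"
    "vvge (Tn n (kap ps)) (- (b + w * real n)) \<Longrightarrow> vvge (kap ps) (- (b + C))" for b
    using g m mF unfolding growthF_def by blast+
  show "(vvge x c \<longrightarrow> vvge (Tn n x) (c - w * real n - C)) \<and> (vvge (Tn n x) (c - w * real n) \<longrightarrow> vvge x (c - C))"
  proof (intro conjI impI)
    assume "vvge x c"
    then have "vvge y (c - real N)" by (simp add: y_def shv_vvge)
    then have "vvge (y - z) (c - real N)" by (intro vvge_diff vvge_mono[OF z]) (use N in auto)
    then have "vvge (kap ps) (- (real N - c))" by (simp add: yz)
    then have "vvge (Tn n (kap ps)) (- (real N - c + w * real n + C))" by (rule gm(1))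
    then have "vvge (Tn n (kap ps) + Tn n z) (c - w * real n - C - real N)"
      by (intro vvge_add vvge_mono[OF z']) (use N in \<open>auto simp: algebra_simps abs_if split: if_splits\<close>)
    then show "vvge (Tn n x) (c - w * real n - C)" unfolding Dyz[symmetric] shv_vvge by simp
  next
    assume "vvge (Tn n x) (c - w * real n)"
    then have "vvge (shv (int N) (Tn n x)) (c - w * real n - real N)" by (simp add: shv_vvge)
    then have "vvge (shv (int N) (Tn n x) - Tn n z) (c - w * real n - real N)"
      by (intro vvge_diff vvge_mono[OF z']) (use N in \<open>auto simp: algebra_simps abs_if split: if_splits\<close>)
    then have "vvge (Tn n (kap ps)) (c - w * real n - real N)" by (simp add: Dyz)
    moreover have "c - w * real n - real N = - ((real N - c) + w * real n)" by simp
    ultimately have "vvge (Tn n (kap ps)) (- ((real N - c) + w * real n))" by metis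
    then have "vvge (kap ps) (- (real N - c + C))" by (rule gm(2))
    then have "vvge (kap ps + z) (c - C - real N)"
      by (intro vvge_add vvge_mono[OF z]) (use N in \<open>auto elim: vvge_mono\<close>)
    then show "vvge x (c - C)" unfolding yz[symmetric] y_def shv_vvge by simp
  qed
qed

end

lemma sum_lessThan_add: "sum f {..<a + b :: nat} = sum f {..<a} + (\<Sum>j<b. f (a + j) :: 'x :: comm_monoid_add)"
  by (induction b) (simp_all add: add.assoc)

context tmod begin

text \<open>The coefficients of the preimage are q-th roots, which exist because K is
  perfect.\<close>

lemma tau_image:
  assumes m: "m \<in> Mot" and m0: "\<And>j. m j 0 = 0" shows "\<exists>m'\<in>Mot. m = tau_act q m'"
proof -
  define m' where "m' = (\<lambda>j n. invfrob q (m j (Suc n)))"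
  have 0: "invfrob q 0 = (0 :: 'k)" using invfrob_of_pow[of 0] by (simp add: power_0_left)
  obtain N where N: "\<forall>j n. n \<ge> N \<longrightarrow> m j n = 0" using motive_bound[OF m] ..
  have "\<forall>j n. d \<le> j \<longrightarrow> m j n = 0" using m unfolding motive_alt by blast
  then have "m' \<in> Mot" unfolding motive_alt using N 0 by (auto simp: m'_def intro!: exI[of _ N])
  moreover have "m = tau_act q m'"
    by (intro ext) (auto simp: tau_act_nth m'_def m0)
  ultimately show ?thesis by blast
qed

text \<open>The quotient of M by the image of tau has dimension d over K, so it is torsion over K[t].\<close>

lemma tau_torsion:
  assumes m: "m \<in> Mot" shows "\<exists>p m'. p \<noteq> 0 \<and> m' \<in> Mot \<and> kact p m = tau_act q m'"
proof -
  \<comment> \<open>The constant term in tau of t^i m. Those with i at most d are d + 1 vectors in a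
    space of dimension d, and a relation among them gives the coefficients of p.\<close>
  define f :: "nat \<Rightarrow> 'k skvec" where "f i = (\<lambda>j n. if n = 0 then tp m i j 0 else 0)" for i
  have f: "f i \<in> kv.span (Eset 0)" for i
  proof -
    have "\<forall>j n. d \<le> j \<longrightarrow> tp m i j n = 0" using tp_Mot[OF m] unfolding motive_alt by blast
    then have "f i \<in> Gf (real 0)" unfolding Gf_def motive_alt by (auto simp: f_def intro!: exI[of _ 1])
    then show ?thesis using Gf_span by blast
  qed
  have "\<exists>u. (\<Sum>i\<in>{..d}. ks (u i) (f i)) = 0 \<and> (\<exists>i\<in>{..d}. u i \<noteq> 0)"
  proof (rule ccontr)
    assume "\<not> ?thesis"
    then have z: "\<And>u. (\<Sum>i\<in>{..d}. ks (u i) (f i)) = 0 \<Longrightarrow> \<forall>i\<in>{..d}. u i = 0" by blast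
    have "kv.independent (f ` {..d})" by (rule kv.indep_family(2)) (simp, rule z)
    then have "card (f ` {..d}) \<le> card (Eset 0)"
      using f by (intro conjunct2[OF kv.independent_span_bound] Eset_card(1)) auto
    also have "\<dots> \<le> d" using Eset_card(2)[of 0] by simp
    finally have "card (f ` {..d}) \<le> d" .
    moreover have "inj_on f {..d}" by (rule kv.indep_family(1)) (simp, rule z)
    ultimately show False by (simp add: card_image)
  qed
  then obtain u i where u: "(\<Sum>i\<in>{..d}. ks (u i) (f i)) = 0" "i \<le> d" "u i \<noteq> 0" by auto
  define p where "p = (\<Sum>i\<le>d. monom (u i) i)"
  have cp: "coeff p i = (if i \<le> d then u i else 0)" for i by (simp add: p_def coeff_sum)
  have "degree p \<le> d" by (intro degree_le) (simp add: cp)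
  then have "degree p < Suc d" by simp
  then have p: "kact p m = (\<Sum>i\<le>d. ks (u i) (tp m i))"
    by (simp only: kact_eq cp lessThan_Suc_atMost) (rule sum.cong, auto)
  have "kact p m j 0 = 0" for j
  proof -
    have "kact p m j 0 = (\<Sum>i\<in>{..d}. ks (u i) (f i)) j 0"
      unfolding p sum_fun_apply by (simp add: ks_nth f_def)
    then show ?thesis using u(1) by simp
  qed
  then have "\<exists>m'\<in>Mot. kact p m = tau_act q m'" by (intro tau_image kact_Mot m)
  moreover have "p \<noteq> 0" using cp[of i] u by auto
  ultimately show ?thesis by blast
qed

end

context tfls begin

section \<open>Bijectivity of tau on K((1/t))^r\<close>

definition ue :: "nat \<Rightarrow> nat \<Rightarrow> 'k fls" where "ue k = (\<lambda>i. if i = k then 1 else 0)"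

lemma ue_Fl: "k < r \<Longrightarrow> ue k \<in> Fl" by (auto simp: ue_def flvec_space_def)

lemma ue_sum: "(\<Sum>k<r. csm (c k) (ue k)) i = (if i < r then c i else 0)"
proof -
  have "(\<Sum>k<r. csm (c k) (ue k)) i = (\<Sum>k<r. if k = i then c i else 0)"
    unfolding sum_fun_apply by (rule sum.cong) (auto simp: csm_def ue_def)
  then show ?thesis by simp
qed

lemma Fl_expand: "x \<in> Fl \<Longrightarrow> x = (\<Sum>k<r. csm (x k) (ue k))"
  by (rule ext) (simp only: ue_sum flvec_space_def, auto)

text \<open>Some nonzero multiple p b_k lies in tau M. Over K((1/t)) the factor p is removed by a
  scalar whose Frobenius twist is 1 / p.\<close>

lemma ue_preimage: assumes "k < r" shows "\<exists>g\<in>Fl. T g = ue k"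
proof -
  obtain p m' where p: "p \<noteq> 0" "m' \<in> Mot" "kact p (bs k) = tau_act q m'"
    using tau_torsion[OF bs_Mot[OF assms]] by blast
  obtain ps where ps: "m' = comb r ps bs" using comb_ex[OF p(2)] by blast
  have "comb r (\<lambda>j. if j = k then p else 0) bs = (\<Sum>j<r. if j = k then kact p (bs k) else 0)"
    unfolding comb_eq by (rule sum.cong) (auto simp: kact_zero)
  also have "\<dots> = kact p (bs k)" using assms by simp
  also have "\<dots> = comb r (tps ps) bs" unfolding p(3) ps by (rule tau_comb)
  finally have c: "comb r (\<lambda>j. if j = k then p else 0) bs = comb r (tps ps) bs" .
  have "T (kap ps) = csm (kt_to_fls p) (ue k)"
    unfolding T_kap using comb_unique[OF c, symmetric] assms by (auto simp: kap_def csm_def ue_def fun_eq_iff)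
  moreover obtain c where "fls_frob q c = inverse (kt_to_fls p)" using fls_frob_surj by blast
  ultimately have "T (csm c (kap ps)) = ue k"
    using p(1) by (simp add: T_csm)
  then show ?thesis using Fl_csm[OF kap_Fl] by blast
qed

text \<open>The coordinates of y are Frobenius twists, so semilinearity is no obstacle to combining
  the preimages of the unit vectors.\<close>

lemma T_surj: assumes "y \<in> Fl" shows "\<exists>x\<in>Fl. T x = y"
proof -
  obtain g where g: "\<And>k. k < r \<Longrightarrow> g k \<in> Fl" "\<And>k. k < r \<Longrightarrow> T (g k) = ue k" using ue_preimage by metis
  have "\<forall>k. \<exists>f. fls_frob q f = y k" using fls_frob_surj by blast
  then obtain c where c: "\<And>k. fls_frob q (c k) = y k" by metis
  have "T (\<Sum>k<r. csm (c k) (g k)) = (\<Sum>k<r. csm (y k) (ue k))"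
    unfolding T_sum T_csm c by (rule sum.cong) (simp_all add: g)
  then have "T (\<Sum>k<r. csm (c k) (g k)) = y" using Fl_expand[OF assms] by simp
  moreover have "(\<Sum>k<r. csm (c k) (g k)) \<in> Fl" by (intro Fl_sum Fl_csm g) auto
  ultimately show ?thesis by blast
qed

text \<open>A semilinear operator is injective when it maps a family of r vectors onto a basis.\<close>

lemma T_inj: assumes x: "x \<in> Fl" "T x = 0" shows "x = 0"
proof -
  obtain g where g: "\<And>k. k < r \<Longrightarrow> g k \<in> Fl" "\<And>k. k < r \<Longrightarrow> T (g k) = ue k" using ue_preimage by metis
  have Tg: "T (\<Sum>k<r. csm (c k) (g k)) = (\<Sum>k<r. csm (fls_frob q (c k)) (ue k))" for c
    unfolding T_sum T_csm by (rule sum.cong) (simp_all add: g)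
  have c0: "c k = 0" if "T (\<Sum>k<r. csm (c k) (g k)) = 0" "k < r" for c k
  proof -
    have "(\<Sum>k<r. csm (fls_frob q (c k)) (ue k)) k = 0" using that(1) unfolding Tg by simp
    then show ?thesis unfolding ue_sum using that(2) by simp
  qed
  have z: "\<forall>k\<in>{..<r}. c k = 0" if cz: "(\<Sum>k\<in>{..<r}. csm (c k) (g k)) = 0" for c
  proof -
    have "T (\<Sum>k\<in>{..<r}. csm (c k) (g k)) = 0" unfolding cz by (rule T_zero)
    then show ?thesis using c0[of c] by blast
  qed
  have ind: "lv.independent (g ` {..<r})" by (rule lv.indep_family(2)) (simp, rule z)
  have inj: "inj_on g {..<r}" by (rule lv.indep_family(1)) (simp, rule z)
  have span: "Fl \<subseteq> lv.span (ue ` {..<r})"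
  proof
    fix y assume "y \<in> Fl"
    then have "y = (\<Sum>k<r. csm (y k) (ue k))" by (rule Fl_expand)
    also have "\<dots> \<in> lv.span (ue ` {..<r})" by (intro lv.span_sum lv.span_scale[OF lv.span_base]) blast
    finally show "y \<in> lv.span (ue ` {..<r})" .
  qed
  \<comment> \<open>The preimages are r independent vectors in a space of dimension r, so a vector
    outside their span would be one too many.\<close>
  have "x \<in> lv.span (g ` {..<r})"
  proof (rule ccontr)
    assume n: "x \<notin> lv.span (g ` {..<r})"
    then have "x \<notin> g ` {..<r}" using lv.span_base[of x "g ` {..<r}"] by blast
    then have c: "card (insert x (g ` {..<r})) = Suc r" by (simp add: card_image[OF inj])
    have "insert x (g ` {..<r}) \<subseteq> lv.span (ue ` {..<r})" using span x(1) g(1) by blast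
    then have "card (insert x (g ` {..<r})) \<le> card (ue ` {..<r})"
      by (intro conjunct2[OF lv.independent_span_bound] lv.independent_insertI[OF n ind]) auto
    also have "\<dots> \<le> r" using card_image_le[of "{..<r}" ue] by simp
    finally show False using c by simp
  qed
  then have "x \<in> range (\<lambda>u. \<Sum>y\<in>g ` {..<r}. csm (u y) y)" by (simp only: lv.span_finite finite_imageI finite_lessThan)
  then obtain u where "x = (\<Sum>y\<in>g ` {..<r}. csm (u y) y)" by blast
  then have xu: "x = (\<Sum>k<r. csm (u (g k)) (g k))" by (simp add: sum.reindex[OF inj])
  have "u (g k) = 0" if "k < r" for k by (rule c0[of "\<lambda>k. u (g k)"]) (use x(2) xu that in auto)
  then show ?thesis unfolding xu by (intro sum.neutral) (simp add: lv.scale_zero_left)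
qed

lemma Tn_surj: "y \<in> Fl \<Longrightarrow> \<exists>x\<in>Fl. Tn n x = y"
proof (induction n arbitrary: y)
  case (Suc n)
  then show ?case using T_surj by (metis comp_apply funpow.simps(2))
qed auto

lemma T_diff: "T (x - y) = T x - T y"
proof -
  have "T (x - y) + T y = T x" by (simp only: T_add[symmetric] diff_add_cancel)
  then show ?thesis by (simp only: eq_diff_eq)
qed

lemma Tn_inj: assumes "x \<in> Fl" "y \<in> Fl" "Tn n x = Tn n y" shows "x = y"
  using assms
proof (induction n)
  case (Suc n)
  have "T (Tn n x) = T (Tn n y)" using Suc.prems(3) by (simp only: funpow.simps o_apply)
  then have "T (Tn n x - Tn n y) = 0" by (simp only: T_diff diff_self)
  then have "Tn n x - Tn n y = 0" by (rule T_inj[rotated]) (intro Fl_diff Tn_Fl Suc.prems)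
  then have "Tn n x = Tn n y" by (simp only: eq_iff_diff_eq_0[symmetric])
  then show ?case by (rule Suc.IH[OF Suc.prems(1,2)])
qed simp

section \<open>Lattices and orders of pole\<close>

lemma Fl_vvge_ex: assumes "x \<in> Fl" shows "\<exists>c. vvge x c"
proof -
  obtain m where m: "\<And>i. i < r \<Longrightarrow> m \<le> real_of_int (fls_subdegree (x i))"
    using finite_lower[of r "\<lambda>i. real_of_int (fls_subdegree (x i))"] by blast
  have "vge (x k) m" for k
    by (cases "k < r") (use m vge_mono[OF vge_subdegree] assms in \<open>auto simp: flvec_space_def\<close>)
  then show ?thesis unfolding vvge_def by blast
qed

lemma vvge_csm: "vge c a \<Longrightarrow> vvge x b \<Longrightarrow> vvge (csm c x) (a + b)"
  by (simp add: vvge_def csm_def vge_times)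

lemma csm_sum: "(\<lambda>i. \<Sum>j\<in>J. c j * x j i) = (\<Sum>j\<in>J. csm (c j) (x j))"
  by (rule ext) (simp add: sum_fun_apply csm_def)

text \<open>A lattice lies between two multiples of the standard one: its finitely many generators
  bound the poles of all elements, and the unit vectors have bounded coordinates in the basis that
  it contains.\<close>

lemma lattice_bounds:
  assumes "is_lattice r L"
  shows "L \<subseteq> Fl" "\<exists>N::nat. (\<forall>x\<in>L. vvge x (- real N)) \<and> (\<forall>x\<in>Fl. vvge x (real N) \<longrightarrow> x \<in> L)"
proof -
  have "\<exists>(gs :: nat \<Rightarrow> nat \<Rightarrow> 'k fls) n. (\<forall>j<n. gs j \<in> Fl) \<and>
      L = {(\<lambda>i. \<Sum>j<n. c j * gs j i) | c :: nat \<Rightarrow> 'k fls. \<forall>j<n. c j \<in> pows_ring}"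
    using assms unfolding is_lattice_def by (rule conjunct1)
  then obtain gs :: "nat \<Rightarrow> nat \<Rightarrow> 'k fls" and n where gs': "(\<forall>j<n. gs j \<in> Fl) \<and>
      L = {(\<lambda>i. \<Sum>j<n. c j * gs j i) | c :: nat \<Rightarrow> 'k fls. \<forall>j<n. c j \<in> pows_ring}"
    by iprover
  note L' = conjunct2[OF gs']
  have "\<exists>es :: nat \<Rightarrow> nat \<Rightarrow> 'k fls. (\<forall>k<r. es k \<in> L) \<and> fls_basis r es"
    using assms unfolding is_lattice_def by (rule conjunct2)
  then obtain es :: "nat \<Rightarrow> nat \<Rightarrow> 'k fls" where es': "\<forall>k<r. es k \<in> L" "fls_basis r es" by blast
  have gs: "gs j \<in> Fl" if "j < n" for j using gs' that by blast
  have es: "es k \<in> L" if "k < r" for k using es'(1) that by blast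
  from L' have L: "L = {\<Sum>j<n. csm (c j) (gs j) | c. \<forall>j<n. vge (c j) 0}"
    by (simp add: csm_sum vge_pows)
  show LF: "L \<subseteq> Fl" unfolding L by (auto intro!: Fl_sum Fl_csm gs)
  have L_add: "x + y \<in> L" if xy: "x \<in> L" "y \<in> L" for x y
  proof -
    obtain c c' where "x = (\<Sum>j<n. csm (c j) (gs j))" "y = (\<Sum>j<n. csm (c' j) (gs j))"
      "\<forall>j<n. vge (c j) 0" "\<forall>j<n. vge (c' j) 0" using xy unfolding L by blast
    then show ?thesis unfolding L
      by (intro CollectI exI[of _ "\<lambda>j. c j + c' j"]) (simp add: lv.scale_left_distrib sum.distrib vge_add)
  qed
  have L_csm: "csm a x \<in> L" if ax: "vge a 0" "x \<in> L" for a x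
  proof -
    obtain c where "x = (\<Sum>j<n. csm (c j) (gs j))" "\<forall>j<n. vge (c j) 0" using ax(2) unfolding L by blast
    then show ?thesis unfolding L using vge_times[OF ax(1), of _ 0]
      by (intro CollectI exI[of _ "\<lambda>j. a * c j"]) (simp add: lv.scale_sum_right)
  qed
  have "0 = (\<Sum>j<n. csm 0 (gs j))" by (simp add: lv.scale_zero_left)
  then have L_zero: "0 \<in> L" unfolding L by (intro CollectI exI[of _ "\<lambda>_. 0"]) simp
  have L_sum: "sum f J \<in> L" if "\<And>j. j \<in> J \<Longrightarrow> f j \<in> L" for J :: "nat set" and f
    using that by (induction J rule: infinite_finite_induct) (simp_all add: L_zero L_add)
  obtain b where b: "\<And>j. j < n \<Longrightarrow> vvge (gs j) (b j)" using Fl_vvge_ex[OF gs] by metis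
  obtain b0 where b0: "\<And>j. j < n \<Longrightarrow> b0 \<le> b j" using finite_lower[of n b] by blast
  have low: "vvge x b0" if xL: "x \<in> L" for x
  proof -
    obtain c where c: "x = (\<Sum>j<n. csm (c j) (gs j))" "\<forall>j<n. vge (c j) 0" using xL unfolding L by blast
    have "vvge (csm (c j) (gs j)) (0 + b0)" if j: "j < n" for j
      by (rule vvge_csm) (use c(2) vvge_mono[OF b b0] j in auto)
    then show ?thesis unfolding c(1) by (intro vvge_sum) simp
  qed
  have "\<forall>k. \<exists>c. k < r \<longrightarrow> ue k = (\<Sum>j<r. csm (c j) (es j))"
    using es'(2) ue_Fl unfolding fls_basis_def csm_sum by blast
  then obtain c where c: "\<And>k. k < r \<Longrightarrow> ue k = (\<Sum>j<r. csm (c k j) (es j))" by metis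
  have "\<exists>m. \<forall>j<r. m \<le> real_of_int (fls_subdegree (c k j))" for k by (rule finite_lower)
  then obtain m where m: "\<And>j k. j < r \<Longrightarrow> m k \<le> real_of_int (fls_subdegree (c k j))" by metis
  obtain m0 where m0: "\<And>k. k < r \<Longrightarrow> m0 \<le> m k" using finite_lower[of r m] by blast
  have high: "x \<in> L" if xF: "x \<in> Fl" "vvge x (- m0)" for x
  proof -
    have "csm (x k) (ue k) \<in> L" if k: "k < r" for k
    proof -
      have "vge (x k * c k j) (- m0 + m0)" if "j < r" for j
        by (rule vge_times) (use xF(2) m0[OF k] m[OF that, of k] in \<open>auto simp: vvge_def intro: vge_mono[OF vge_subdegree]\<close>)
      then show ?thesis unfolding c[OF k] lv.scale_sum_right lv.scale_scale
        by (intro L_sum L_csm es) auto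
    qed
    then show ?thesis by (subst Fl_expand[OF xF(1)], intro L_sum) auto
  qed
  define N where "N = nat \<lceil>max (- b0) (- m0)\<rceil>"
  have N: "- real N \<le> b0" "- m0 \<le> real N" unfolding N_def by linarith+
  show "\<exists>N::nat. (\<forall>x\<in>L. vvge x (- real N)) \<and> (\<forall>x\<in>Fl. vvge x (real N) \<longrightarrow> x \<in> L)"
    by (intro exI[of _ N] conjI ballI impI high) (auto intro: vvge_mono[OF low N(1)] vvge_mono[OF _ N(2)])
qed

lemma vector_space_const: "vector_space (\<lambda>c x. csm (fls_const c) x)"
  by unfold_locales (auto simp: csm_def fun_eq_iff algebra_simps simp flip: fls_plus_const fls_const_mult_const)

lemma shv_ue_nth: "shv (- n) (ue k) i $$ m = (if i = k \<and> m = n then 1 else 0)"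
  by (auto simp: shv_def ue_def)

lemma shv_ue_sum: "x \<in> Fl \<Longrightarrow> (\<Sum>k<r. csm (fls_shift n (x k)) (shv (- n) (ue k))) = x"
proof -
  have "csm (fls_shift n (x k)) (shv (- n) (ue k)) = csm (x k) (ue k)" for k
    by (rule ext) (simp add: csm_def shv_def ue_def fls_shifted_times_simps)
  then show "x \<in> Fl \<Longrightarrow> ?thesis" using Fl_expand by simp
qed

text \<open>Modulo vectors of order at least N, which all belong to L, an element of L has at most 2
  N r coefficients. The elements without higher terms thus form a finite-dimensional space over K,
  and b enumerates a basis of it.\<close>

lemma lattice_finite_generation:
  assumes LF: "L \<subseteq> Fl" and L_add: "\<And>x y. x \<in> L \<Longrightarrow> y \<in> L \<Longrightarrow> x + y \<in> L"
    and L_csm: "\<And>c x. vge c 0 \<Longrightarrow> x \<in> L \<Longrightarrow> csm c x \<in> L"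
    and low: "\<And>x. x \<in> L \<Longrightarrow> vvge x (- real N)" and high: "\<And>x. x \<in> Fl \<Longrightarrow> vvge x (real N) \<Longrightarrow> x \<in> L"
  shows "\<exists>b::nat \<Rightarrow> nat \<Rightarrow> 'k fls. \<exists>n. (\<forall>j<n. b j \<in> L) \<and>
    (\<forall>x\<in>L. \<exists>c y. y \<in> Fl \<and> vvge y (real N) \<and> x = (\<Sum>j<n. csm (fls_const (c j)) (b j)) + y)"
proof -
  interpret k: vector_space "\<lambda>c x. csm (fls_const c) x" by (rule vector_space_const)
  define V where "V = {x \<in> L. \<forall>i m. m \<ge> int N \<longrightarrow> x i $$ m = 0}"
  define W where "W = (\<lambda>(i, m). shv (- m) (ue i)) ` ({..<r} \<times> {- int N..<int N})"
  have "V \<subseteq> k.span W"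
  proof
    fix x assume x: "x \<in> V"
    have x0: "x i $$ m = 0" if "\<not> (i < r \<and> m \<in> {- int N..<int N})" for i m
    proof (cases "i < r")
      case True
      then have "m \<ge> int N \<or> real_of_int m < - real N" using that by auto
      then show ?thesis using x low[of x] unfolding V_def vvge_def vge_def by blast
    next
      case False
      then show ?thesis using x LF unfolding V_def flvec_space_def by auto
    qed
    have "x = (\<Sum>(i,m)\<in>{..<r} \<times> {- int N..<int N}. csm (fls_const (x i $$ m)) (shv (- m) (ue i)))"
    proof (intro ext fls_eqI)
      fix i' m'
      have "(\<Sum>(i,m)\<in>{..<r} \<times> {- int N..<int N}. csm (fls_const (x i $$ m)) (shv (- m) (ue i))) i' $$ m'
         = (\<Sum>a\<in>{..<r} \<times> {- int N..<int N}. if a = (i', m') then x i' $$ m' else 0)"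
        unfolding sum_fun_apply fls_nth_sum by (rule sum.cong) (auto simp: csm_nth shv_ue_nth split: if_splits)
      then show "x i' $$ m' = (\<Sum>(i,m)\<in>{..<r} \<times> {- int N..<int N}. csm (fls_const (x i $$ m)) (shv (- m) (ue i))) i' $$ m'"
        using x0[of i' m'] by auto
    qed
    also have "\<dots> \<in> k.span W"
      by (rule k.span_sum) (auto simp: W_def intro!: k.span_scale[OF k.span_base])
    finally show "x \<in> k.span W" .
  qed
  moreover obtain B where B: "B \<subseteq> V" "k.independent B" "V \<subseteq> k.span B"
    using k.maximal_independent_subset by blast
  ultimately have "finite B"
    using k.independent_span_bound[of W B] by (auto simp: W_def)
  then obtain b where b: "bij_betw b {0..<card B} B" using ex_bij_betw_nat_finite by blast
  then have inj: "inj_on b {..<card B}" and im: "b ` {..<card B} = B"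
    by (simp_all add: bij_betw_def lessThan_atLeast0)
  have "\<exists>c y. y \<in> Fl \<and> vvge y (real N) \<and> x = (\<Sum>j<card B. csm (fls_const (c j)) (b j)) + y" if x: "x \<in> L" for x
  proof -
    \<comment> \<open>The terms of x from order N on, obtained as the regular part after a
      shift.\<close>
    define y where "y = shv (- int N) (\<lambda>i. fps_to_fls (fls_regpart (fls_shift (int N) (x i))))"
    have y: "y i $$ m = (if m < int N then 0 else x i $$ m)" for i m by (simp add: y_def shv_def)
    have yF: "y \<in> Fl" using x LF by (auto simp: flvec_space_def y_def shv_def)
    moreover have yN: "vvge y (real N)" by (simp add: vvge_def vge_def y)
    ultimately have "y \<in> L" by (rule high)
    then have "csm (- 1) y \<in> L" by (rule L_csm[rotated]) (simp add: vge_minus vge_one)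
    then have "x + csm (- 1) y \<in> L" by (rule L_add[OF x])
    moreover have "x + csm (- 1) y = x - y" by (rule ext) (simp add: csm_def)
    ultimately have "x - y \<in> L" by metis
    moreover have "\<forall>i m. m \<ge> int N \<longrightarrow> (x - y) i $$ m = 0" by (simp add: y)
    ultimately have "x - y \<in> V" unfolding V_def by blast
    then have "x - y \<in> k.span B" using B(3) by blast
    then have "x - y \<in> range (\<lambda>u. \<Sum>v\<in>B. csm (fls_const (u v)) v)" by (simp only: k.span_finite[OF \<open>finite B\<close>])
    then obtain u where "x - y = (\<Sum>v\<in>B. csm (fls_const (u v)) v)" by blast
    also have "\<dots> = (\<Sum>v\<in>b ` {..<card B}. csm (fls_const (u v)) v)" by (simp only: im)
    also have "\<dots> = (\<Sum>j<card B. csm (fls_const (u (b j))) (b j))"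
      by (subst sum.reindex[OF inj]) simp
    finally have "x = (\<Sum>j<card B. csm (fls_const (u (b j))) (b j)) + y" by (simp only: diff_eq_eq)
    then show ?thesis using yF yN by (intro exI[of _ "\<lambda>j. u (b j)"] exI[of _ y]) blast
  qed
  moreover have "b j \<in> L" if "j < card B" for j using im that B(1) unfolding V_def by blast
  ultimately show ?thesis by (intro exI[of _ b] exI[of _ "card B"]) blast
qed

text \<open>Generators are the vectors from \<open>lattice_finite_generation\<close> together with
  the t^(-N) \<open>ue k\<close>. The latter generate everything of order at least N and also serve
  as the basis of the whole space.\<close>

lemma is_latticeI:
  assumes LF: "L \<subseteq> Fl" and L_add: "\<And>x y. x \<in> L \<Longrightarrow> y \<in> L \<Longrightarrow> x + y \<in> L"
    and L_csm: "\<And>c x. vge c 0 \<Longrightarrow> x \<in> L \<Longrightarrow> csm c x \<in> L"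
    and low: "\<And>x. x \<in> L \<Longrightarrow> vvge x (- real N)" and high: "\<And>x. x \<in> Fl \<Longrightarrow> vvge x (real N) \<Longrightarrow> x \<in> L"
  shows "is_lattice r L"
proof -
  obtain b :: "nat \<Rightarrow> nat \<Rightarrow> 'k fls" and n where bn: "(\<forall>j<n. b j \<in> L) \<and>
    (\<forall>x\<in>L. \<exists>c y. y \<in> Fl \<and> vvge y (real N) \<and> x = (\<Sum>j<n. csm (fls_const (c j)) (b j)) + y)"
    using lattice_finite_generation[OF assms] by iprover
  have bL: "b j \<in> L" if "j < n" for j using bn that by blast
  have b: "\<exists>c y. y \<in> Fl \<and> vvge y (real N) \<and> x = (\<Sum>j<n. csm (fls_const (c j)) (b j)) + y" if "x \<in> L" for x
    using conjunct2[OF bn] that by (rule bspec)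
  define es where "es k = shv (- int N) (ue k)" for k
  have esF: "es k \<in> Fl" if "k < r" for k unfolding es_def by (intro Fl_shv ue_Fl that)
  have esL: "es k \<in> L" if "k < r" for k
    by (rule high[OF esF[OF that]]) (auto simp: es_def vvge_def vge_def shv_ue_nth)
  have es_sum: "(\<Sum>k<r. csm (fls_shift (int N) (x k)) (es k)) = x" if "x \<in> Fl" for x
    unfolding es_def by (rule shv_ue_sum[OF that])
  define gs where "gs j = (if j < n then b j else es (j - n))" for j
  have gsL: "gs j \<in> L" if "j < n + r" for j using that bL esL by (simp add: gs_def)
  have L_zero: "0 \<in> L" by (rule high) (simp_all add: Fl_zero)
  have L_sum: "sum f J \<in> L" if "\<And>j. j \<in> J \<Longrightarrow> f j \<in> L" for J :: "nat set" and f
    using that by (induction J rule: infinite_finite_induct) (simp_all add: L_zero L_add)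
  have "L = {\<Sum>j<n + r. csm (c j) (gs j) | c. \<forall>j<n + r. vge (c j) 0}"
  proof (intro equalityI subsetI)
    fix x assume "x \<in> L"
    then obtain c y where y: "y \<in> Fl" "vvge y (real N)" "x = (\<Sum>j<n. csm (fls_const (c j)) (b j)) + y"
      using b by blast
    define e where "e j = (if j < n then fls_const (c j) else fls_shift (int N) (y (j - n)))" for j
    have "(\<Sum>j<n + r. csm (e j) (gs j)) = (\<Sum>j<n. csm (fls_const (c j)) (b j)) + (\<Sum>k<r. csm (fls_shift (int N) (y k)) (es k))"
      unfolding sum_lessThan_add by (simp add: e_def gs_def)
    then have "x = (\<Sum>j<n + r. csm (e j) (gs j))" unfolding es_sum[OF y(1)] y(3) by simp
    moreover have "vge (e j) 0" for j
      using y(2) by (auto simp: e_def vge_shift vvge_def) (simp add: vge_def)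
    ultimately show "x \<in> {\<Sum>j<n + r. csm (c j) (gs j) | c. \<forall>j<n + r. vge (c j) 0}" by blast
  next
    fix x assume "x \<in> {\<Sum>j<n + r. csm (c j) (gs j) | c. \<forall>j<n + r. vge (c j) 0}"
    then obtain c where "x = (\<Sum>j<n + r. csm (c j) (gs j))" "\<forall>j<n + r. vge (c j) 0" by blast
    then show "x \<in> L" by (auto intro!: L_sum L_csm gsL)
  qed
  then have "L = {(\<lambda>i. \<Sum>j<n + r. c j * gs j i) | c. \<forall>j<n + r. c j \<in> pows_ring}"
    by (simp add: csm_sum vge_pows)
  moreover have "\<forall>j<n + r. gs j \<in> Fl" using gsL LF by blast
  moreover have "fls_basis r es"
    unfolding fls_basis_def csm_sum
  proof (intro conjI allI impI ballI)
    show "\<exists>c. x = (\<Sum>k<r. csm (c k) (es k))" if "x \<in> Fl" for x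
      using es_sum[OF that] by (intro exI[of _ "\<lambda>k. fls_shift (int N) (x k)"]) simp
    fix c k assume c: "(\<Sum>k<r. csm (c k) (es k)) = (\<lambda>_. 0)" and k: "k < r"
    have "csm (c k) (es k) = csm (fls_shift (- int N) (c k)) (ue k)" for k
      by (rule ext) (simp add: csm_def es_def shv_def ue_def fls_shifted_times_simps)
    then have "(\<Sum>k<r. csm (fls_shift (- int N) (c k)) (ue k)) k = 0" using c by simp
    then have "fls_shift (- int N) (c k) = 0" unfolding ue_sum using k by simp
    then show "c k = 0" by (simp add: fls_shift_eq0_iff)
  qed (rule esF)
  ultimately show ?thesis unfolding is_lattice_def using esL by blast
qed

text \<open>Asking for the bound only at all large n makes the condition invariant under n to n + 1,
  which is the effect of t^(-u) tau^v; hence x lies in L exactly if t^(-u) tau^v x does. Growth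
  bounds L on both sides, and surjectivity of tau^v turns the equivalence into an equality of
  lattices.\<close>

lemma growthT_lattice:
  assumes g: "growthT (real u / real v) C" and v: "v > 0"
  shows "\<exists>L. is_lattice r L \<and> shv (int u) ` L = Tn v ` L"
proof -
  have w: "real u / real v * real (v * n) = real (u * n)" for n using v by simp
  have gup: "x \<in> Fl \<Longrightarrow> vvge x c \<Longrightarrow> vvge (Tn (v * n) x) (c - real (u * n) - C)"
    and glow: "x \<in> Fl \<Longrightarrow> vvge (Tn (v * n) x) (c - real (u * n)) \<Longrightarrow> vvge x (c - C)" for n x c
    using g unfolding growthT_def w[symmetric] by blast+
  define L where "L = {x \<in> Fl. \<exists>n0. \<forall>n\<ge>n0. vvge (Tn (v * n) x) (- real (u * n))}"
  define N where "N = nat \<lceil>\<bar>C\<bar>\<rceil>"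
  have N: "C \<le> real N" unfolding N_def by linarith
  have "is_lattice r L"
  proof (rule is_latticeI[where N=N])
    show "L \<subseteq> Fl" by (auto simp: L_def)
    show "x + y \<in> L" if xy: "x \<in> L" "y \<in> L" for x y
    proof -
      obtain n0 n1 where "\<forall>n\<ge>n0. vvge (Tn (v * n) x) (- real (u * n))" "\<forall>n\<ge>n1. vvge (Tn (v * n) y) (- real (u * n))"
        using xy unfolding L_def by blast
      then have "\<forall>n\<ge>max n0 n1. vvge (Tn (v * n) (x + y)) (- real (u * n))" by (simp add: Tn_add vvge_add)
      then show ?thesis using xy Fl_add unfolding L_def by blast
    qed
    show "csm c x \<in> L" if cx: "vge c 0" "x \<in> L" for c x
    proof -
      have "vvge (Tn (v * n) (csm c x)) (- real (u * n))" if t: "vvge (Tn (v * n) x) (- real (u * n))" for n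
      proof -
        obtain c' where "vge c' 0" "Tn (v * n) (csm c x) = csm c' (Tn (v * n) x)" using Tn_csm cx(1) by blast
        then show ?thesis using vvge_csm[OF _ t, of c' 0] by simp
      qed
      then show ?thesis using cx(2) Fl_csm unfolding L_def by blast
    qed
    show "vvge x (- real N)" if xL: "x \<in> L" for x
    proof -
      obtain n where "\<forall>m\<ge>n. vvge (Tn (v * m) x) (- real (u * m))" using xL unfolding L_def by blast
      then have n: "x \<in> Fl" "vvge (Tn (v * n) x) (- real (u * n))" using xL unfolding L_def by blast+
      then have "vvge (Tn (v * n) x) (0 - real (u * n))" by simp
      then have "vvge x (0 - C)" by (rule glow[OF n(1)])
      then show ?thesis by (rule vvge_mono) (use N in simp)
    qed
    show "x \<in> L" if x: "x \<in> Fl" "vvge x (real N)" for x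
    proof -
      have "vvge (Tn (v * n) x) (real N - real (u * n) - C)" for n by (rule gup[OF x])
      then have "vvge (Tn (v * n) x) (- real (u * n))" for n by (rule vvge_mono) (use N in simp)
      then show ?thesis using x(1) unfolding L_def by blast
    qed
  qed
  moreover have shift: "vvge (Tn (v * n) (shv (- int u) (Tn v x))) (- real (u * n)) \<longleftrightarrow>
      vvge (Tn (v * Suc n) x) (- real (u * Suc n))" for n x
  proof -
    have e: "Tn (v * n) (shv (- int u) (Tn v x)) = shv (- int u) (Tn (v * Suc n) x)"
      by (simp only: Tn_shv Tn_Tn mult_Suc_right add.commute)
    have "- real (u * n) + real_of_int (- int u) = - real (u * Suc n)" by (simp add: distrib_left)
    then show ?thesis unfolding e shv_vvge by (simp only:)
  qed
  have LT: "shv (- int u) (Tn v x) \<in> L \<longleftrightarrow> x \<in> L" if x: "x \<in> Fl" for x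
  proof
    assume "shv (- int u) (Tn v x) \<in> L"
    then have "\<exists>n0. \<forall>n\<ge>n0. vvge (Tn (v * n) (shv (- int u) (Tn v x))) (- real (u * n))" unfolding L_def by blast
    then obtain n0 where n0: "\<forall>n\<ge>n0. vvge (Tn (v * Suc n) x) (- real (u * Suc n))" unfolding shift by iprover
    have "vvge (Tn (v * n) x) (- real (u * n))" if n: "n \<ge> Suc n0" for n
    proof -
      obtain m where m: "n = Suc m" using n Suc_le_D by blast
      then have "m \<ge> n0" using n by simp
      then show ?thesis unfolding m using n0 by iprover
    qed
    then show "x \<in> L" using x unfolding L_def by blast
  next
    assume "x \<in> L"
    then have "\<exists>n0. \<forall>n\<ge>n0. vvge (Tn (v * n) x) (- real (u * n))" unfolding L_def by blast
    then obtain n0 where n0: "\<forall>n\<ge>n0. vvge (Tn (v * n) x) (- real (u * n))" by iprover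
    have "vvge (Tn (v * Suc n) x) (- real (u * Suc n))" if "n \<ge> n0" for n using n0 le_SucI[OF that] by iprover
    then have "\<forall>n\<ge>n0. vvge (Tn (v * n) (shv (- int u) (Tn v x))) (- real (u * n))" unfolding shift by iprover
    then show "shv (- int u) (Tn v x) \<in> L" using Fl_shv[OF Tn_Fl[OF x]] unfolding L_def by blast
  qed
  have "shv (int u) ` L = Tn v ` L"
  proof (intro equalityI subsetI)
    fix z assume "z \<in> shv (int u) ` L"
    then obtain y where y: "y \<in> L" "z = shv (int u) y" by blast
    then have "z \<in> Fl" using Fl_shv unfolding L_def by blast
    then obtain x where x: "x \<in> Fl" "Tn v x = z" using Tn_surj by blast
    then have "shv (- int u) (Tn v x) = y" using y(2) by (simp add: shv_shv)
    then show "z \<in> Tn v ` L" using LT[OF x(1)] x(2) y(1) by blast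
  next
    fix z assume "z \<in> Tn v ` L"
    then obtain x where x: "x \<in> L" "z = Tn v x" by blast
    then have "shv (- int u) z \<in> L" using LT[of x] unfolding L_def by blast
    moreover have "z = shv (int u) (shv (- int u) z)" by (simp add: shv_shv)
    ultimately show "z \<in> shv (int u) ` L" by blast
  qed
  ultimately show ?thesis by blast
qed

text \<open>The relation iterates to tau^(v a) L = t^(u a) L, so at multiples of v the growth is
  known up to the width 2 N of the lattice. Injectivity of tau allows the conclusion from tau^(v a)
  x back to x.\<close>

lemma lattice_growthT:
  assumes L: "is_lattice r L" and TL: "shv (int u) ` L = Tn v ` L" and v: "v > 0"
  shows "\<exists>C. growthT (real u / real v) C"
proof -
  obtain N :: nat where low: "\<And>x. x \<in> L \<Longrightarrow> vvge x (- real N)"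
    and high: "\<And>x. x \<in> Fl \<Longrightarrow> vvge x (real N) \<Longrightarrow> x \<in> L" and LF: "L \<subseteq> Fl"
    using lattice_bounds[OF L] by blast
  obtain e where e: "e \<ge> 0" "\<And>n x c. vvge x c \<Longrightarrow> vvge (Tn n x) (c - real n * e)" using Tn_vvge by blast
  have TLn: "Tn (v * a) ` L = shv (int (u * a)) ` L" for a
  proof (induction a)
    case (Suc a)
    have "Tn (v * Suc a) ` L = Tn v ` Tn (v * a) ` L" by (simp add: image_image Tn_Tn)
    also have "\<dots> = shv (int (u * a)) ` Tn v ` L" unfolding Suc by (simp add: image_image Tn_shv)
    also have "\<dots> = shv (int (u * Suc a)) ` L" unfolding TL[symmetric] by (simp add: image_image shv_shv algebra_simps)
    finally show ?case .
  qed simp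
  have up: "vvge (Tn (v * a) x) (c - real (u * a) - 2 * real N)" if x: "x \<in> Fl" "vvge x c" for a x c
  proof -
    \<comment> \<open>Orders are integers, so x has order at least the ceiling of c; after
      multiplication by this power of t the order is at least N and the vector belongs to L.\<close>
    define y where "y = shv (\<lceil>c\<rceil> - int N) x"
    have "vge (x k) (real_of_int \<lceil>c\<rceil>)" for k
      unfolding vge_def
    proof (intro allI impI)
      fix n :: int assume "real_of_int n < real_of_int \<lceil>c\<rceil>"
      then have "real_of_int n < c" by (simp add: less_ceiling_iff)
      then show "x k $$ n = 0" using x(2) unfolding vvge_def vge_def by blast
    qed
    then have "vvge y (real N)" by (simp add: y_def shv_vvge) (simp add: vvge_def)
    then have "y \<in> L" by (intro high) (simp add: y_def Fl_shv x)
    then have "Tn (v * a) y \<in> shv (int (u * a)) ` L" unfolding TLn[symmetric] by blast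
    then obtain z where z: "z \<in> L" "Tn (v * a) y = shv (int (u * a)) z" by blast
    have "vvge (Tn (v * a) y) (- real N - real (u * a))" unfolding z(2) shv_vvge using low[OF z(1)] by simp
    then have "vvge (Tn (v * a) x) (- real N - real (u * a) + real_of_int (\<lceil>c\<rceil> - int N))"
      unfolding y_def Tn_shv shv_vvge .
    moreover have "c - real (u * a) - 2 * real N \<le> - real N - real (u * a) + real_of_int (\<lceil>c\<rceil> - int N)"
      using le_of_int_ceiling[of c] by simp
    ultimately show ?thesis by (rule vvge_mono)
  qed
  have down: "vvge x (c - 2 * real N)" if x: "x \<in> Fl" "vvge (Tn (v * a) x) (c - real (u * a))" for a x c
  proof -
    define y where "y = shv (\<lceil>c\<rceil> - int N) x"
    define z where "z = shv (- int (u * a)) (Tn (v * a) y)"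
    have yF: "y \<in> Fl" by (simp add: y_def Fl_shv x)
    have "vge (Tn (v * a) x k) (real_of_int \<lceil>c\<rceil> - real (u * a))" for k
      unfolding vge_def
    proof (intro allI impI)
      fix n :: int assume n: "real_of_int n < real_of_int \<lceil>c\<rceil> - real (u * a)"
      have "n + int (u * a) < \<lceil>c\<rceil>" using n by linarith
      then have "real_of_int (n + int (u * a)) < c" by (simp only: less_ceiling_iff)
      then have "real_of_int n < c - real (u * a)" by simp
      then show "Tn (v * a) x k $$ n = 0" using x(2) unfolding vvge_def vge_def by blast
    qed
    then have "vvge z (real N)"
      unfolding z_def y_def Tn_shv shv_vvge by (simp add: vvge_def algebra_simps)
    then have "z \<in> L" by (intro high) (simp_all add: z_def Fl_shv Tn_Fl yF)
    moreover have "Tn (v * a) y = shv (int (u * a)) z" by (simp add: z_def shv_shv)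
    ultimately have "Tn (v * a) y \<in> Tn (v * a) ` L" unfolding TLn by blast
    then obtain y' where y': "y' \<in> L" "Tn (v * a) y = Tn (v * a) y'" by blast
    then have "y = y'" using Tn_inj[OF yF] LF by blast
    then have "vvge y (- real N)" using low y' by simp
    then have "vvge x (- real N + real_of_int (\<lceil>c\<rceil> - int N))" unfolding y_def shv_vvge .
    moreover have "c - 2 * real N \<le> - real N + real_of_int (\<lceil>c\<rceil> - int N)" using le_of_int_ceiling[of c] by simp
    ultimately show ?thesis by (rule vvge_mono)
  qed
  \<comment> \<open>2 N from the lattice, v e for the at most v applications of tau between n and a
    multiple of v, and u for the change of u n / v in between.\<close>
  define C where "C = 2 * real N + real v * e + real u"
  have "growthT (real u / real v) C"
    unfolding growthT_def
  proof (intro allI ballI conjI impI)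
    fix n x c assume x: "x \<in> Fl"
    define a where "a = n div v"
    define b where "b = n mod v"
    have n: "n = b + v * a" "b < v" using v by (simp_all add: a_def b_def)
    have "real u / real v * real n = real (u * a) + real u * (real b / real v)"
      using v by (simp add: n(1) field_simps)
    moreover have "0 \<le> real u * (real b / real v)" by simp
    moreover have "real u * (real b / real v) \<le> real u" using n(2) by (intro mult_left_le) simp_all
    ultimately have wn: "real (u * a) \<le> real u / real v * real n" "real u / real v * real n \<le> real (u * a) + real u"
      by linarith+
    have be: "real b * e \<le> real v * e" "real (v - b) * e \<le> real v * e" using n(2) e(1) by (simp_all add: mult_right_mono)
    show "vvge (Tn n x) (c - real u / real v * real n - C)" if "vvge x c"
    proof -
      have "vvge (Tn b (Tn (v * a) x)) (c - real (u * a) - 2 * real N - real b * e)"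
        by (rule e(2)[OF up[OF x that]])
      then have "vvge (Tn n x) (c - real (u * a) - 2 * real N - real b * e)" by (simp add: Tn_Tn n(1))
      then show ?thesis by (rule vvge_mono) (use wn be in \<open>simp add: C_def\<close>)
    qed
    show "vvge x (c - C)" if t: "vvge (Tn n x) (c - real u / real v * real n)"
    proof -
      \<comment> \<open>A bound on tau^n x can only be carried forward, so n is completed to the
        next multiple of v.\<close>
      have "vvge (Tn (v - b) (Tn n x)) (c - real u / real v * real n - real (v - b) * e)" by (rule e(2)[OF t])
      moreover have "v - b + n = v * Suc a" using n by simp
      ultimately have "vvge (Tn (v * Suc a) x) (c - real u / real v * real n - real (v - b) * e)"
        by (simp only: Tn_Tn)
      then have "vvge (Tn (v * Suc a) x) ((c - real v * e) - real (u * Suc a))"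
        by (rule vvge_mono) (use wn be in simp)
      then have "vvge x (c - real v * e - 2 * real N)" by (rule down[OF x])
      then show ?thesis by (rule vvge_mono) (simp add: C_def)
    qed
  qed
  then show ?thesis by blast
qed

end

section \<open>Purity and the Newton polygon\<close>

context tmod begin

text \<open>From t^u L = tau^v L, tau has the rate u / v in the degree in t, hence t has the rate v
  / u in the degree in tau.\<close>

lemma pure_imp_growth:
  assumes "pure q d D"
  shows "\<exists>r bs s C. kt_basis q d D r bs \<and> s > 0 \<and> growthM s C"
proof -
  obtain r bs A L u v where b: "kt_basis q d D r bs"
    and A: "\<forall>k<r. tau_act q (bs k) = kt_comb q d D r (A k) bs"
    and L: "is_lattice r L" and uv: "0 < u" "0 < v"
    and uL: "(\<lambda>x i. fls_X_inv ^ u * x i) ` L = (tau_fl q r A ^^ v) ` L"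
    using assms unfolding pure_def by iprover
  interpret tfls q K d D r bs A by unfold_locales (use b A in auto)
  have "shv (int u) ` L = Tn v ` L" using uL unfolding X_inv_shv .
  then obtain C where "growthT (real u / real v) C" using lattice_growthT[OF L _ uv(2)] by blast
  then have "growthF (real u / real v) C" by (rule growthT_F)
  then obtain C' where "QM (1 / (real u / real v)) C'" using growthF_QM uv by fastforce
  then have "growthM (1 / (real u / real v)) ((1 / (real u / real v) + 1) * C')"
    by (rule QM_growthM) (use uv in simp)
  moreover have "1 / (real u / real v) > 0" using uv by simp
  ultimately show ?thesis using b by blast
qed

text \<open>The slope enters as a fraction v / u, because its numerator and denominator become the
  exponents of tau and t in the definition of purity.\<close>

lemma growth_imp_pure:
  assumes b: "kt_basis q d D r bs" and g: "growthM (real v / real u) C" and uv: "u > 0" "v > 0"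
  shows "pure q d D"
proof -
  interpret tbasis q K d D r bs by unfold_locales (rule b)
  have "\<forall>k. \<exists>ps. k < r \<longrightarrow> tau_act q (bs k) = comb r ps bs" using comb_ex tau_Mot bs_Mot by blast
  then obtain A where A: "\<And>k. k < r \<Longrightarrow> tau_act q (bs k) = comb r (A k) bs" by metis
  interpret tfls q K d D r bs A by unfold_locales (rule A)
  have s: "real v / real u > 0" using uv by simp
  obtain C' where "QM (real v / real u) C'" using growthM_QM[OF g s] by blast
  then have "growthF (1 / (real v / real u)) (C' / (real v / real u) + C')" by (rule QM_growthF) (rule s)
  then have "growthT (1 / (real v / real u)) (C' / (real v / real u) + C')" by (rule growthF_T)
  then have "growthT (real u / real v) (C' / (real v / real u) + C')" by simp
  then obtain L where "is_lattice r L" "shv (int u) ` L = Tn v ` L" using growthT_lattice[OF _ uv(2)] by blast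
  then have "is_lattice r L \<and> 0 < u \<and> 0 < v \<and> (\<lambda>x i. fls_X_inv ^ u * x i) ` L = (tau_fl q r A ^^ v) ` L"
    using uv unfolding X_inv_shv by blast
  then show ?thesis unfolding pure_def using b A by blast
qed

end

context tmod_last begin

lemma growth_imp_one_edge:
  assumes dv: "\<And>i. i + 1 < d \<Longrightarrow> \<exists>x. slp_fin x \<and> lam (i + 1) = lam i \<otimes>\<^sub>p x"
    and g: "growthM s C"
  shows "np_one_edge L" "np_slope L = s"
proof -
  have "growthV s C" by (rule growthM_V[OF g])
  then interpret tmod_growth q K d D Q Q' lam h s C
    by unfold_locales (unfold growthV_def, blast+)
  have H: "H > 0" by (rule H_pos[OF dv])
  have L0: "L 0 \<noteq> 0" "real_of_int (fls_subdegree (L 0)) = - s * real H" using growth_imp_const by blast+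
  show "np_slope L = s" unfolding monic_np(1)[OF L_monic L0(1)] L0(2) using H by simp
  then show "np_one_edge L" unfolding monic_np(2)[OF L_monic L0(1)] using H growth_imp_upper by simp
qed

lemma one_edge_imp_growth:
  assumes dv: "\<And>i. i + 1 < d \<Longrightarrow> \<exists>x. slp_fin x \<and> lam (i + 1) = lam i \<otimes>\<^sub>p x"
    and L0: "L 0 \<noteq> 0" and e: "np_one_edge L"
  shows "\<exists>C. growthM (np_slope L) C"
    and "H > 0" "np_slope L = - real_of_int (fls_subdegree (L 0)) / real H"
proof -
  show H: "H > 0" using e unfolding monic_np(2)[OF L_monic L0] by blast
  have gL: "gv (np_slope L) L (- np_slope L * real H)" using e unfolding monic_np(2)[OF L_monic L0] by blast
  show s: "np_slope L = - real_of_int (fls_subdegree (L 0)) / real H" by (rule monic_np(1)[OF L_monic L0])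
  have c: "real_of_int (fls_subdegree (L 0)) = - np_slope L * real H" unfolding s using H by simp
  have "straight (np_slope L) (lam i) (h i)" if "i < d" for i by (rule all_straight[OF dv gL L0 c that])
  then obtain C where "growthV (np_slope L) C" unfolding growthV_def using straight_imp_growth by blast
  then show "\<exists>C. growthM (np_slope L) C" using growthV_M by blast
qed

lemma pure_iff_one_edge:
  assumes dv: "\<And>i. i + 1 < d \<Longrightarrow> \<exists>x. slp_fin x \<and> lam (i + 1) = lam i \<otimes>\<^sub>p x"
    and ab: "abelian q d D"
  shows "pure q d D \<longleftrightarrow> np_one_edge L" "pure q d D \<Longrightarrow> weight q d D = 1 / np_slope L"
proof -
  obtain r bs where gen: "gen r bs" using ab unfolding abelian_def gen_def by blast
  have edge: "np_one_edge L \<and> weight q d D = 1 / np_slope L" if p: "pure q d D"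
  proof -
    obtain r bs s C where b: "kt_basis q d D r bs" and s: "s > 0" and g: "growthM s C"
      using pure_imp_growth[OF p] by blast
    note e = growth_imp_one_edge[OF dv g]
    have "weight q d D = real d / (s * real d)"
      unfolding weight_def motive_rank_eq(1)[OF b g s] motive_rank_eq(2)[OF b g s] ..
    then show ?thesis using e d_pos by simp
  qed
  then show "pure q d D \<Longrightarrow> weight q d D = 1 / np_slope L" by blast
  have "pure q d D" if e: "np_one_edge L"
  proof -
    \<comment> \<open>One edge alone does not exclude that t divides \<open>L\<close>; the
      injectivity of D does.\<close>
    have L0: "L 0 \<noteq> 0" by (rule const_nonzero) (rule vD_injective[OF gen])
    note o = one_edge_imp_growth[OF dv L0 e]
    obtain C where g: "growthM (np_slope L) C" using o(1) by blast
    have s: "np_slope L > 0" by (rule growth_pos[OF gen g d_pos])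
    \<comment> \<open>The edge runs from (0, - v) to (\<open>H\<close>, 0), so the slope is the
      fraction v / \<open>H\<close>, which supplies the exponents for purity.\<close>
    define v where "v = nat (- fls_subdegree (L 0))"
    have neg: "fls_subdegree (L 0) < 0"
    proof -
      have "- real_of_int (fls_subdegree (L 0)) / real H > 0" using s by (simp only: o(3)[symmetric])
      then show ?thesis using o(2) by (simp add: divide_less_0_iff)
    qed
    then have v: "v > 0" "real v = - real_of_int (fls_subdegree (L 0))" by (simp_all add: v_def)
    obtain r' bs' where b: "kt_basis q d D r' bs'" using basis_exists[OF gen g s] by blast
    have "growthM (real v / real H) C" using g by (simp only: v(2) o(3)[symmetric])
    then show ?thesis using growth_imp_pure[OF b] o(2) v(1) by blast
  qed
  then show "pure q d D \<longleftrightarrow> np_one_edge L" using edge by blast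
qed

end

theorem theorem7p2:
  fixes q d :: nat and \<theta> :: "'k::field" and D :: "'k skmat" and lam :: "nat \<Rightarrow> 'k slp"
  assumes "fq_setup q TYPE('k)"
    and "tmodule q \<theta> d D"
    and "abelian q d D"
    and "1 \<le> d"
    and "invariant_factors q d D lam"
  shows "(pure q d D \<longleftrightarrow> np_one_edge (lam (d - 1))) \<and>
         (pure q d D \<longrightarrow> weight q d D = 1 / np_slope (lam (d - 1)))"
proof -
  interpret tmod q "TYPE('k)" d D
    by unfold_locales (use assms(1,2) in \<open>simp_all add: tmodule_def\<close>)
  obtain Q Q' h where "tmod_last q TYPE('k) d D Q Q' lam h"
    using invariant_factors_iso[OF assms(5,4)] by blast
  then interpret tmod_last q "TYPE('k)" d D Q Q' lam h .
  have dv: "\<exists>x. slp_fin x \<and> lam (i + 1) = slp_mult q (lam i) x" if "i + 1 < d" for i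
    using assms(5) that unfolding invariant_factors_def by blast
  show ?thesis using pure_iff_one_edge[OF dv assms(3)] unfolding ld_def by blast
qed

end
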